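(* Let $B,C\in\mathbb{Q}[X]$ with $B\ne0$, $\deg B\le2$ and $C$ monic of degree $3$, and let $r$ be the rank of $\mathcal{E}(\mathbb{Q}(T))$ for the elliptic curve $\mathcal{E}\colon Y^2=B(X)T+C(X)$ over $\mathbb{Q}(T)$. Then \[ r=\#\{[\theta]_G:\ B(\theta)=0,\ C(\theta)\text{ is a nonzero square in }\mathbb{Q}(\theta)\}, \] where $[\theta]_G$ is the orbit of $\theta\in\overline{\mathbb{Q}}$ under $G=\mathrm{Gal}(\overline{\mathbb{Q}}/\mathbb{Q})$. In particular $r\le2$, and each value $r\in\{0,1,2\}$ is attained for suitable such $B,C$.
   Context: The equation is read as a Weierstrass equation in $X,Y$ over the field $\mathbb{Q}(T)$ (coefficients of $X^2,X,1$ are polynomials in $T$ of degree $\le1$). *)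

theory Defs
  imports
    "HOL-Algebra.Algebraic_Closure_Type"
    "HOL-Algebra.Generated_Fields"
    "HOL-Algebra.QuotRing"
    "HOL-Library.Extended_Nat"
begin

section \<open>Rank of an abelian group\<close>

definition Z_independent :: "('a, 'b) monoid_scheme \<Rightarrow> 'a set \<Rightarrow> bool" where
  "Z_independent G S \<longleftrightarrow> finite S \<and> S \<subseteq> carrier G \<and>
     (\<forall>n :: 'a \<Rightarrow> int. finprod G (\<lambda>x. x [^]\<^bsub>G\<^esub> n x) S = \<one>\<^bsub>G\<^esub> \<longrightarrow> (\<forall>x\<in>S. n x = 0))"

text \<open>
  For a commutative group this is the dimension of its tensor product with the rationals;
  the value is \<open>\<infinity>\<close> if there are arbitrarily large independent sets.
\<close>
definition group_rank :: "('a, 'b) monoid_scheme \<Rightarrow> enat" where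
  "group_rank G = (SUP S \<in> {S. Z_independent G S}. enat (card S))"


section \<open>Weierstrass curves \<open>Y\<^sup>2 = f(X)\<close>\<close>

text \<open>
  Throughout, \<open>f = X\<^sup>3 + a\<^sub>2 X\<^sup>2 + a\<^sub>4 X + a\<^sub>6\<close> is a monic cubic polynomial over a field of
  characteristic 0, i.e. the Weierstrass equation has \<open>a\<^sub>1 = a\<^sub>3 = 0\<close>.
\<close>

definition weierstrass_disc :: "'a :: field_char_0 poly \<Rightarrow> 'a" where
  "weierstrass_disc f =
     (let a2 = Polynomial.coeff f 2; a4 = Polynomial.coeff f 1; a6 = Polynomial.coeff f 0
      in 16 * (a2^2 * a4^2 - 4 * a4^3 - 4 * a2^3 * a6 - 27 * a6^2 + 18 * a2 * a4 * a6))"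

text \<open>Nonsingularity of the Weierstrass equation is nonvanishing of its discriminant.\<close>
definition is_elliptic :: "'a :: field_char_0 poly \<Rightarrow> bool" where
  "is_elliptic f \<longleftrightarrow> Polynomial.degree f = 3 \<and> Polynomial.lead_coeff f = 1 \<and> weierstrass_disc f \<noteq> 0"

datatype 'a ec_point = Infinity | Affine 'a 'a

definition ec_points :: "'a :: field_char_0 poly \<Rightarrow> 'a ec_point set" where
  "ec_points f = insert Infinity {Affine x y | x y. y^2 = poly f x}"

text \<open>
  The third intersection point of the line of slope \<open>m\<close> through \<open>(x1, y1)\<close> and \<open>(x2, y2)\<close>
  has abscissa \<open>m\<^sup>2 - a\<^sub>2 - x1 - x2\<close>; the sum is its reflection in the \<open>X\<close>-axis.
\<close>
fun ec_add :: "'a :: field_char_0 poly \<Rightarrow> 'a ec_point \<Rightarrow> 'a ec_point \<Rightarrow> 'a ec_point" where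
  "ec_add f Infinity Q = Q"
| "ec_add f P Infinity = P"
| "ec_add f (Affine x1 y1) (Affine x2 y2) =
     (if x1 = x2 \<and> y1 = - y2 then Infinity
      else
        let m = (if x1 = x2 then poly (pderiv f) x1 / (2 * y1) else (y2 - y1) / (x2 - x1));
            x3 = m^2 - Polynomial.coeff f 2 - x1 - x2
        in Affine x3 (m * (x1 - x3) - y1))"

definition ec_group :: "'a :: field_char_0 poly \<Rightarrow> 'a ec_point monoid" where
  "ec_group f = \<lparr>carrier = ec_points f, monoid.mult = ec_add f, one = Infinity\<rparr>"


section \<open>The curve \<open>Y\<^sup>2 = B(X) T + C(X)\<close> over \<open>\<rat>(T)\<close>\<close>

text \<open>The field \<open>\<rat>(T)\<close> is \<^typ>\<open>rat poly fract\<close>, with \<open>T\<close> the class of \<open>[:0, 1:]\<close>.\<close>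

definition const_QT :: "rat \<Rightarrow> rat poly fract" where
  "const_QT c = to_fract [:c:]"

definition T_QT :: "rat poly fract" where
  "T_QT = to_fract [:0, 1:]"

definition curve_BC :: "rat poly \<Rightarrow> rat poly \<Rightarrow> rat poly fract poly" where
  "curve_BC B C = smult T_QT (map_poly const_QT B) + map_poly const_QT C"


section \<open>Galois orbits\<close>

text \<open>The algebraic closure of \<open>\<rat>\<close> is \<^typ>\<open>rat alg_closure\<close>, with embedding \<^const>\<open>to_ac\<close>.\<close>

definition Gal_Q :: "(rat alg_closure \<Rightarrow> rat alg_closure) set" where
  "Gal_Q = {\<sigma> \<in> ring_iso ring_of_type_algebra ring_of_type_algebra. \<forall>q. \<sigma> (to_ac q) = to_ac q}"

definition Gal_orbit :: "rat alg_closure \<Rightarrow> rat alg_closure set" where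
  "Gal_orbit \<theta> = (\<lambda>\<sigma>. \<sigma> \<theta>) ` Gal_Q"

definition Q_adjoin :: "rat alg_closure \<Rightarrow> rat alg_closure set" where
  "Q_adjoin \<theta> = generate_field ring_of_type_algebra (insert \<theta> (range to_ac))"

definition eval_ac :: "rat poly \<Rightarrow> rat alg_closure \<Rightarrow> rat alg_closure" where
  "eval_ac p \<theta> = poly (map_poly to_ac p) \<theta>"

definition square_value_orbits :: "rat poly \<Rightarrow> rat poly \<Rightarrow> rat alg_closure set set" where
  "square_value_orbits B C =
     {Gal_orbit \<theta> | \<theta>. eval_ac B \<theta> = 0 \<and> eval_ac C \<theta> \<noteq> 0 \<and>
                       (\<exists>s \<in> Q_adjoin \<theta>. eval_ac C \<theta> = s^2)}"

end

theory Submission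
  imports Defs
begin

text \<open>
  Over \<open>K = \<rat>(T)\<close> a point \<open>(x\<^sub>0, y\<^sub>0)\<close> is sent to the class of the ideal \<open>(x - x\<^sub>0, y - y\<^sub>0)\<close> of
  \<open>R = K[x, y]\<close>, where \<open>y\<^sup>2 = f(x) = B(x) T + C(x)\<close>. This turns addition of points into multiplication
  of ideal classes and is injective, which makes the group law associative.

  As \<open>f\<close> is linear in \<open>T\<close>, the ring \<open>\<rat>[T, x, y]\<close> is \<open>\<rat>[x, y]\<close> once \<open>B\<close> is inverted, and this
  forces the ideal classes to live above the roots of \<open>B\<close>. Concretely, a dimension count gives in
  every point class an ideal whose norm \<open>g\<close> lies in \<open>\<rat>[x]\<close>. A monic irreducible factor \<open>q\<close> of \<open>g\<close> is
  inert if it does not divide \<open>B\<close> (compare the parities of the degrees in \<open>T\<close>) or if \<open>C\<close> is not a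
  square modulo \<open>q\<close>; it is ramified if \<open>q\<close> divides \<open>B\<close> and \<open>C\<close>; and it splits as
  \<open>(q, y - s) (q, y + s)\<close> if \<open>q\<close> divides \<open>B\<close> and \<open>C \<equiv> s\<^sup>2 \<noteq> 0\<close> modulo \<open>q\<close>. Up to squaring, only the split
  factors contribute. Conversely their classes are independent: a generator \<open>a + b y\<close> of a principal
  ideal with norm in \<open>\<rat>[x]\<close> has \<open>b = 0\<close>, again by parity of degrees, so if \<open>q\<close> divides the norm, the
  ideal is contained in both primes above \<open>q\<close>. Finally, the split factors correspond to the orbits of roots \<open>\<theta>\<close> of \<open>B\<close> at which \<open>C\<close> is a
  nonzero square in \<open>\<rat>(\<theta>)\<close>.
\<close>

section \<open>Products of additive subgroups of a field\<close>

text \<open>All ideals live as plain subsets of one field, an algebraic closure of K(x), and those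
  to be inverted satisfy an equation I conj(I) = (u) with u a nonzero polynomial in x. This one
  equation supplies inverses and cancellation, and, when u lies in Q[x], also the rule that to
  contain is to divide; squarefreeness of f is what makes it hold for (u, y - v). Injectivity on
  points rests on the degree in x: as deg f = 3, the norm a^2 - b^2 f has degree at least 3 unless b
  = 0, while the norms that have to be excluded have degree at most 2. The passage to squares is
  forced by the ramified factors: (q, y) need not be principal, but its square is (q). So only
  doubles of points are shown to lie in the span of the split points, which is enough for the rank.
  Each parity argument singles out one variable as the main one: f is linear in T with leading
  coefficient B, and monic of degree 3 in x. Hence the translation between Q[x][T] and Q(T)[x],
  where Gauss's lemma keeps divisibility by a polynomial in x alone unchanged.\<close>

definition is_submodule :: "'a::comm_ring_1 set \<Rightarrow> 'a set \<Rightarrow> bool" where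
  "is_submodule R I \<longleftrightarrow> 0 \<in> I \<and> (\<forall>x\<in>I. \<forall>y\<in>I. x + y \<in> I) \<and> (\<forall>r\<in>R. \<forall>x\<in>I. r * x \<in> I)"

text \<open>Finite sums of products, one summand at a time. For ideals this is the usual product,
  but commutativity and associativity already hold for arbitrary sets.\<close>

inductive_set set_prod :: "'a::comm_ring_1 set \<Rightarrow> 'a set \<Rightarrow> 'a set" (infixl \<open>\<bullet>\<close> 70)
  for I J where
  zero: "0 \<in> I \<bullet> J"
| step: "a \<in> I \<Longrightarrow> b \<in> J \<Longrightarrow> s \<in> I \<bullet> J \<Longrightarrow> a * b + s \<in> I \<bullet> J"

abbreviation scale :: "'a::comm_ring_1 \<Rightarrow> 'a set \<Rightarrow> 'a set" where
  "scale c I \<equiv> (*) c ` I"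

text \<open>Equality of ideal classes. The factor ranges over the whole ambient field; between
  nonzero ideals of a ring R it is automatically a quotient of elements of R.\<close>

definition similar :: "'a::field set \<Rightarrow> 'a set \<Rightarrow> bool" (infix \<open>\<approx>\<close> 50) where
  "I \<approx> J \<longleftrightarrow> (\<exists>c. c \<noteq> 0 \<and> J = scale c I)"

lemma set_prodI: "a \<in> I \<Longrightarrow> b \<in> J \<Longrightarrow> a * b \<in> I \<bullet> J"
  using set_prod.step[OF _ _ set_prod.zero] by fastforce

lemma set_prod_add: "x \<in> I \<bullet> J \<Longrightarrow> y \<in> I \<bullet> J \<Longrightarrow> x + y \<in> I \<bullet> J"
  by (induction rule: set_prod.induct) (auto simp: add.assoc intro: set_prod.step)

lemma set_prod_least:
  assumes "\<And>a b. a \<in> I \<Longrightarrow> b \<in> J \<Longrightarrow> a * b \<in> K" "0 \<in> K" "\<And>x y. x \<in> K \<Longrightarrow> y \<in> K \<Longrightarrow> x + y \<in> K"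
  shows "I \<bullet> J \<subseteq> K"
proof
  fix x assume "x \<in> I \<bullet> J"
  then show "x \<in> K" by induction (use assms in auto)
qed

lemma set_prod_comm: "I \<bullet> J = J \<bullet> I"
proof -
  have "I \<bullet> J \<subseteq> J \<bullet> I" for I J :: "'a set"
  proof (rule set_prod_least)
    fix a b assume "a \<in> I" "b \<in> J"
    then show "a * b \<in> J \<bullet> I" using set_prodI[of b J a I] by (simp add: mult.commute)
  qed (auto intro: set_prod.zero set_prod_add)
  then show ?thesis by blast
qed

lemma set_prod_assoc_le: "(I \<bullet> J) \<bullet> K \<subseteq> I \<bullet> (J \<bullet> K)"
proof (rule set_prod_least)
  fix x k assume x: "x \<in> I \<bullet> J" and k: "k \<in> K"
  from x show "x * k \<in> I \<bullet> (J \<bullet> K)"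
  proof induction
    case (step a b s)
    have "(a * b + s) * k = a * (b * k) + s * k" by (simp add: algebra_simps)
    then show ?case using step k by (auto intro: set_prod.step set_prodI)
  qed (simp add: set_prod.zero)
qed (auto intro: set_prod.zero set_prod_add)

lemma set_prod_assoc: "(I \<bullet> J) \<bullet> K = I \<bullet> (J \<bullet> K)"
proof
  have "I \<bullet> (J \<bullet> K) = (K \<bullet> J) \<bullet> I" by (metis set_prod_comm)
  also have "\<dots> \<subseteq> K \<bullet> (J \<bullet> I)" by (rule set_prod_assoc_le)
  also have "\<dots> = (I \<bullet> J) \<bullet> K" by (metis set_prod_comm)
  finally show "I \<bullet> (J \<bullet> K) \<subseteq> (I \<bullet> J) \<bullet> K" .
qed (rule set_prod_assoc_le)

lemma set_prod_left_comm: "I \<bullet> (J \<bullet> K) = J \<bullet> (I \<bullet> K)"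
  by (metis set_prod_assoc set_prod_comm)

lemmas set_prod_ac = set_prod_assoc set_prod_comm set_prod_left_comm

lemma set_prod_mono: "I \<subseteq> I' \<Longrightarrow> J \<subseteq> J' \<Longrightarrow> I \<bullet> J \<subseteq> I' \<bullet> J'"
  by (rule set_prod_least) (auto intro: set_prodI set_prod.zero set_prod_add)

lemma set_prod_submodule:
  assumes "is_submodule R I" shows "is_submodule R (I \<bullet> J)"
proof -
  have "r * x \<in> I \<bullet> J" if "r \<in> R" "x \<in> I \<bullet> J" for r x
    using that(2)
  proof induction
    case (step a b s)
    have "r * (a * b + s) = (r * a) * b + r * s" by (simp add: algebra_simps)
    then show ?case using step assms that(1) by (auto simp: is_submodule_def intro: set_prod.step)
  qed (simp add: set_prod.zero)
  then show ?thesis by (auto simp: is_submodule_def intro: set_prod.zero set_prod_add)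
qed

lemma set_prod_unit:
  assumes "is_submodule R I" "1 \<in> R" shows "R \<bullet> I = I"
proof
  show "R \<bullet> I \<subseteq> I" using assms(1) by (intro set_prod_least) (auto simp: is_submodule_def)
  show "I \<subseteq> R \<bullet> I" using set_prodI[OF assms(2)] by fastforce
qed

lemma scale_scale: "scale c (scale d I) = scale (c * d) I"
  by (auto simp: image_image mult.assoc)

lemma scale_one [simp]: "scale 1 I = I"
  by auto

lemma scale_cancel:
  fixes c :: "'a::field"
  assumes "scale c I = scale c J" "c \<noteq> 0" shows "I = J"
  using assms by (metis inj_image_eq_iff injI mult_cancel_left)

lemma set_prod_scale: "scale c I \<bullet> J = scale c (I \<bullet> J)"
proof
  show "scale c I \<bullet> J \<subseteq> scale c (I \<bullet> J)"
  proof (rule set_prod_least)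
    fix a b assume "a \<in> scale c I" "b \<in> J"
    then obtain a' where "a' \<in> I" "a = c * a'" by auto
    then show "a * b \<in> scale c (I \<bullet> J)"
      using \<open>b \<in> J\<close> set_prodI[of a' I b J] by (auto simp: mult.assoc)
  next
    show "0 \<in> scale c (I \<bullet> J)" using set_prod.zero by (rule image_eqI[rotated]) simp
  next
    fix x y assume "x \<in> scale c (I \<bullet> J)" "y \<in> scale c (I \<bullet> J)"
    then obtain x' y' where "x' \<in> I \<bullet> J" "y' \<in> I \<bullet> J" "x = c * x'" "y = c * y'" by auto
    then show "x + y \<in> scale c (I \<bullet> J)"
      using set_prod_add[of x' I J y'] by (auto simp: distrib_left[symmetric])
  qed
  show "scale c (I \<bullet> J) \<subseteq> scale c I \<bullet> J"
  proof safe
    fix x assume "x \<in> I \<bullet> J"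
    then show "c * x \<in> scale c I \<bullet> J"
    proof induction
      case (step a b s)
      have "c * (a * b + s) = (c * a) * b + c * s" by (simp add: algebra_simps)
      then show ?case using step by (auto intro: set_prod.step)
    qed (simp add: set_prod.zero)
  qed
qed

lemma set_prod_scale_right: "I \<bullet> scale c J = scale c (I \<bullet> J)"
  by (metis set_prod_comm set_prod_scale)

lemma is_submodule_scale: "is_submodule R I \<Longrightarrow> is_submodule R (scale c I)"
proof -
  assume I: "is_submodule R I"
  have "0 \<in> scale c I" using I by (intro image_eqI[of _ _ 0]) (auto simp: is_submodule_def)
  moreover have "x + y \<in> scale c I" if "x \<in> scale c I" "y \<in> scale c I" for x y
    using that I by (auto simp: is_submodule_def distrib_left[symmetric])
  moreover have "r * x \<in> scale c I" if "r \<in> R" "x \<in> scale c I" for r x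
    using that I by (auto simp: is_submodule_def mult.left_commute[of r c])
  ultimately show ?thesis by (auto simp: is_submodule_def)
qed

lemma similar_refl [simp]: "I \<approx> I"
  unfolding similar_def by (rule exI[of _ 1]) simp

lemma similar_sym: "I \<approx> J \<Longrightarrow> J \<approx> I"
proof -
  assume "I \<approx> J"
  then obtain c where c: "c \<noteq> 0" "J = scale c I" by (auto simp: similar_def)
  then have "scale (inverse c) J = I" by (simp add: scale_scale)
  then show ?thesis using c(1) unfolding similar_def by (intro exI[of _ "inverse c"]) simp
qed

lemma similar_trans [trans]: "I \<approx> J \<Longrightarrow> J \<approx> K \<Longrightarrow> I \<approx> K"
proof -
  assume "I \<approx> J" "J \<approx> K"
  then obtain c d where "c \<noteq> 0" "J = scale c I" "d \<noteq> 0" "K = scale d J" by (auto simp: similar_def)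
  then show ?thesis unfolding similar_def by (intro exI[of _ "d * c"]) (simp add: scale_scale)
qed

lemma similar_scale: "c \<noteq> 0 \<Longrightarrow> I \<approx> scale c I"
  unfolding similar_def by auto

lemma similar_prod: "I \<approx> I' \<Longrightarrow> J \<approx> J' \<Longrightarrow> I \<bullet> J \<approx> I' \<bullet> J'"
proof -
  assume "I \<approx> I'" "J \<approx> J'"
  then obtain c d where "c \<noteq> 0" "I' = scale c I" "d \<noteq> 0" "J' = scale d J" by (auto simp: similar_def)
  then show ?thesis unfolding similar_def
    by (intro exI[of _ "d * c"]) (simp add: scale_scale set_prod_scale set_prod_scale_right)
qed

text \<open>Multiplication by I' turns both sides into g times the module, and g is invertible in
  the field.\<close>

lemma set_prod_cancel:
  fixes g :: "'a::field"
  assumes "I \<bullet> I' = scale g R" "g \<noteq> 0" "1 \<in> R" "is_submodule R J" "is_submodule R K" "I \<bullet> J = I \<bullet> K"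
  shows "J = K"
proof -
  have "scale g J = scale g K"
  proof -
    have "scale g A = I' \<bullet> (I \<bullet> A)" if "is_submodule R A" for A
    proof -
      have "I' \<bullet> (I \<bullet> A) = (I \<bullet> I') \<bullet> A" by (simp only: set_prod_ac)
      then show ?thesis using that assms by (simp add: set_prod_scale set_prod_unit)
    qed
    then show ?thesis using assms by simp
  qed
  then show ?thesis using assms(2) by (rule scale_cancel)
qed

section \<open>The ring \<open>k[x, y]\<close> with \<open>y\<^sup>2 = f(x)\<close>\<close>

lemma poly_submodule_principal:
  fixes I :: "'a::field poly set"
  assumes I: "is_submodule UNIV I"
  obtains d where "d \<in> I" "\<And>x. x \<in> I \<Longrightarrow> d dvd x"
proof (cases "I \<subseteq> {0}")
  case True
  then show ?thesis using that[of 0] I by (auto simp: is_submodule_def)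
next
  case False
  define d where "d = arg_min Polynomial.degree (\<lambda>x. x \<in> I \<and> x \<noteq> 0)"
  have d: "d \<in> I" "d \<noteq> 0" "\<And>x. x \<in> I \<Longrightarrow> x \<noteq> 0 \<Longrightarrow> Polynomial.degree d \<le> Polynomial.degree x"
    using arg_min_nat_lemma[of "\<lambda>x. x \<in> I \<and> x \<noteq> 0" _ Polynomial.degree] False
    unfolding d_def by blast+
  have "d dvd x" if "x \<in> I" for x
  proof (rule ccontr)
    assume "\<not> d dvd x"
    then have nz: "x mod d \<noteq> 0" by (simp add: dvd_eq_mod_eq_0)
    have "x mod d = x + (- (x div d)) * d" by (metis add_uminus_conv_diff minus_div_mult_eq_mod mult_minus_left)
    also have "\<dots> \<in> I" using I that d(1) unfolding is_submodule_def by blast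
    finally have "Polynomial.degree d \<le> Polynomial.degree (x mod d)" using d(3) nz by blast
    moreover have "Polynomial.degree (x mod d) < Polynomial.degree d"
      using degree_mod_less'[OF d(2) nz] .
    ultimately show False by simp
  qed
  then show ?thesis using that d(1) by blast
qed

text \<open>Three polynomials, because the coprimality used for products of ideals concerns triples
  such as u1, u2, 2v.\<close>

lemma poly_bezout3:
  fixes a b c :: "'a::field poly"
  obtains d p q r where "d = p * a + q * b + r * c" "d dvd a" "d dvd b" "d dvd c"
proof -
  define I where "I = {p * a + q * b + r * c | p q r. True}"
  have "is_submodule UNIV I"
    unfolding is_submodule_def
  proof (intro conjI ballI)
    show "0 \<in> I" unfolding I_def by (rule CollectI, rule exI[of _ 0], rule exI[of _ 0], rule exI[of _ 0]) simp
  next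
    fix u v assume "u \<in> I" "v \<in> I"
    then obtain p q r p' q' r' where "u = p * a + q * b + r * c" "v = p' * a + q' * b + r' * c"
      unfolding I_def by blast
    then have "u + v = (p + p') * a + (q + q') * b + (r + r') * c" by (simp add: algebra_simps)
    then show "u + v \<in> I" unfolding I_def by blast
  next
    fix u v assume "v \<in> I"
    then obtain p q r where "v = p * a + q * b + r * c" unfolding I_def by blast
    then have "u * v = (u * p) * a + (u * q) * b + (u * r) * c" by (simp add: algebra_simps)
    then show "u * v \<in> I" unfolding I_def by blast
  qed
  then obtain d where d: "d \<in> I" "\<And>x. x \<in> I \<Longrightarrow> d dvd x"
    using poly_submodule_principal by blast
  have "a \<in> I" unfolding I_def by (rule CollectI, rule exI[of _ 1], rule exI[of _ 0], rule exI[of _ 0]) simp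
  moreover have "b \<in> I" unfolding I_def by (rule CollectI, rule exI[of _ 0], rule exI[of _ 1], rule exI[of _ 0]) simp
  moreover have "c \<in> I" unfolding I_def by (rule CollectI, rule exI[of _ 0], rule exI[of _ 0], rule exI[of _ 1]) simp
  moreover obtain p q r where "d = p * a + q * b + r * c" using d(1) unfolding I_def by blast
  ultimately show ?thesis using d(2) by (intro that[of d p q r]) auto
qed

lemma smult_2: "Polynomial.smult (2 :: 'a::comm_ring_1) p = p + p"
  by (simp only: one_add_one[symmetric] smult_add_left smult_1_left)

text \<open>The degree of a^2 is even and that of b^2 f is odd, so the leading terms cannot
  cancel.\<close>

lemma degree_norm_odd:
  fixes a b f :: "'a::idom poly"
  assumes "odd (Polynomial.degree f)" "b \<noteq> 0"
  shows "Polynomial.degree (a * a - b * b * f) \<ge> 2 * Polynomial.degree b + Polynomial.degree f"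
proof -
  have f0: "f \<noteq> 0" using assms(1) by auto
  have 1: "Polynomial.degree (b * b * f) = 2 * Polynomial.degree b + Polynomial.degree f"
    using assms f0 by (simp add: degree_mult_eq)
  have 2: "Polynomial.degree (a * a) = 2 * Polynomial.degree a" by (cases "a = 0") (auto simp: degree_mult_eq)
  have "2 * Polynomial.degree a \<noteq> 2 * Polynomial.degree b + Polynomial.degree f" using assms(1) by presburger
  then consider "Polynomial.degree (a * a) < Polynomial.degree (b * b * f)"
    | "Polynomial.degree (b * b * f) < Polynomial.degree (a * a)"
    using 1 2 by linarith
  then show ?thesis
  proof cases
    case 1
    then have "Polynomial.degree (- (b * b * f) + a * a) = Polynomial.degree (- (b * b * f))"
      by (intro degree_add_eq_left) simp
    then show ?thesis using \<open>Polynomial.degree (b * b * f) = _\<close> by simp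
  next
    case 2
    then have "Polynomial.degree (a * a + - (b * b * f)) = Polynomial.degree (a * a)"
      by (intro degree_add_eq_left) simp
    then show ?thesis using 2 1 by simp
  qed
qed

text \<open>The target is algebraically closed, so it contains a square root y of f, and it is a
  field, so ideals can be scaled by inverses.\<close>

definition emb :: "'k::field_char_0 poly \<Rightarrow> 'k poly fract alg_closure" where
  "emb p = to_ac (to_fract p)"

lemma emb_simps [simp]:
  "emb 0 = 0" "emb 1 = 1" "emb (p + q) = emb p + emb q" "emb (p * q) = emb p * emb q"
  "emb (p - q) = emb p - emb q" "emb (- p) = - emb p"
  unfolding emb_def by (simp_all flip: to_ac_minus)

lemma emb_eq_iff [simp]: "emb p = emb q \<longleftrightarrow> p = q"
  unfolding emb_def by simp

lemma emb_eq_0_iff [simp]: "emb p = 0 \<longleftrightarrow> p = 0"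
  using emb_eq_iff[of p 0] by (simp del: emb_eq_iff)

text \<open>Squarefreeness is nonsingularity of the affine curve; it enters through
  \<open>unit_if_dvd\<close> and makes the ideals (u, y - v) invertible.\<close>

locale squarefree_cubic =
  fixes f :: "'k::field_char_0 poly"
  assumes deg_f: "Polynomial.degree f = 3" and sqfree: "\<And>d. d * d dvd f \<Longrightarrow> is_unit d"
begin

definition yy :: "'k poly fract alg_closure" where "yy = (SOME z. z ^ 2 = emb f)"

lemma yy_sq: "yy * yy = emb f"
proof -
  have "\<exists>z. z ^ 2 = emb f" using nth_root_exists[of 2 "emb f"] by auto
  then show ?thesis unfolding yy_def by (metis (mono_tags, lifting) power2_eq_square someI_ex)
qed

lemma yy_sq': "yy * (yy * z) = emb f * z"
  by (metis mult.assoc yy_sq)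

definition el :: "'k poly \<Rightarrow> 'k poly \<Rightarrow> 'k poly fract alg_closure" where
  "el a b = emb a + emb b * yy"

definition R :: "'k poly fract alg_closure set" where "R = {el a b | a b. True}"

lemma el_add: "el a b + el c d = el (a + c) (b + d)"
  by (simp add: el_def algebra_simps)

lemma el_mult: "el a b * el c d = el (a * c + b * d * f) (a * d + b * c)"
  by (simp add: el_def algebra_simps yy_sq yy_sq')

lemma el_0 [simp]: "el 0 0 = 0" and el_1 [simp]: "el 1 0 = 1" and emb_el: "emb a = el a 0"
  by (simp_all add: el_def)

lemma degree_norm:
  assumes "b \<noteq> 0"
  shows "Polynomial.degree (a * a - b * b * f) \<ge> 2 * Polynomial.degree b + 3"
    "a * a - b * b * f \<noteq> 0"
proof -
  show "Polynomial.degree (a * a - b * b * f) \<ge> 2 * Polynomial.degree b + 3"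
    using degree_norm_odd[OF _ assms, of f a] deg_f by simp
  then show "a * a - b * b * f \<noteq> 0" by auto
qed

lemma norm_eq_0_iff: "a * a - b * b * f = 0 \<longleftrightarrow> a = 0 \<and> b = 0"
  using degree_norm(2)[of b a] by (cases "b = 0") auto

text \<open>A relation a - c = (d - b) y becomes, after squaring, an element of norm zero, which the
  parity of degrees forbids unless both coefficients vanish. Hence 1 and y are linearly independent
  over k[x].\<close>

lemma el_eq_iff [simp]: "el a b = el c d \<longleftrightarrow> a = c \<and> b = d"
proof
  assume "el a b = el c d"
  then have "emb (a - c) = emb (d - b) * yy" by (simp add: el_def algebra_simps)
  then have "emb (a - c) * emb (a - c) = (emb (d - b) * yy) * (emb (d - b) * yy)" by simp
  also have "\<dots> = emb (d - b) * emb (d - b) * (yy * yy)" by (simp only: ac_simps)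
  also have "\<dots> = emb ((d - b) * (d - b) * f)" by (simp only: yy_sq emb_simps)
  finally have "emb ((a - c) * (a - c) - (d - b) * (d - b) * f) = 0" by simp
  then have "(a - c) * (a - c) - (d - b) * (d - b) * f = 0" by (simp only: emb_eq_0_iff)
  then show "a = c \<and> b = d" using norm_eq_0_iff by auto
qed simp

lemma el_eq_0_iff [simp]: "el a b = 0 \<longleftrightarrow> a = 0 \<and> b = 0"
  using el_eq_iff[of a b 0 0] by (simp del: el_eq_iff)

lemma RE: assumes "z \<in> R" obtains a b where "z = el a b"
  using assms by (auto simp: R_def)

lemma el_in_R [simp]: "el a b \<in> R" and one_in_R [simp]: "1 \<in> R" and zero_in_R [simp]: "0 \<in> R"
  and emb_in_R [simp]: "emb a \<in> R"
proof -
  show *: "el a b \<in> R" for a b unfolding R_def by blast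
  show "1 \<in> R" "0 \<in> R" "emb a \<in> R" using *[of 1 0] *[of 0 0] *[of a 0] by (simp_all add: emb_el)
qed

lemma R_closed: "z \<in> R \<Longrightarrow> w \<in> R \<Longrightarrow> z + w \<in> R" "z \<in> R \<Longrightarrow> w \<in> R \<Longrightarrow> z * w \<in> R"
  by (auto elim!: RE simp: el_add el_mult)

lemma R_submodule: "is_submodule R R"
  by (auto simp: is_submodule_def R_closed)

lemma submodule_R_eq: "is_submodule R I \<Longrightarrow> I \<subseteq> R \<Longrightarrow> 1 \<in> I \<Longrightarrow> I = R"
  unfolding is_submodule_def by force

lemma set_prod_R: "is_submodule R I \<Longrightarrow> R \<bullet> I = I" "is_submodule R I \<Longrightarrow> I \<bullet> R = I"
  using set_prod_unit[of R I] by (auto simp: set_prod_comm)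

lemma set_prod_subset_R: "I \<subseteq> R \<Longrightarrow> J \<subseteq> R \<Longrightarrow> I \<bullet> J \<subseteq> R"
  by (rule set_prod_least) (auto intro: R_closed)

lemma scale_emb_R_mem: "el a b \<in> scale (emb u) R \<longleftrightarrow> u dvd a \<and> u dvd b"
proof
  assume "el a b \<in> scale (emb u) R"
  then obtain z where "z \<in> R" "el a b = emb u * z" by blast
  then obtain c d where "el a b = emb u * el c d" by (metis RE)
  then show "u dvd a \<and> u dvd b" by (auto simp: emb_el el_mult)
next
  assume "u dvd a \<and> u dvd b"
  then obtain c d where "a = u * c" "b = u * d" by (auto elim!: dvdE)
  then have "el a b = emb u * el c d" by (simp add: emb_el el_mult)
  then show "el a b \<in> scale (emb u) R" by auto
qed

text \<open>The ideal \<open>(u, y - v)\<close> when \<open>u\<close> divides \<open>f - v\<^sup>2\<close>.\<close>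

definition M :: "'k poly \<Rightarrow> 'k poly \<Rightarrow> 'k poly fract alg_closure set" where
  "M u v = {el a b | a b. u dvd a + b * v}"

lemma M_mem [simp]: "el a b \<in> M u v \<longleftrightarrow> u dvd a + b * v"
  by (auto simp: M_def)

lemma M_subset_R: "M u v \<subseteq> R"
  by (auto simp: M_def)

lemma ME: assumes "z \<in> M u v" obtains a b where "z = el a b" "u dvd a + b * v"
  using assms by (auto simp: M_def)

text \<open>Modulo u, the substitution y -> v is a ring homomorphism on R, because y^2 = f and u
  divides f - v^2; \<open>M u v\<close> is its kernel.\<close>

lemma M_submodule:
  assumes "u dvd f - v * v" shows "is_submodule R (M u v)"
  unfolding is_submodule_def
proof (intro conjI ballI)
  show "0 \<in> M u v" using M_mem[of 0 0 u v] by simp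
next
  fix z w assume "z \<in> M u v" "w \<in> M u v"
  then obtain a b c d where z: "z = el a b" "u dvd a + b * v" "w = el c d" "u dvd c + d * v"
    by (auto elim!: ME)
  have "(a + c) + (b + d) * v = (a + b * v) + (c + d * v)" by (simp add: algebra_simps)
  then have "u dvd (a + c) + (b + d) * v" using z by (simp only: dvd_add)
  then show "z + w \<in> M u v" using z by (simp add: el_add)
next
  fix z w assume "z \<in> R" "w \<in> M u v"
  then obtain a b c d where z: "z = el a b" "w = el c d" "u dvd c + d * v"
    by (auto elim!: ME RE)
  have "(a * c + b * d * f) + (a * d + b * c) * v = (a + b * v) * (c + d * v) + b * d * (f - v * v)"
    by (simp add: algebra_simps)
  then have "u dvd (a * c + b * d * f) + (a * d + b * c) * v"
    using z(3) assms by (metis dvd_add dvd_mult)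
  then show "z * w \<in> M u v" using z by (simp add: el_mult)
qed

lemma M_cong: "u dvd v - v' \<Longrightarrow> M u v = M u v'"
proof -
  assume u: "u dvd v - v'"
  have "u dvd a + b * v \<longleftrightarrow> u dvd a + b * v'" for a b
  proof -
    have "a + b * v = (a + b * v') + b * (v - v')" by (simp add: algebra_simps)
    then show ?thesis using u by (metis dvd_add_left_iff dvd_mult)
  qed
  then show ?thesis by (simp add: M_def)
qed

text \<open>The square of such a d divides both v^2 and a b, hence f. This is the only way in which
  squarefreeness is applied to ideals.\<close>

lemma unit_if_dvd:
  assumes "d dvd a" "d dvd b" "d dvd v" "f = v * v + a * b" shows "is_unit d"
proof (rule sqfree)
  show "d * d dvd f" using assms by (auto intro!: dvd_add mult_dvd_mono)
qed

lemma submodule_sum: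
  assumes "is_submodule R I" "x \<in> I" "y \<in> I" "z \<in> I"
  shows "emb p * x + emb q * y + emb r * z \<in> I"
  using assms by (auto simp: is_submodule_def)

lemma comb_unit_mem:
  assumes I: "is_submodule R I" and e: "e = p * a + q * b + r * c" "is_unit e"
    and m: "emb a * x \<in> I" "emb b * x \<in> I" "emb c * x \<in> I"
  shows "x \<in> I"
proof -
  obtain k where k: "1 = e * k" using e(2) by (auto elim: dvdE)
  have "emb p * (emb a * x) + emb q * (emb b * x) + emb r * (emb c * x) \<in> I"
    by (rule submodule_sum[OF I m])
  also have "emb p * (emb a * x) + emb q * (emb b * x) + emb r * (emb c * x) = emb e * x"
    by (simp add: e(1) algebra_simps)
  finally have "emb k * (emb e * x) \<in> I" using I by (auto simp: is_submodule_def)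
  also have "emb k * (emb e * x) = emb (e * k) * x" by (simp add: algebra_simps)
  finally show ?thesis unfolding k[symmetric] by simp
qed

lemma dvd_two_mult_iff: "d dvd [:2:] * v \<longleftrightarrow> d dvd v"
  for v :: "'k poly"
  by (auto intro: dvd_smult dest: dvd_smult_cancel)

text \<open>One inclusion is multiplicativity of y -> v modulo u1 u2. For the other, the product
  contains u1 u2 and also the multiples of y - v by u1, u2 and 2v; these three are coprime, as a
  common divisor would divide f twice.\<close>

lemma M_prod:
  assumes "u1 * u2 dvd f - v * v"
  shows "M u1 v \<bullet> M u2 v = M (u1 * u2) v"
proof
  show "M u1 v \<bullet> M u2 v \<subseteq> M (u1 * u2) v"
  proof (rule set_prod_least)
    fix z w assume "z \<in> M u1 v" "w \<in> M u2 v"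
    then obtain a b c d where z: "z = el a b" "u1 dvd a + b * v" "w = el c d" "u2 dvd c + d * v"
      by (auto elim!: ME)
    have "(a * c + b * d * f) + (a * d + b * c) * v = (a + b * v) * (c + d * v) + b * d * (f - v * v)"
      by (simp add: algebra_simps)
    also have "u1 * u2 dvd \<dots>"
      by (rule dvd_add[OF mult_dvd_mono[OF z(2,4)] dvd_mult[OF assms]])
    finally show "z * w \<in> M (u1 * u2) v" using z by (simp add: el_mult)
  qed (use M_submodule[OF assms] in \<open>auto simp: is_submodule_def\<close>)
  obtain k where k: "f - v * v = u1 * u2 * k" using assms by (auto elim: dvdE)
  have d1: "u1 dvd f - v * v" using assms dvd_mult_left by blast
  let ?I = "M u1 v \<bullet> M u2 v"
  have I: "is_submodule R ?I" using M_submodule[OF d1] by (rule set_prod_submodule)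
  have u: "emb u1 \<in> M u1 v" "emb u2 \<in> M u2 v" "el (- v) 1 \<in> M u1 v" "el (- v) 1 \<in> M u2 v"
    by (simp_all add: emb_el)
  obtain d p q r where d: "d = p * u1 + q * u2 + r * ([:2:] * v)" "d dvd u1" "d dvd u2" "d dvd [:2:] * v"
    by (rule poly_bezout3)
  have "is_unit d"
    by (rule unit_if_dvd[of d u1 "u2 * k" v])
      (use d(2,3,4) dvd_two_mult_iff k in \<open>auto simp: algebra_simps\<close>)
  have m12: "emb (u1 * u2) \<in> ?I" using set_prodI[OF u(1,2)] by simp
  have my: "el (- v) 1 \<in> ?I"
  proof (rule comb_unit_mem[OF I d(1) \<open>is_unit d\<close>])
    show "emb u1 * el (- v) 1 \<in> ?I" using set_prodI[OF u(1,4)] .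
    show "emb u2 * el (- v) 1 \<in> ?I" using set_prodI[OF u(3,2)] by (simp add: mult.commute)
    \<comment> \<open>The identity behind this is 2v (y - v) = (f - v^2) - (y - v)^2.\<close>
    have "emb k * emb (u1 * u2) \<in> ?I" using I m12 by (auto simp: is_submodule_def)
    moreover have "emb (- 1) * (el (- v) 1 * el (- v) 1) \<in> ?I"
      using I set_prodI[OF u(3,4)] emb_in_R[of "- 1"] unfolding is_submodule_def by metis
    ultimately have "emb k * emb (u1 * u2) + emb (- 1) * (el (- v) 1 * el (- v) 1) \<in> ?I"
      using I by (auto simp: is_submodule_def)
    also have "emb k * emb (u1 * u2) = emb (f - v * v)" by (simp only: k emb_simps) (simp add: algebra_simps)
    also have "emb (f - v * v) + emb (- 1) * (el (- v) 1 * el (- v) 1) = emb ([:2:] * v) * el (- v) 1"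
      by (simp only: emb_el el_mult el_add el_eq_iff) (simp add: algebra_simps smult_2)
    finally show "emb ([:2:] * v) * el (- v) 1 \<in> ?I" .
  qed
  show "M (u1 * u2) v \<subseteq> ?I"
  proof
    fix z assume "z \<in> M (u1 * u2) v"
    then obtain a b l where z: "z = el a b" "a + b * v = u1 * u2 * l" by (auto elim!: ME dvdE)
    have "emb b * el (- v) 1 + emb l * emb (u1 * u2) \<in> ?I"
      using I m12 my by (auto simp: is_submodule_def)
    also have "emb b * el (- v) 1 + emb l * emb (u1 * u2) = el (l * (u1 * u2) - b * v) b"
      by (simp only: emb_el el_mult el_add el_eq_iff) (simp add: algebra_simps)
    also have "l * (u1 * u2) - b * v = a" using z(2) by (simp add: algebra_simps)
    finally show "z \<in> ?I" using z by simp
  qed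
qed

text \<open>The norm of (u, y - v) is u: the product contains u^2, u w = (y - v)(y + v) and 2v u,
  and u, w, 2v are coprime by squarefreeness.\<close>

lemma M_prod_conj:
  assumes k: "f - v * v = u * w"
  shows "M u v \<bullet> M u (- v) = scale (emb u) R"
proof
  have sm: "is_submodule R (scale (emb u) R)" by (rule is_submodule_scale[OF R_submodule])
  show "M u v \<bullet> M u (- v) \<subseteq> scale (emb u) R"
  proof (rule set_prod_least)
    fix z z' assume "z \<in> M u v" "z' \<in> M u (- v)"
    then obtain a b c d where z: "z = el a b" "u dvd a + b * v" "z' = el c d" "u dvd c + d * - v"
      by (auto elim!: ME)
    have "a * c + b * d * f = (a + b * v) * c + b * d * (f - v * v) + b * v * - (c + d * - v)"
      by (simp add: algebra_simps)
    also have "u dvd \<dots>" unfolding k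
      by (rule dvd_add[OF dvd_add[OF dvd_mult2[OF z(2)] dvd_mult[OF dvd_triv_left]]
            dvd_mult[OF dvd_minus_iff[THEN iffD2, OF z(4)]]])
    finally have "u dvd a * c + b * d * f" .
    moreover have "a * d + b * c = (a + b * v) * d + b * (c + d * - v)" by (simp add: algebra_simps)
    then have "u dvd a * d + b * c" using z by (metis dvd_add dvd_mult dvd_mult2)
    ultimately show "z * z' \<in> scale (emb u) R" using z by (simp add: el_mult scale_emb_R_mem)
  qed (use sm in \<open>auto simp: is_submodule_def\<close>)
  let ?I = "M u v \<bullet> M u (- v)"
  have I: "is_submodule R ?I" by (rule set_prod_submodule[OF M_submodule]) (simp add: k)
  have u: "emb u \<in> M u v" "emb u \<in> M u (- v)" "el (- v) 1 \<in> M u v" "el v 1 \<in> M u (- v)"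
    by (simp_all add: emb_el)
  obtain d p q r where d: "d = p * u + q * w + r * ([:2:] * v)" "d dvd u" "d dvd w" "d dvd [:2:] * v"
    by (rule poly_bezout3)
  have "is_unit d"
    by (rule unit_if_dvd[of d u w v]) (use d(2,3,4) dvd_two_mult_iff k in \<open>auto simp: algebra_simps\<close>)
  have "emb u \<in> ?I"
  proof (rule comb_unit_mem[OF I d(1) \<open>is_unit d\<close>])
    show "emb u * emb u \<in> ?I" using set_prodI[OF u(1,2)] .
    have "emb w * emb u = el (- v) 1 * el v 1"
      using k by (simp only: emb_el el_mult el_eq_iff) (simp add: algebra_simps)
    then show "emb w * emb u \<in> ?I" using set_prodI[OF u(3,4)] by simp
    \<comment> \<open>Here 2v u is written as u (y + v) - u (y - v).\<close>
    have "emb u * el v 1 + emb (- 1) * (el (- v) 1 * emb u) \<in> ?I"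
      using I set_prodI[OF u(1,4)] set_prodI[OF u(3,2)] unfolding is_submodule_def
      by (meson emb_in_R)
    also have "emb u * el v 1 + emb (- 1) * (el (- v) 1 * emb u) = emb ([:2:] * v) * emb u"
      by (simp only: emb_el el_mult el_add el_eq_iff) (simp add: algebra_simps smult_2)
    finally show "emb ([:2:] * v) * emb u \<in> ?I" .
  qed
  then show "scale (emb u) R \<subseteq> ?I"
    using I by (auto simp: is_submodule_def mult.commute)
qed

text \<open>As f - v^2 = (y - v)(y + v), the generator y - v alone suffices; the quotient of a + b y
  by it is b + k (y + v). Geometrically, the curve y = v(x) cuts out a principal divisor.\<close>

lemma M_full: "M (f - v * v) v = scale (el (- v) 1) R"
proof
  show "M (f - v * v) v \<subseteq> scale (el (- v) 1) R"
  proof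
    fix z assume "z \<in> M (f - v * v) v"
    then obtain a b k where z: "z = el a b" "a + b * v = (f - v * v) * k" by (auto elim!: ME dvdE)
    have "el (- v) 1 * el (b + k * v) k = el ((f - v * v) * k - b * v) b"
      by (simp only: el_mult el_eq_iff) (simp add: algebra_simps)
    also have "(f - v * v) * k - b * v = a" by (simp add: z(2)[symmetric])
    finally show "z \<in> scale (el (- v) 1) R" using z(1) by (metis el_in_R imageI)
  qed
  have "is_submodule R (M (f - v * v) v)" by (rule M_submodule) simp
  moreover have "el (- v) 1 \<in> M (f - v * v) v" by simp
  ultimately show "scale (el (- v) 1) R \<subseteq> M (f - v * v) v"
    by (auto simp: is_submodule_def mult.commute)
qed

text \<open>The automorphism y -> -y of R. It is meaningful only on R, with an unspecified value
  elsewhere, so facts about it carry the assumption that the sets lie in R.\<close>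

definition conj_el :: "'k poly fract alg_closure \<Rightarrow> 'k poly fract alg_closure" where
  "conj_el z = (SOME w. \<exists>a b. z = el a b \<and> w = el a (- b))"

lemma conj_el [simp]: "conj_el (el a b) = el a (- b)"
  unfolding conj_el_def by (rule some_equality) auto

lemma conj_el_simps:
  assumes "z \<in> R" "w \<in> R"
  shows "conj_el (z + w) = conj_el z + conj_el w" "conj_el (z * w) = conj_el z * conj_el w"
    "conj_el (conj_el z) = z" "conj_el z \<in> R"
  using assms by (auto elim!: RE simp: el_add el_mult)

lemma conj_prod_le:
  assumes "I \<subseteq> R" "J \<subseteq> R"
  shows "conj_el ` (I \<bullet> J) \<subseteq> (conj_el ` I) \<bullet> (conj_el ` J)"
proof safe
  fix x assume "x \<in> I \<bullet> J"
  then show "conj_el x \<in> (conj_el ` I) \<bullet> (conj_el ` J)"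
  proof induction
    case zero
    then show ?case using conj_el[of 0 0] by (simp add: set_prod.zero)
  next
    case (step a b s)
    then have "a \<in> R" "b \<in> R" "s \<in> R" using assms set_prod_subset_R[OF assms] by auto
    then have "conj_el (a * b + s) = conj_el a * conj_el b + conj_el s"
      by (simp add: conj_el_simps R_closed)
    then show ?case using step by (auto intro: set_prod.step)
  qed
qed

lemma conj_conj: "I \<subseteq> R \<Longrightarrow> conj_el ` conj_el ` I = I"
  by (force simp: image_image conj_el_simps subset_iff intro!: image_eqI)

lemma conj_subset_R: "I \<subseteq> R \<Longrightarrow> conj_el ` I \<subseteq> R"
  using conj_el_simps by auto

lemma conj_prod:
  assumes "I \<subseteq> R" "J \<subseteq> R"
  shows "conj_el ` (I \<bullet> J) = (conj_el ` I) \<bullet> (conj_el ` J)"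
proof
  have "conj_el ` ((conj_el ` I) \<bullet> (conj_el ` J)) \<subseteq> I \<bullet> J"
    using conj_prod_le[of "conj_el ` I" "conj_el ` J"] assms by (simp add: conj_subset_R conj_conj)
  then have "conj_el ` conj_el ` ((conj_el ` I) \<bullet> (conj_el ` J)) \<subseteq> conj_el ` (I \<bullet> J)" by blast
  then show "(conj_el ` I) \<bullet> (conj_el ` J) \<subseteq> conj_el ` (I \<bullet> J)"
    by (simp add: conj_conj assms conj_subset_R set_prod_subset_R)
qed (rule conj_prod_le[OF assms])

lemma conj_R: "conj_el ` R = R"
  using conj_conj[of R] conj_subset_R[of R] by blast

lemma conj_scale:
  assumes "z \<in> R" "I \<subseteq> R" shows "conj_el ` scale z I = scale (conj_el z) (conj_el ` I)"
  using assms by (auto simp: image_image conj_el_simps subset_iff intro!: image_eqI)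

lemma conj_M: "conj_el ` M u v = M u (- v)"
proof
  have *: "conj_el ` M u v \<subseteq> M u (- v)" for v by (auto elim!: ME)
  show "conj_el ` M u v \<subseteq> M u (- v)" by (rule *)
  have "conj_el ` conj_el ` M u (- v) \<subseteq> conj_el ` M u v" using *[of "- v"] by auto
  then show "M u (- v) \<subseteq> conj_el ` M u v" by (simp add: conj_conj M_subset_R)
qed

lemma conj_submodule:
  assumes "is_submodule R I" "I \<subseteq> R" shows "is_submodule R (conj_el ` I)"
  unfolding is_submodule_def
proof (intro conjI ballI)
  show "0 \<in> conj_el ` I" using assms conj_el[of 0 0] unfolding is_submodule_def by force
next
  fix x y assume "x \<in> conj_el ` I" "y \<in> conj_el ` I"
  then obtain x' y' where "x' \<in> I" "x = conj_el x'" "y' \<in> I" "y = conj_el y'" by auto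
  then show "x + y \<in> conj_el ` I"
    using assms by (auto simp: is_submodule_def conj_el_simps subset_iff intro!: image_eqI[of _ _ "x' + y'"])
next
  fix r x assume r: "r \<in> R" and "x \<in> conj_el ` I"
  then obtain x' where x: "x' \<in> I" "x = conj_el x'" by auto
  have "conj_el (conj_el r * x') = r * x" using r x assms by (auto simp: conj_el_simps subset_iff)
  moreover have "conj_el r * x' \<in> I" using r x assms conj_el_simps(4)[OF r r] by (auto simp: is_submodule_def)
  ultimately show "r * x \<in> conj_el ` I" by (metis imageI)
qed

lemma el_norm: "el a b * el a (- b) = emb (a * a - b * b * f)"
  by (simp only: el_mult emb_el el_eq_iff) (simp add: algebra_simps)

lemma scale_emb_R_dvd:
  assumes "scale (emb p) R \<subseteq> scale (emb q) R" shows "q dvd p"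
proof -
  have "emb p * 1 \<in> scale (emb p) R" by (intro imageI) simp
  then have "el p 0 \<in> scale (emb q) R" using assms by (auto simp: emb_el)
  then show ?thesis by (simp add: scale_emb_R_mem)
qed

end

section \<open>The group law\<close>

locale monic_cubic = squarefree_cubic f for f :: "'k::field_char_0 poly" +
  assumes monic_f: "Polynomial.lead_coeff f = 1"
begin

fun point_ideal :: "'k ec_point \<Rightarrow> 'k poly fract alg_closure set" where
  "point_ideal Infinity = R"
| "point_ideal (Affine x y) = M [:- x, 1:] [:y:]"

lemma Infinity_in_points [simp]: "Infinity \<in> ec_points f"
  by (simp add: ec_points_def)

lemma Affine_in_points [simp]: "Affine x y \<in> ec_points f \<longleftrightarrow> y ^ 2 = poly f x"
  by (simp add: ec_points_def)

lemma point_dvd: "y ^ 2 = poly f x \<Longrightarrow> [:- x, 1:] dvd f - [:y:] * [:y:]"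
  by (subst poly_eq_0_iff_dvd[symmetric]) (simp add: power2_eq_square)

lemma point_ideal_submodule: "P \<in> ec_points f \<Longrightarrow> is_submodule R (point_ideal P)"
  by (cases P) (auto simp: R_submodule intro!: M_submodule[OF point_dvd])

lemma point_ideal_subset_R: "point_ideal P \<subseteq> R"
  by (cases P) (auto simp: M_subset_R)

lemma M_eval: "M [:- x, 1:] v = M [:- x, 1:] [:poly v x:]"
  by (rule M_cong) (simp flip: poly_eq_0_iff_dvd)

lemma similar_emb_R: "u \<noteq> 0 \<Longrightarrow> scale (emb u) R \<approx> R"
  by (rule similar_sym[OF similar_scale]) simp

lemma point_ideal_opposite:
  assumes "y ^ 2 = poly f x"
  shows "point_ideal (Affine x y) \<bullet> point_ideal (Affine x (- y)) = scale (emb [:- x, 1:]) R"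
proof -
  obtain w where "f - [:y:] * [:y:] = [:- x, 1:] * w" using point_dvd[OF assms] by (auto elim: dvdE)
  from M_prod_conj[OF this] show ?thesis by simp
qed

definition slope :: "'k \<Rightarrow> 'k \<Rightarrow> 'k \<Rightarrow> 'k \<Rightarrow> 'k" where
  "slope x1 y1 x2 y2 = (if x1 = x2 then poly (pderiv f) x1 / (2 * y1) else (y2 - y1) / (x2 - x1))"

text \<open>The polynomial f - v^2 is a monic cubic with roots x1 and x2, counted twice in the
  tangent case, where its derivative vanishes too. The third root then follows from the coefficient
  of X^2.\<close>

lemma line_section:
  fixes x1 y1 x2 y2
  assumes P: "y1 ^ 2 = poly f x1" and Q: "y2 ^ 2 = poly f x2" and ne: "\<not> (x1 = x2 \<and> y1 = - y2)"
  defines "m \<equiv> slope x1 y1 x2 y2"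
  defines "v \<equiv> [:y1 - m * x1, m:]" and "x3 \<equiv> m^2 - Polynomial.coeff f 2 - x1 - x2"
  shows "poly v x1 = y1" "poly v x2 = y2" "f - v * v = [:- x1, 1:] * [:- x2, 1:] * [:- x3, 1:]"
proof -
  show v1: "poly v x1 = y1" by (simp add: v_def)
  \<comment> \<open>The excluded case contains y1 = y2 = 0, so the denominator 2 y1 of the tangent
    slope is nonzero.\<close>
  have tan: "y1 = y2 \<and> y1 \<noteq> 0" if "x1 = x2"
  proof -
    have "y1 = y2 \<or> y1 = - y2" using P Q that by (metis power2_eq_iff)
    then show ?thesis using ne that by auto
  qed
  show v2: "poly v x2 = y2"
  proof (cases "x1 = x2")
    case False
    then have "m * (x2 - x1) = y2 - y1" by (simp add: m_def slope_def)
    then show ?thesis by (simp add: v_def algebra_simps)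
  qed (use tan v1 in auto)
  define g where "g = f - v * v"
  have "poly g x1 = 0" using v1 P by (simp add: g_def power2_eq_square)
  then obtain g1 where g1: "g = [:- x1, 1:] * g1" by (auto simp: poly_eq_0_iff_dvd elim: dvdE)
  have "poly g1 x2 = 0"
  proof (cases "x1 = x2")
    case True
    have pv: "pderiv v = [:m:]" by (simp add: v_def pderiv_pCons)
    have "poly (pderiv g) x1 = poly (pderiv f) x1 - 2 * (m * y1)"
      by (simp add: g_def pderiv_diff pderiv_mult pv v1)
    moreover have "y1 \<noteq> 0" using tan True by blast
    then have "poly (pderiv f) x1 - 2 * (m * y1) = 0" by (simp add: m_def slope_def True)
    ultimately have "poly (pderiv g) x1 = 0" by simp
    moreover have "poly (pderiv g) x1 = poly g1 x1" unfolding g1 pderiv_mult by (simp add: pderiv_pCons)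
    ultimately show ?thesis using True by simp
  next
    case False
    have "poly g x2 = 0" using v2 Q by (simp add: g_def power2_eq_square)
    then show ?thesis using False by (simp add: g1)
  qed
  then obtain g2 where "g1 = [:- x2, 1:] * g2" by (auto simp: poly_eq_0_iff_dvd elim: dvdE)
  then have g2: "g = [:- x1, 1:] * [:- x2, 1:] * g2" by (simp only: g1 mult.assoc)
  have dv: "Polynomial.degree v \<le> 1" by (simp add: v_def)
  then have dvv: "Polynomial.degree (v * v) < 3" using degree_mult_le[of v v] by linarith
  have dg: "Polynomial.degree g = 3"
    unfolding g_def using dvv deg_f degree_add_eq_left[of "- (v * v)" f] by simp
  have c3: "Polynomial.coeff g 3 = 1"
    using monic_f deg_f dvv by (simp add: g_def coeff_eq_0)
  have c2: "Polynomial.coeff g 2 = Polynomial.coeff f 2 - m * m"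
    by (simp add: g_def v_def numeral_2_eq_2)
  have g20: "g2 \<noteq> 0" using g2 dg by auto
  have "Polynomial.degree g = 2 + Polynomial.degree g2" using g20 by (simp only: g2) (subst degree_mult_eq; simp)+
  then have "Polynomial.degree g2 = 1" using dg by simp
  then obtain e c where ec: "g2 = [:e, c:]" by (metis degree1_coeffs)
  have "c = 1" using c3 unfolding g2 ec by (simp add: numeral_3_eq_3)
  moreover have "e - x1 - x2 = Polynomial.coeff f 2 - m * m"
    using c2 unfolding g2 ec \<open>c = 1\<close> by (simp add: numeral_2_eq_2 algebra_simps)
  then have "e = - x3" by (simp add: x3_def power2_eq_square algebra_simps)
  ultimately show "f - v * v = [:- x1, 1:] * [:- x2, 1:] * [:- x3, 1:]"
    using g2 ec by (simp add: g_def)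
qed

lemma ec_add_affine:
  assumes "\<not> (x1 = x2 \<and> y1 = - y2)"
  shows "ec_add f (Affine x1 y1) (Affine x2 y2) =
    (let m = slope x1 y1 x2 y2; x3 = m^2 - Polynomial.coeff f 2 - x1 - x2 in Affine x3 (m * (x1 - x3) - y1))"
  using assms by (auto simp: slope_def Let_def)

text \<open>For three points on a line y = v(x) the product of the ideals is (f - v^2, y - v) = (y -
  v), hence principal. Multiplication by the ideal of the reflected third point, which is the sum,
  cancels the third factor up to a principal ideal.\<close>

lemma ec_add_ideal:
  assumes P: "P \<in> ec_points f" and Q: "Q \<in> ec_points f"
  shows "ec_add f P Q \<in> ec_points f \<and> point_ideal P \<bullet> point_ideal Q \<approx> point_ideal (ec_add f P Q)"
proof -
  have main: "ec_add f (Affine x1 y1) (Affine x2 y2) \<in> ec_points f \<and>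
    point_ideal (Affine x1 y1) \<bullet> point_ideal (Affine x2 y2) \<approx> point_ideal (ec_add f (Affine x1 y1) (Affine x2 y2))"
    if P: "y1 ^ 2 = poly f x1" and Q: "y2 ^ 2 = poly f x2" for x1 y1 x2 y2
  proof (cases "x1 = x2 \<and> y1 = - y2")
    case True
    then show ?thesis
      using point_ideal_opposite[OF P] similar_emb_R[of "[:- x1, 1:]"] by (auto simp del: point_ideal.simps(2))
  next
    case ne: False
    define m where "m = slope x1 y1 x2 y2"
    define x3 where "x3 = m^2 - Polynomial.coeff f 2 - x1 - x2"
    define v where "v = [:y1 - m * x1, m:]"
    define y3 where "y3 = m * (x1 - x3) - y1"
    have add: "ec_add f (Affine x1 y1) (Affine x2 y2) = Affine x3 y3"
      unfolding ec_add_affine[OF ne] by (simp add: m_def x3_def y3_def Let_def)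
    note l = line_section[OF P Q ne, folded m_def, folded v_def x3_def]
    have v3: "poly v x3 = - y3" by (simp add: v_def y3_def algebra_simps)
    have "poly (f - v * v) x3 = 0" unfolding l(3) by simp
    then have R3: "y3 ^ 2 = poly f x3" using v3 by (simp add: power2_eq_square)
    let ?I = "point_ideal (Affine x1 y1) \<bullet> point_ideal (Affine x2 y2)"
    \<comment> \<open>The third intersection point has ordinate - y3, as the sum is its
      reflection.\<close>
    let ?J = "point_ideal (Affine x3 (- y3))"
    have e: "point_ideal (Affine x1 y1) = M [:- x1, 1:] v" "point_ideal (Affine x2 y2) = M [:- x2, 1:] v"
      "?J = M [:- x3, 1:] v"
      using M_eval[of x1 v] M_eval[of x2 v] M_eval[of x3 v] l v3 by simp_all
    have "?I = M ([:- x1, 1:] * [:- x2, 1:]) v" unfolding e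
      by (rule M_prod) (simp only: l(3) dvd_triv_left)
    then have "?I \<bullet> ?J = M ([:- x1, 1:] * [:- x2, 1:] * [:- x3, 1:]) v" unfolding e
      by (simp only:) (rule M_prod, simp only: l(3) dvd_refl)
    also have "\<dots> = scale (el (- v) 1) R" by (simp only: l(3)[symmetric] M_full)
    finally have IJ: "?I \<bullet> ?J = scale (el (- v) 1) R" .
    have sub: "is_submodule R (point_ideal (Affine x3 y3))" "is_submodule R ?I"
      using R3 P by (auto intro!: point_ideal_submodule set_prod_submodule simp del: point_ideal.simps)
    have "?I \<approx> ?I \<bullet> (point_ideal (Affine x3 y3) \<bullet> ?J)"
      unfolding point_ideal_opposite[OF R3]
      using sub similar_scale[of "emb [:- x3, 1:]"] by (simp add: set_prod_scale_right set_prod_R)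
    also have "\<dots> = (?I \<bullet> ?J) \<bullet> point_ideal (Affine x3 y3)" by (simp only: set_prod_ac)
    also have "\<dots> = scale (el (- v) 1) (point_ideal (Affine x3 y3))"
      unfolding IJ using sub by (simp add: set_prod_scale set_prod_R)
    also have "\<dots> \<approx> point_ideal (Affine x3 y3)" by (rule similar_sym[OF similar_scale]) simp
    finally show ?thesis unfolding add using R3 by simp
  qed
  show ?thesis
  proof (cases P)
    case Infinity
    then show ?thesis using Q set_prod_R(1)[OF point_ideal_submodule[OF Q]] by simp
  next
    case P': (Affine x1 y1)
    show ?thesis
    proof (cases Q)
      case Infinity
      then show ?thesis using P P' set_prod_R(2)[OF point_ideal_submodule[OF P]] by simp
    next
      case (Affine x2 y2)
      then show ?thesis using main P Q P' by auto
    qed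
  qed
qed

text \<open>Multiplying a principal ideal by its conjugate gives the norm of the generator, so the
  norm of the ideal and that of the generator are associates.\<close>

lemma norm_R_dvd:
  assumes "scale (el a b) R = I" "I \<bullet> conj_el ` I = scale (emb u) R"
  shows "u dvd a * a - b * b * f" "a * a - b * b * f dvd u"
proof -
  have "I \<bullet> conj_el ` I = scale (el a b) R \<bullet> scale (el a (- b)) R"
    unfolding assms(1)[symmetric] by (subst conj_scale) (simp_all add: conj_R)
  also have "\<dots> = scale (emb (a * a - b * b * f)) R"
    using set_prod_R[OF R_submodule]
    by (simp only: set_prod_scale set_prod_scale_right scale_scale mult.commute[of "el a (- b)"] el_norm)
  finally have "scale (emb (a * a - b * b * f)) R = scale (emb u) R" using assms(2) by simp
  then show "u dvd a * a - b * b * f" "a * a - b * b * f dvd u" by (metis order_refl scale_emb_R_dvd)+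
qed

lemma point_ideal_eqD:
  assumes P: "y1 ^ 2 = poly f x1" and Q: "y2 ^ 2 = poly f x2"
    and eq: "point_ideal (Affine x1 y1) = point_ideal (Affine x2 y2)"
  shows "x1 = x2 \<and> y1 = y2"
proof -
  have "el [:- x1, 1:] 0 \<in> point_ideal (Affine x2 y2)" unfolding eq[symmetric] by simp
  then have "[:- x2, 1:] dvd [:- x1, 1:]" by simp
  then have "poly [:- x1, 1:] x2 = 0" by (simp only: poly_eq_0_iff_dvd)
  then have x: "x1 = x2" by simp
  have "el [:- y1:] 1 \<in> point_ideal (Affine x2 y2)" unfolding eq[symmetric] by simp
  then have "[:- x2, 1:] dvd [:y2 - y1:]" by simp
  then have "poly [:y2 - y1:] x2 = 0" by (simp only: poly_eq_0_iff_dvd)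
  then show ?thesis using x by simp
qed

text \<open>A generator a + b y would have norm of degree 1: degree at least 3 if b is nonzero, and
  even degree if b = 0.\<close>

lemma not_similar_R:
  assumes "y ^ 2 = poly f x" shows "\<not> R \<approx> point_ideal (Affine x y)"
proof
  assume "R \<approx> point_ideal (Affine x y)"
  then obtain c where c: "point_ideal (Affine x y) = scale c R" unfolding similar_def by blast
  have "c * 1 \<in> scale c R" by (intro imageI) simp
  then have "c \<in> R" using c point_ideal_subset_R[of "Affine x y"] by auto
  then obtain a b where ab: "c = el a b" by (rule RE)
  have "point_ideal (Affine x y) \<bullet> conj_el ` point_ideal (Affine x y) = scale (emb [:- x, 1:]) R"
    using point_ideal_opposite[OF assms] by (simp add: conj_M)
  note d = norm_R_dvd[OF c[unfolded ab, symmetric] this]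
  have nz: "a * a - b * b * f \<noteq> 0" using d(2) by auto
  have "Polynomial.degree (a * a - b * b * f) \<le> 1" and ge: "Polynomial.degree (a * a - b * b * f) \<ge> 1"
    using dvd_imp_degree_le[OF d(1) nz] dvd_imp_degree_le[OF d(2)] by simp_all
  then have "b = 0" using degree_norm(1)[of b a] by (cases "b = 0") auto
  then have "Polynomial.degree (a * a) = 1" using \<open>Polynomial.degree (a * a - b * b * f) \<le> 1\<close> ge by simp
  moreover have "a \<noteq> 0" using nz \<open>b = 0\<close> by auto
  ultimately have "Polynomial.degree a + Polynomial.degree a = 1" by (simp add: degree_mult_eq)
  then show False by presburger
qed

lemma scale_const_R:
  assumes "k \<noteq> 0" shows "scale (emb [:k:]) R = R"
proof
  show "scale (emb [:k:]) R \<subseteq> R" using R_closed(2) by auto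
  have "emb [:k:] * emb [:inverse k:] = emb ([:k:] * [:inverse k:])" by (simp only: emb_simps)
  also have "[:k:] * [:inverse k:] = 1" using assms by simp
  finally have "scale (emb [:k:]) (scale (emb [:inverse k:]) R) = R" by (simp add: scale_scale)
  then show "R \<subseteq> scale (emb [:k:]) R" using R_closed(2)[of "emb [:inverse k:]"] by fastforce
qed

text \<open>If P and Q have the same class, the ideal of Q times that of -P is principal with norm
  (x - x1)(x - x2). Degree 2 is too small for b to be nonzero, so the generator is a linear a(x)
  whose square both factors divide. Hence x1 = x2, the generator is x - x1 up to a constant, and the
  ideal of -P can be cancelled.\<close>

lemma point_ideal_inj:
  assumes P: "P \<in> ec_points f" and Q: "Q \<in> ec_points f" and sim: "point_ideal P \<approx> point_ideal Q"
  shows "P = Q"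
proof -
  have main: "x1 = x2 \<and> y1 = y2"
    if P: "y1 ^ 2 = poly f x1" and Q: "y2 ^ 2 = poly f x2"
      and sim: "point_ideal (Affine x1 y1) \<approx> point_ideal (Affine x2 y2)" for x1 y1 x2 y2
  proof -
    let ?P = "point_ideal (Affine x1 y1)" and ?P' = "point_ideal (Affine x1 (- y1))"
    let ?Q = "point_ideal (Affine x2 y2)" and ?Q' = "point_ideal (Affine x2 (- y2))"
    have P': "(- y1) ^ 2 = poly f x1" using P by simp
    obtain c where "?Q = scale c ?P" using sim unfolding similar_def by blast
    then have "?Q \<bullet> ?P' = scale (c * emb [:- x1, 1:]) R"
      using point_ideal_opposite[OF P] by (simp add: set_prod_scale scale_scale)
    then obtain h where h: "?Q \<bullet> ?P' = scale h R" by blast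
    have QP: "?Q \<bullet> ?P' \<subseteq> R" by (intro set_prod_subset_R point_ideal_subset_R)
    have "h * 1 \<in> scale h R" by (intro imageI) simp
    then have "h \<in> R" using h QP by auto
    then obtain a b where ab: "h = el a b" by (rule RE)
    have conj: "conj_el ` (?Q \<bullet> ?P') = ?Q' \<bullet> ?P"
      by (subst conj_prod[OF point_ideal_subset_R point_ideal_subset_R]) (simp add: conj_M)
    have "(?Q \<bullet> ?P') \<bullet> conj_el ` (?Q \<bullet> ?P') = (?P \<bullet> ?P') \<bullet> (?Q \<bullet> ?Q')"
      unfolding conj by (simp only: set_prod_ac)
    also have "\<dots> = scale (emb ([:- x1, 1:] * [:- x2, 1:])) R"
      using set_prod_R[OF R_submodule]
      by (simp only: point_ideal_opposite[OF P] point_ideal_opposite[OF Q] set_prod_scale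
          set_prod_scale_right scale_scale emb_simps mult.commute[of "emb [:- x2, 1:]"])
    finally have N: "(?Q \<bullet> ?P') \<bullet> conj_el ` (?Q \<bullet> ?P') = scale (emb ([:- x1, 1:] * [:- x2, 1:])) R" .
    note d = norm_R_dvd[OF h[unfolded ab, symmetric] N]
    have d2: "Polynomial.degree ([:- x1, 1:] * [:- x2, 1:]) = 2" by (subst degree_mult_eq) auto
    have nz: "[:- x1, 1:] * [:- x2, 1:] \<noteq> 0" by simp
    then have nz': "a * a - b * b * f \<noteq> 0" using d(2) by (metis dvd_0_left)
    have dn: "Polynomial.degree (a * a - b * b * f) = 2"
      using dvd_imp_degree_le[OF d(1) nz'] dvd_imp_degree_le[OF d(2) nz] d2 by linarith
    then have b: "b = 0" using degree_norm(1)[of b a] by (cases "b = 0") auto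
    then have "a \<noteq> 0" and "Polynomial.degree (a * a) = 2" using nz' dn by auto
    then have "Polynomial.degree a = 1" by (simp add: degree_mult_eq)
    then obtain e k where ek: "a = [:e, k:]" "k \<noteq> 0" by (metis degree1_coeffs coeff_pCons_0 degree_pCons_0 zero_neq_one)
    have da: "[:- x1, 1:] dvd a * a" "[:- x2, 1:] dvd a * a"
      using d(1) b dvd_mult_left[of "[:- x1, 1:]"] dvd_mult_right[of "[:- x1, 1:]"]
      by (simp_all only: mult_zero_left diff_zero)
    then have "poly a x1 = 0" "poly a x2 = 0" by (auto simp flip: poly_eq_0_iff_dvd)
    then have x: "x1 = x2" and e: "e = - x1 * k" using ek by (auto simp: add_eq_0_iff2)
    have a: "a = [:k:] * [:- x1, 1:]" using e by (simp add: ek)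
    have ku: "scale (emb [:k:]) R = R" by (rule scale_const_R[OF ek(2)])
    have "?P' \<bullet> ?Q = scale (emb [:- x1, 1:] * emb [:k:]) R"
    proof -
      have "h = emb [:- x1, 1:] * emb [:k:]"
        by (simp only: ab b emb_el[symmetric] a emb_simps mult.commute[of "emb [:k:]"])
      then show ?thesis using h by (simp only: set_prod_comm)
    qed
    also have "\<dots> = scale (emb [:- x1, 1:]) R" by (simp only: scale_scale[symmetric] ku)
    also have "\<dots> = ?P' \<bullet> ?P" using point_ideal_opposite[OF P] by (simp add: set_prod_comm)
    finally have "?P' \<bullet> ?Q = ?P' \<bullet> ?P" .
    moreover have "?P' \<bullet> ?P = scale (emb [:- x1, 1:]) R"
      using point_ideal_opposite[OF P] by (simp add: set_prod_comm)
    moreover have "is_submodule R ?P" "is_submodule R ?Q"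
      by (rule point_ideal_submodule, simp add: P Q)+
    ultimately have "?P = ?Q"
      using set_prod_cancel[of ?P' ?P "emb [:- x1, 1:]" R ?Q ?P] by simp
    then show ?thesis by (rule point_ideal_eqD[OF P Q])
  qed
  show ?thesis
  proof (cases P)
    case Infinity
    then show ?thesis using Q sim not_similar_R by (cases Q) auto
  next
    case P': (Affine x1 y1)
    show ?thesis
    proof (cases Q)
      case Infinity
      then show ?thesis using P P' sim not_similar_R[of y1 x1] similar_sym by fastforce
    next
      case (Affine x2 y2)
      then show ?thesis using P Q P' sim main[of y1 x1 y2 x2] by simp
    qed
  qed
qed

lemma comm_group_ec: "comm_group (ec_group f)"
proof (rule comm_groupI)
  fix P Q assume "P \<in> carrier (ec_group f)" "Q \<in> carrier (ec_group f)"
  then show "P \<otimes>\<^bsub>ec_group f\<^esub> Q \<in> carrier (ec_group f)"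
    using ec_add_ideal by (simp add: ec_group_def)
next
  fix P Q S assume "P \<in> carrier (ec_group f)" "Q \<in> carrier (ec_group f)" "S \<in> carrier (ec_group f)"
  then have c: "P \<in> ec_points f" "Q \<in> ec_points f" "S \<in> ec_points f" by (auto simp: ec_group_def)
  note a = ec_add_ideal[THEN conjunct1] and i = ec_add_ideal[THEN conjunct2]
  have "point_ideal (ec_add f (ec_add f P Q) S) \<approx> point_ideal (ec_add f P Q) \<bullet> point_ideal S"
    using c by (intro similar_sym[OF i] a)
  also have "\<dots> \<approx> (point_ideal P \<bullet> point_ideal Q) \<bullet> point_ideal S"
    using c by (intro similar_prod similar_sym[OF i]) auto
  also have "\<dots> = point_ideal P \<bullet> (point_ideal Q \<bullet> point_ideal S)" by (rule set_prod_assoc)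
  also have "\<dots> \<approx> point_ideal P \<bullet> point_ideal (ec_add f Q S)" using c by (intro similar_prod i) auto
  also have "\<dots> \<approx> point_ideal (ec_add f P (ec_add f Q S))" using c by (intro i a)
  finally have "ec_add f (ec_add f P Q) S = ec_add f P (ec_add f Q S)"
    using c by (intro point_ideal_inj a)
  then show "P \<otimes>\<^bsub>ec_group f\<^esub> Q \<otimes>\<^bsub>ec_group f\<^esub> S = P \<otimes>\<^bsub>ec_group f\<^esub> (Q \<otimes>\<^bsub>ec_group f\<^esub> S)"
    by (simp add: ec_group_def)
next
  fix P Q assume "P \<in> carrier (ec_group f)" "Q \<in> carrier (ec_group f)"
  then have c: "P \<in> ec_points f" "Q \<in> ec_points f" by (auto simp: ec_group_def)
  have "point_ideal (ec_add f P Q) \<approx> point_ideal P \<bullet> point_ideal Q"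
    using c by (intro similar_sym[OF ec_add_ideal[THEN conjunct2]])
  also have "\<dots> = point_ideal Q \<bullet> point_ideal P" by (rule set_prod_comm)
  also have "\<dots> \<approx> point_ideal (ec_add f Q P)" using c by (intro ec_add_ideal[THEN conjunct2])
  finally have "ec_add f P Q = ec_add f Q P"
    using c by (intro point_ideal_inj ec_add_ideal[THEN conjunct1])
  then show "P \<otimes>\<^bsub>ec_group f\<^esub> Q = Q \<otimes>\<^bsub>ec_group f\<^esub> P" by (simp add: ec_group_def)
next
  fix P assume P: "P \<in> carrier (ec_group f)"
  show "\<exists>Q\<in>carrier (ec_group f). Q \<otimes>\<^bsub>ec_group f\<^esub> P = \<one>\<^bsub>ec_group f\<^esub>"
  proof (cases P)
    case Infinity
    then show ?thesis by (intro bexI[of _ Infinity]) (auto simp: ec_group_def)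
  next
    case (Affine x y)
    then show ?thesis using P by (intro bexI[of _ "Affine x (- y)"]) (auto simp: ec_group_def)
  qed
qed (auto simp: ec_group_def)

end

section \<open>Linear dependence and the rank\<close>

text \<open>Gaussian elimination by cross-multiplication, valid over the integers, for ranks, as
  well as over the rationals, for counting coefficients.\<close>

lemma idom_linear_dependence:
  fixes A :: "'s \<Rightarrow> 't \<Rightarrow> 'a::idom"
  assumes "finite T" "finite S" "card T < card S"
  shows "\<exists>c. (\<exists>s\<in>S. c s \<noteq> 0) \<and> (\<forall>t\<in>T. (\<Sum>s\<in>S. c s * A s t) = 0)"
  using assms
proof (induction T arbitrary: S A rule: finite_induct)
  case empty
  then have "S \<noteq> {}" by auto
  then show ?case by (intro exI[of _ "\<lambda>_. 1"]) auto
next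
  case (insert t T)
  show ?case
  proof (cases "\<forall>s\<in>S. A s t = 0")
    case True
    have "card T < card S" using insert by simp
    from insert.IH[OF insert.prems(1) this, of A] True show ?thesis by auto
  next
    case False
    then obtain s0 where s0: "s0 \<in> S" "A s0 t \<noteq> 0" by blast
    define S' where "S' = S - {s0}"
    have S: "S = insert s0 S'" "s0 \<notin> S'" "finite S'" using s0 insert.prems by (auto simp: S'_def)
    have "card T < card S'" using insert S by simp
    from insert.IH[OF S(3) this, of "\<lambda>s u. A s0 t * A s u - A s t * A s0 u"]
    obtain c s1 where c: "s1 \<in> S'" "c s1 \<noteq> 0"
      "\<And>u. u \<in> T \<Longrightarrow> (\<Sum>s\<in>S'. c s * (A s0 t * A s u - A s t * A s0 u)) = 0" by blast
    \<comment> \<open>The other coefficients are scaled by the pivot \<open>A s0 t\<close>, and that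
      of s0 is chosen to annihilate the coordinate t.\<close>
    define c' where "c' s = (if s = s0 then - (\<Sum>s\<in>S'. c s * A s t) else c s * A s0 t)" for s
    have sum: "(\<Sum>s\<in>S. c' s * A s u) = (\<Sum>s\<in>S'. c s * (A s0 t * A s u - A s t * A s0 u))" for u
    proof -
      have "(\<Sum>s\<in>S. c' s * A s u) = c' s0 * A s0 u + (\<Sum>s\<in>S'. c' s * A s u)" using S by simp
      also have "(\<Sum>s\<in>S'. c' s * A s u) = (\<Sum>s\<in>S'. c s * A s0 t * A s u)"
        using S by (intro sum.cong) (auto simp: c'_def)
      also have "c' s0 * A s0 u = - (\<Sum>s\<in>S'. c s * A s t * A s0 u)"
        by (simp add: c'_def sum_distrib_right)
      finally show ?thesis by (simp add: sum_subtractf[symmetric] algebra_simps)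
    qed
    have "c' s1 \<noteq> 0" using c s0 S by (auto simp: c'_def)
    moreover have "s1 \<in> S" using c S by simp
    moreover have "(\<Sum>s\<in>S. c' s * A s u) = 0" if "u \<in> insert t T" for u
      using that c(3) unfolding sum by (auto simp: mult.commute)
    ultimately show ?thesis by blast
  qed
qed

section \<open>Integral spans in an abelian group\<close>

context comm_group
begin

definition int_span :: "'a set \<Rightarrow> 'a set" where
  "int_span S = {finprod G (\<lambda>x. x [^] n x) S | n :: 'a \<Rightarrow> int. True}"

lemma finprod_int_pow_add:
  assumes "S \<subseteq> carrier G"
  shows "finprod G (\<lambda>x. x [^] (n x + m x :: int)) S = finprod G (\<lambda>x. x [^] n x) S \<otimes> finprod G (\<lambda>x. x [^] m x) S"
proof -
  have "finprod G (\<lambda>x. x [^] (n x + m x)) S = finprod G (\<lambda>x. x [^] n x \<otimes> x [^] m x) S"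
    using assms by (intro finprod_cong') (auto simp: int_pow_mult)
  also have "\<dots> = finprod G (\<lambda>x. x [^] n x) S \<otimes> finprod G (\<lambda>x. x [^] m x) S"
    using assms by (intro finprod_multf) auto
  finally show ?thesis .
qed

lemma finprod_int_pow_pow:
  assumes "f \<in> S \<rightarrow> carrier G"
  shows "finprod G f S [^] (k::int) = finprod G (\<lambda>x. f x [^] k) S"
proof (cases "finite S")
  case True
  then show ?thesis using assms
    by (induction S rule: finite_induct) (auto simp: int_pow_distrib Pi_def)
qed simp

lemma finprod_int_pow_mult:
  assumes "S \<subseteq> carrier G"
  shows "finprod G (\<lambda>x. x [^] (n x * k :: int)) S = finprod G (\<lambda>x. x [^] n x) S [^] k"
proof -
  have "finprod G (\<lambda>x. x [^] (n x * k :: int)) S = finprod G (\<lambda>x. (x [^] n x) [^] k) S"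
    using assms by (intro finprod_cong') (auto simp: int_pow_pow)
  also have "\<dots> = finprod G (\<lambda>x. x [^] n x) S [^] k"
    using assms by (intro finprod_int_pow_pow[symmetric]) auto
  finally show ?thesis .
qed

lemma int_span_closed:
  assumes "S \<subseteq> carrier G"
  shows "x \<in> int_span S \<Longrightarrow> x \<in> carrier G"
    and "x \<in> int_span S \<Longrightarrow> y \<in> int_span S \<Longrightarrow> x \<otimes> y \<in> int_span S"
    and "x \<in> int_span S \<Longrightarrow> inv x \<in> int_span S"
    and "\<one> \<in> int_span S"
    and "finite S \<Longrightarrow> x \<in> S \<Longrightarrow> x \<in> int_span S"
proof -
  show "x \<in> int_span S \<Longrightarrow> x \<in> carrier G"
    using assms by (auto simp: int_span_def intro!: finprod_closed)
  show "x \<in> int_span S \<Longrightarrow> y \<in> int_span S \<Longrightarrow> x \<otimes> y \<in> int_span S"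
  proof -
    assume "x \<in> int_span S" "y \<in> int_span S"
    then obtain n m where "x = finprod G (\<lambda>x. x [^] (n x :: int)) S" "y = finprod G (\<lambda>x. x [^] (m x :: int)) S"
      by (auto simp: int_span_def)
    then have "x \<otimes> y = finprod G (\<lambda>x. x [^] (n x + m x)) S" using finprod_int_pow_add[OF assms] by simp
    then show ?thesis unfolding int_span_def by (intro CollectI exI[of _ "\<lambda>x. n x + m x"]) simp
  qed
  show "inv x \<in> int_span S" if x: "x \<in> int_span S"
  proof -
    obtain n where n: "x = finprod G (\<lambda>x. x [^] (n x :: int)) S" using x by (auto simp: int_span_def)
    have c: "finprod G (\<lambda>x. x [^] n x) S \<in> carrier G" using assms by (intro finprod_closed) auto
    have "inv x = finprod G (\<lambda>x. x [^] (n x * - 1)) S"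
      unfolding finprod_int_pow_mult[OF assms] n using c int_pow_neg[OF c, of 1] by simp
    then show ?thesis unfolding int_span_def by (intro CollectI exI[of _ "\<lambda>x. n x * - 1"]) simp
  qed
  have "finprod G (\<lambda>x. x [^] (0::int)) S = \<one>" using assms by (intro finprod_one_eqI) auto
  then show "\<one> \<in> int_span S" unfolding int_span_def by (intro CollectI exI[of _ "\<lambda>_. 0"]) simp
  show "x \<in> int_span S" if "finite S" "x \<in> S"
  proof -
    have "finprod G (\<lambda>z. z [^] (if z = x then 1 else 0 :: int)) S = finprod G (\<lambda>z. if x = z then z else \<one>) S"
      using assms that by (intro finprod_cong') auto
    also have "\<dots> = x" using assms that by (intro finprod_singleton) auto
    finally show ?thesis unfolding int_span_def
      by (intro CollectI exI[of _ "\<lambda>z. if z = x then 1 else 0"]) simp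
  qed
qed

lemma finprod_of_finprods:
  assumes "finite S" "T \<subseteq> carrier G" "\<And>x. x \<in> S \<Longrightarrow> g x = finprod G (\<lambda>y. y [^] (A x y :: int)) T"
  shows "finprod G (\<lambda>x. g x [^] c x) S = finprod G (\<lambda>y. y [^] (\<Sum>x\<in>S. A x y * c x)) T"
  using assms(1,3)
proof (induction S rule: finite_induct)
  case empty
  have "finprod G (\<lambda>y. y [^] (0::int)) T = \<one>" using assms(2) by (intro finprod_one_eqI) auto
  then show ?case by simp
next
  case (insert s S)
  have cl: "finprod G (\<lambda>y. y [^] (A x y)) T \<in> carrier G" for x using assms(2) by (intro finprod_closed) auto
  have "finprod G (\<lambda>x. g x [^] c x) (insert s S) = g s [^] c s \<otimes> finprod G (\<lambda>x. g x [^] c x) S"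
    using insert cl by (intro finprod_insert) auto
  also have "\<dots> = finprod G (\<lambda>y. y [^] (A s y * c s)) T \<otimes> finprod G (\<lambda>y. y [^] (\<Sum>x\<in>S. A x y * c x)) T"
    using insert by (simp add: finprod_int_pow_mult[OF assms(2)])
  also have "\<dots> = finprod G (\<lambda>y. y [^] (A s y * c s + (\<Sum>x\<in>S. A x y * c x))) T"
    by (rule finprod_int_pow_add[OF assms(2), symmetric])
  also have "\<dots> = finprod G (\<lambda>y. y [^] (\<Sum>x\<in>insert s S. A x y * c x)) T" using insert by simp
  finally show ?case .
qed

text \<open>More than \<open>card T\<close> elements have doubles that satisfy a nontrivial integer
  relation c; then 2c is a nontrivial relation among the elements themselves. So it is enough to
  control the doubles.\<close>

lemma group_rank_eqI:
  assumes ind: "Z_independent G T" and gen: "\<And>x. x \<in> carrier G \<Longrightarrow> x \<otimes> x \<in> int_span T"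
  shows "group_rank G = enat (card T)"
proof (rule antisym)
  show "enat (card T) \<le> group_rank G" unfolding group_rank_def using ind by (intro SUP_upper) auto
  have T: "finite T" "T \<subseteq> carrier G" using ind by (auto simp: Z_independent_def)
  have "card S \<le> card T" if S: "Z_independent G S" for S
  proof (rule ccontr)
    assume less: "\<not> card S \<le> card T"
    have S': "finite S" "S \<subseteq> carrier G" using S by (auto simp: Z_independent_def)
    have "\<exists>A. x \<otimes> x = finprod G (\<lambda>y. y [^] (A y :: int)) T" if "x \<in> S" for x
      using gen[of x] that S' by (auto simp: int_span_def)
    then obtain A where A: "\<And>x. x \<in> S \<Longrightarrow> x \<otimes> x = finprod G (\<lambda>y. y [^] (A x y :: int)) T"
      by metis
    obtain c s where c: "s \<in> S" "c s \<noteq> 0" "\<And>t. t \<in> T \<Longrightarrow> (\<Sum>s\<in>S. c s * A s t) = 0"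
      using idom_linear_dependence[OF T(1) S'(1), of A] less by auto
    have "finprod G (\<lambda>x. x [^] (2 * c x)) S = finprod G (\<lambda>x. (x \<otimes> x) [^] c x) S"
    proof (intro finprod_cong')
      fix x assume "x \<in> S"
      then have "x \<in> carrier G" using S' by auto
      then show "x [^] (2 * c x) = (x \<otimes> x) [^] c x"
        by (simp only: mult_2 int_pow_mult int_pow_distrib)
    qed (use S' in auto)
    also have "\<dots> = finprod G (\<lambda>y. y [^] (\<Sum>x\<in>S. A x y * c x)) T"
      using S' T A by (intro finprod_of_finprods) auto
    also have "\<dots> = \<one>"
    proof (rule finprod_one_eqI)
      fix y assume "y \<in> T"
      then have "(\<Sum>x\<in>S. A x y * c x) = 0" using c(3) by (simp add: mult.commute)
      then show "y [^] (\<Sum>x\<in>S. A x y * c x) = \<one>" by simp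
    qed
    finally have "\<forall>x\<in>S. 2 * c x = 0" using S unfolding Z_independent_def by (elim conjE) (drule spec[of _ "\<lambda>x. 2 * c x"], simp)
    then show False using c(1,2) by auto
  qed
  then show "group_rank G \<le> enat (card T)" unfolding group_rank_def by (intro SUP_least) auto
qed

end

text \<open>If d^2 divides the cubic and d is not a unit, then d is linear, so the cubic has a
  double root and its discriminant vanishes.\<close>

lemma is_elliptic_monic_cubic:
  assumes "is_elliptic f" shows "monic_cubic f"
proof
  show f: "Polynomial.degree f = 3" "Polynomial.lead_coeff f = 1" using assms by (auto simp: is_elliptic_def)
  fix d assume d: "d * d dvd f"
  show "is_unit d"
  proof (rule ccontr)
    assume nu: "\<not> is_unit d"
    obtain k where k: "f = d * d * k" using d by (auto elim: dvdE)
    have nz: "d \<noteq> 0" "k \<noteq> 0" using k f by auto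
    then have deg: "2 * Polynomial.degree d + Polynomial.degree k = 3"
      using f k by (simp add: degree_mult_eq)
    moreover have "Polynomial.degree d \<noteq> 0" using nu nz by (simp add: is_unit_iff_degree)
    ultimately have "Polynomial.degree d = 1" "Polynomial.degree k = 1" by presburger+
    then obtain a b g h where dk: "d = [:a, b:]" "k = [:g, h:]" by (metis degree1_coeffs)
    have "[:a, b:] * [:a, b:] * [:g, h:] =
      [:a * a * g, 2 * a * b * g + a * a * h, b * b * g + 2 * a * b * h, b * b * h:]"
      by (simp add: algebra_simps)
    then have c: "f = [:a * a * g, 2 * a * b * g + a * a * h, b * b * g + 2 * a * b * h, b * b * h:]"
      using k dk by simp
    have one: "b * b * h = 1" using f unfolding c by (simp add: numeral_3_eq_3)
    \<comment> \<open>With b^2 h = 1 these are a / b and g / h, so that f = (X + r)^2 (X +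
      s).\<close>
    define r where "r = a * b * h"
    define s where "s = b * b * g"
    have a: "a = r * b" using one by (simp add: r_def) (metis mult.assoc mult.commute mult.right_neutral)
    have g: "g = s * h" using one by (simp add: s_def) (metis mult.assoc mult.commute mult.right_neutral)
    have "a * a * g = r * r * s * (b * b * h)" unfolding a g by (simp only: ac_simps)
    moreover have "2 * a * b * g = 2 * r * s * (b * b * h)" unfolding a g by (simp only: ac_simps)
    moreover have "a * a * h = r * r * (b * b * h)" unfolding a by (simp only: ac_simps)
    moreover have "2 * a * b * h = 2 * r * (b * b * h)" unfolding a by (simp only: ac_simps)
    moreover have "b * b * g = s * (b * b * h)" unfolding g by (simp only: ac_simps)
    ultimately have "f = [:r * r * s, 2 * r * s + r * r, s + 2 * r, 1:]"
      unfolding c one by simp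
    then have "weierstrass_disc f = 0"
      by (simp add: weierstrass_disc_def numeral_2_eq_2 algebra_simps power2_eq_square power3_eq_cube)
    then show False using assms by (simp add: is_elliptic_def)
  qed
qed

section \<open>Polynomials in two variables\<close>

text \<open>A polynomial in the outer variable alone, the mirror image of \<open>[:q:]\<close>,
  which involves only the inner one.\<close>

definition const_coeffs :: "'a::comm_ring_1 poly \<Rightarrow> 'a poly poly" where
  "const_coeffs q = map_poly (\<lambda>c. [:c:]) q"

text \<open>Once \<open>const_coeffs\<close> has moved the inner variable outside, the old outer
  variable is evaluated at \<open>[:[:0, 1:]:]\<close>, the new inner variable.\<close>

definition swap_vars :: "'a::comm_ring_1 poly poly \<Rightarrow> 'a poly poly" where
  "swap_vars p = poly (map_poly const_coeffs p) [:[:0, 1:]:]"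

lemma coeff_const_coeffs [simp]: "poly.coeff (const_coeffs q) i = [:poly.coeff q i:]"
  by (simp add: const_coeffs_def coeff_map_poly)

lemma const_coeffs_simps [simp]:
  "const_coeffs 0 = 0" "const_coeffs 1 = 1" "const_coeffs (p + q) = const_coeffs p + const_coeffs q"
  "const_coeffs (pCons c q) = pCons [:c:] (const_coeffs q)"
  by (auto simp: poly_eq_iff coeff_pCons coeff_1 split: nat.splits)

lemma const_coeffs_smult: "const_coeffs (Polynomial.smult c q) = Polynomial.smult [:c:] (const_coeffs q)"
  by (rule poly_eqI) (simp add: mult.commute)

lemma const_coeffs_mult [simp]: "const_coeffs (p * q) = const_coeffs p * const_coeffs q"
  by (induction p) (simp_all add: const_coeffs_smult)

lemma const_coeffs_eq_0_iff [simp]: "const_coeffs q = 0 \<longleftrightarrow> q = 0"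
proof
  assume *: "const_coeffs q = 0"
  have "[:poly.coeff q i:] = 0" for i using arg_cong[OF *, of "\<lambda>p. poly.coeff p i"] by simp
  then show "q = 0" by (intro poly_eqI) simp
qed simp

lemma swap_vars_pCons: "swap_vars (pCons a p) = const_coeffs a + [:[:0, 1:]:] * swap_vars p"
  unfolding swap_vars_def by (simp add: map_poly_pCons)

lemma swap_vars_0 [simp]: "swap_vars 0 = 0"
  by (simp add: swap_vars_def)

lemma coeff_swap_vars [simp]: "poly.coeff (poly.coeff (swap_vars p) j) i = poly.coeff (poly.coeff p i) j"
proof (induction p arbitrary: i)
  case (pCons a p)
  then show ?case
    by (cases i) (simp_all add: swap_vars_pCons coeff_pCons)
qed simp

lemma swap_vars_add [simp]: "swap_vars (p + q) = swap_vars p + swap_vars q"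
  and swap_vars_diff [simp]: "swap_vars (p - q) = swap_vars p - swap_vars q"
  and swap_vars_swap_vars [simp]: "swap_vars (swap_vars p) = p"
  and swap_vars_const [simp]: "swap_vars [:r:] = const_coeffs r"
  and swap_vars_const_coeffs [simp]: "swap_vars (const_coeffs r) = [:r:]"
  by (auto simp: poly_eq_iff coeff_pCons split: nat.splits)

lemma swap_vars_smult: "swap_vars (Polynomial.smult a q) = const_coeffs a * swap_vars q"
  by (induction q) (simp_all add: swap_vars_pCons distrib_left mult.left_commute)

lemma swap_vars_mult [simp]: "swap_vars (p * q) = swap_vars p * swap_vars q"
proof (induction p)
  case (pCons a p)
  have "swap_vars (pCons a p * q) = swap_vars (Polynomial.smult a q) + swap_vars (pCons 0 (p * q))"
    by simp
  also have "\<dots> = (const_coeffs a + [:[:0, 1:]:] * swap_vars p) * swap_vars q"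
    by (simp add: swap_vars_smult swap_vars_pCons pCons algebra_simps)
  finally show ?case by (simp add: swap_vars_pCons)
qed simp

lemma swap_vars_dvd_iff [simp]: "swap_vars p dvd swap_vars q \<longleftrightarrow> p dvd q"
  by (metis dvd_def swap_vars_mult swap_vars_swap_vars)

lemma swap_vars_eq_0_iff [simp]: "swap_vars p = 0 \<longleftrightarrow> p = 0"
  by (metis swap_vars_0 swap_vars_swap_vars)

text \<open>Reducing every coefficient modulo q gives a representative whose degree is the true
  degree modulo q, so that leading terms can be compared in the residue ring.\<close>

lemma reduce_coeffs:
  fixes q :: "'a::field poly" and A :: "'a poly poly"
  assumes "q \<noteq> 0"
  obtains A' where "[:q:] dvd A - A'" "A' = 0 \<or> \<not> q dvd Polynomial.lead_coeff A'"
proof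
  let ?A = "map_poly (\<lambda>c. c mod q) A"
  have "q dvd c - c mod q" for c by (simp add: minus_mod_eq_mult_div)
  then show "[:q:] dvd A - ?A" by (auto simp: const_poly_dvd_iff coeff_map_poly)
  show "?A = 0 \<or> \<not> q dvd Polynomial.lead_coeff ?A"
  proof (rule disjCI)
    assume "\<not> \<not> q dvd Polynomial.lead_coeff ?A"
    then have "Polynomial.lead_coeff ?A mod q = 0" by simp
    then have "Polynomial.lead_coeff ?A = 0" by (simp add: coeff_map_poly)
    then show "?A = 0" by simp
  qed
qed

lemma prime_elem_bezout:
  fixes p q :: "'a::field poly"
  assumes "prime_elem q" "\<not> q dvd p"
  obtains u v where "u * p + v * q = 1"
proof -
  obtain e u v w where e: "e = u * p + v * q + w * 0" "e dvd p" "e dvd q" by (metis poly_bezout3)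
  obtain r where r: "q = e * r" using e(3) by (auto elim: dvdE)
  have "\<not> is_unit r"
  proof
    assume "is_unit r"
    then have "q dvd e" using r by simp
    then show False using e(2) assms(2) dvd_trans by blast
  qed
  then have "is_unit e" using r assms(1) by (metis irreducibleD prime_elem_imp_irreducible)
  then obtain k where k: "1 = e * k" by (auto elim: dvdE)
  have "(k * u) * p + (k * v) * q = 1" unfolding k e(1) by (simp add: algebra_simps)
  then show ?thesis by (rule that)
qed

lemma monic_prime_elem:
  fixes q' :: "'a::field poly"
  assumes "prime_elem q'"
  obtains q c where "c \<noteq> 0" "q = Polynomial.smult c q'" "Polynomial.lead_coeff q = 1" "prime_elem q"
proof -
  define c where "c = inverse (Polynomial.lead_coeff q')"
  have q'0: "q' \<noteq> 0" using assms by auto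
  then have c: "c \<noteq> 0" by (simp add: c_def)
  have "Polynomial.lead_coeff (Polynomial.smult c q') = 1" using q'0 by (simp add: c_def)
  moreover have "prime_elem (Polynomial.smult c q')"
    using assms c unfolding prime_elem_def by (simp add: smult_dvd_iff)
  ultimately show ?thesis using that[OF c refl] by blast
qed

lemma prime_elem_dvd_square:
  "prime_elem q \<Longrightarrow> q dvd a * a \<longleftrightarrow> q dvd a"
  by (auto dest: prime_elem_dvd_multD)

lemma const_dvd_norm_cong:
  fixes A D F :: "'a::comm_ring_1 poly"
  assumes "[:q:] dvd A - A'" "[:q:] dvd D - D'"
  shows "[:q:] dvd A * A - D * D * F \<longleftrightarrow> [:q:] dvd A' * A' - D' * D' * F"
proof -
  have "(A * A - D * D * F) - (A' * A' - D' * D' * F) = (A - A') * (A + A') - (D - D') * ((D + D') * F)"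
    by (simp add: algebra_simps)
  also have "[:q:] dvd \<dots>" by (rule dvd_diff[OF dvd_mult2[OF assms(1)] dvd_mult2[OF assms(2)]])
  finally have "[:q:] dvd (A * A - D * D * F) - (A' * A' - D' * D' * F)" .
  then show ?thesis by (metis diff_add_cancel dvd_add_right_iff)
qed

text \<open>
  Modulo \<open>q\<close> the two sides of \<open>A\<^sup>2 = D\<^sup>2 F\<close> have degrees of different parity.
\<close>

lemma dvd_norm_odd:
  fixes q :: "'a::field poly" and A D F :: "'a poly poly"
  assumes q: "prime_elem q" and F: "odd (Polynomial.degree F)" "\<not> q dvd Polynomial.lead_coeff F"
    and dvd: "[:q:] dvd A * A - D * D * F"
  shows "[:q:] dvd A \<and> [:q:] dvd D"
proof -
  have q0: "q \<noteq> 0" using q by auto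
  obtain A' where A': "[:q:] dvd A - A'" "A' = 0 \<or> \<not> q dvd Polynomial.lead_coeff A'"
    using reduce_coeffs[OF q0] by blast
  obtain D' where D': "[:q:] dvd D - D'" "D' = 0 \<or> \<not> q dvd Polynomial.lead_coeff D'"
    using reduce_coeffs[OF q0] by blast
  let ?N = "A' * A' - D' * D' * F"
  have N: "[:q:] dvd ?N" using dvd const_dvd_norm_cong[OF A'(1) D'(1)] by blast
  then have c: "q dvd poly.coeff ?N i" for i using const_poly_dvd_iff by blast
  have lA: "Polynomial.lead_coeff (A' * A') = Polynomial.lead_coeff A' * Polynomial.lead_coeff A'"
    and lD: "Polynomial.lead_coeff (D' * D' * F) = Polynomial.lead_coeff D' * Polynomial.lead_coeff D' * Polynomial.lead_coeff F"
    by (simp_all add: lead_coeff_mult)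
  have nA: "\<not> q dvd Polynomial.lead_coeff (A' * A')" if "A' \<noteq> 0"
    using A'(2) that q unfolding lA by (simp add: prime_elem_dvd_square)
  have nD: "\<not> q dvd Polynomial.lead_coeff (D' * D' * F)" if "D' \<noteq> 0"
    using D'(2) that q F(2) unfolding lD by (auto simp: prime_elem_dvd_mult_iff)
  have F0: "F \<noteq> 0" using F(1) by auto
  have "A' = 0 \<and> D' = 0"
  proof (rule ccontr)
    assume ne: "\<not> (A' = 0 \<and> D' = 0)"
    consider "D' = 0" "A' \<noteq> 0" | "A' = 0" "D' \<noteq> 0"
      | "A' \<noteq> 0" "D' \<noteq> 0" "Polynomial.degree (D' * D' * F) < Polynomial.degree (A' * A')"
      | "A' \<noteq> 0" "D' \<noteq> 0" "Polynomial.degree (A' * A') < Polynomial.degree (D' * D' * F)"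
    proof -
      have "Polynomial.degree (D' * D' * F) \<noteq> Polynomial.degree (A' * A')" if "A' \<noteq> 0" "D' \<noteq> 0"
        using that F(1) F0 by (simp add: degree_mult_eq) presburger
      then show ?thesis using ne that by linarith
    qed
    then show False
    proof cases
      case 1
      then show ?thesis using c[of "Polynomial.degree (A' * A')"] nA by simp
    next
      case 2
      then show ?thesis using c[of "Polynomial.degree (D' * D' * F)"] nD by simp
    next
      case 3
      then show ?thesis using c[of "Polynomial.degree (A' * A')"] nA by (simp add: coeff_eq_0)
    next
      case 4
      then show ?thesis using c[of "Polynomial.degree (D' * D' * F)"] nD by (simp add: coeff_eq_0)
    qed
  qed
  then show ?thesis using A'(1) D'(1) by simp
qed

text \<open>Let n be the larger degree after reduction modulo q. The top coefficients satisfy a^2 =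
  d^2 c modulo q; if d were invertible there, c would be the square of a / d. So both vanish modulo
  q, which for reduced polynomials means that both are zero.\<close>

lemma dvd_norm_const:
  fixes q c :: "'a::field poly" and A D :: "'a poly poly"
  assumes q: "prime_elem q" and dvd: "[:q:] dvd A * A - D * D * [:c:]"
    and nosq: "\<And>s. \<not> q dvd c - s * s"
  shows "[:q:] dvd A \<and> [:q:] dvd D"
proof -
  have q0: "q \<noteq> 0" using q by auto
  have nc: "\<not> q dvd c" using nosq[of 0] by simp
  obtain A' where A': "[:q:] dvd A - A'" "A' = 0 \<or> \<not> q dvd Polynomial.lead_coeff A'"
    using reduce_coeffs[OF q0] by blast
  obtain D' where D': "[:q:] dvd D - D'" "D' = 0 \<or> \<not> q dvd Polynomial.lead_coeff D'"
    using reduce_coeffs[OF q0] by blast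
  let ?N = "A' * A' - D' * D' * [:c:]"
  have c: "q dvd poly.coeff ?N i" for i
    using dvd const_dvd_norm_cong[OF A'(1) D'(1)] const_poly_dvd_iff by blast
  define n where "n = max (Polynomial.degree A') (Polynomial.degree D')"
  let ?a = "poly.coeff A' n" and ?d = "poly.coeff D' n"
  have sq: "poly.coeff (P * P) (n + n) = poly.coeff P n * poly.coeff P n" if "Polynomial.degree P \<le> n" for P :: "'a poly poly"
  proof (cases "Polynomial.degree P = n")
    case True
    then show ?thesis using coeff_mult_degree_sum[of P P] by simp
  next
    case False
    then have "Polynomial.degree P < n" using that by simp
    moreover then have "Polynomial.degree (P * P) < n + n" using degree_mult_le[of P P] by linarith
    ultimately show ?thesis by (simp add: coeff_eq_0)
  qed
  have "poly.coeff ?N (n + n) = ?a * ?a - ?d * ?d * c"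
    using sq[of A'] sq[of D'] by (simp add: n_def)
  then have key: "q dvd ?a * ?a - ?d * ?d * c" using c[of "n + n"] by simp
  have "q dvd ?d"
  proof (rule ccontr)
    assume nd: "\<not> q dvd ?d"
    then obtain u v where uv: "u * ?d + v * q = 1" using prime_elem_bezout[OF q] by blast
    define s where "s = u * ?a"
    \<comment> \<open>Since u inverts d modulo q, s = u a plays the role of a / d.\<close>
    have "c - s * s = c * ((1 - u * ?d) * (1 + u * ?d)) - u * u * (?a * ?a - ?d * ?d * c)"
      by (simp add: s_def algebra_simps)
    also have "1 - u * ?d = v * q" by (simp add: uv[symmetric])
    also have "q dvd c * (v * q * (1 + u * ?d)) - u * u * (?a * ?a - ?d * ?d * c)"
      by (rule dvd_diff[OF _ dvd_mult[OF key]]) simp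
    finally show False using nosq[of s] by blast
  qed
  moreover then have "q dvd ?a * ?a" using key
    by (metis dvd_diff_left_iff dvd_mult2 dvd_diff_commute dvd_add_right_iff diff_add_cancel)
  then have "q dvd ?a" using q by (simp add: prime_elem_dvd_square)
  moreover have "A' = 0 \<and> D' = 0" if "q dvd ?a" "q dvd ?d"
  proof -
    have "A' \<noteq> 0 \<Longrightarrow> Polynomial.degree A' < n"
      using A'(2) that(1) by (metis le_neq_implies_less max.cobounded1 n_def)
    moreover have "D' \<noteq> 0 \<Longrightarrow> Polynomial.degree D' < n"
      using D'(2) that(2) by (metis le_neq_implies_less max.cobounded2 n_def)
    ultimately show ?thesis unfolding n_def
      by (metis degree_0 less_max_iff_disj less_irrefl max_0L max_0R max_def less_le_not_le)
  qed
  ultimately show ?thesis using A'(1) D'(1) by simp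
qed

lemma prime_elem_const_poly: "prime_elem q \<Longrightarrow> prime_elem [:q:]" for q :: "rat poly"
  by (rule lift_prime_elem_poly)

text \<open>A nonzero coefficient of g is a nonzero rational number, which is a unit in the
  coefficient ring.\<close>

lemma content_const_coeffs:
  fixes g :: "rat poly"
  assumes "g \<noteq> 0" shows "content (const_coeffs g) = 1"
proof -
  obtain i where i: "poly.coeff g i \<noteq> 0" using assms by (auto simp: poly_eq_iff)
  have "content (const_coeffs g) dvd [:poly.coeff g i:]"
    using content_dvd_coeff[of "const_coeffs g" i] by simp
  also have "[:poly.coeff g i:] dvd 1" using i by (simp add: is_unit_pCons_iff)
  finally show ?thesis by (metis is_unit_normalize normalize_content)
qed

section \<open>The curve \<open>y\<^sup>2 = B(x) T + C(x)\<close>\<close>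

text \<open>
  Polynomials in \<open>\<rat>[x][T]\<close> have \<open>T\<close> as outer variable, so that \<^const>\<open>Polynomial.degree\<close> is the degree
  in \<open>T\<close>, whereas the outer variable of \<open>\<rat>(T)[x]\<close> is \<open>x\<close>.
\<close>

definition psi :: "rat poly poly \<Rightarrow> rat poly fract poly" where
  "psi A = map_poly to_fract (swap_vars A)"

abbreviation cx :: "rat poly \<Rightarrow> rat poly fract poly" where
  "cx q \<equiv> psi [:q:]"

lemma psi_simps [simp]:
  "psi 0 = 0" "psi (A + D) = psi A + psi D" "psi (A - D) = psi A - psi D" "psi (A * D) = psi A * psi D"
  "psi A = 0 \<longleftrightarrow> A = 0"
  by (simp_all add: psi_def)

lemma psi_one [simp]: "psi 1 = 1"
  using swap_vars_const[of "1 :: rat poly"] by (simp add: psi_def flip: one_pCons)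

lemma cx_simps: "cx (p * q) = cx p * cx q" "cx (p + q) = cx p + cx q" "cx (p - q) = cx p - cx q" "cx (- p) = - cx p"
proof -
  show "cx (p * q) = cx p * cx q" by (simp add: mult.commute flip: psi_simps(4))
  show "cx (p + q) = cx p + cx q" by (simp flip: psi_simps(2))
  show *: "cx (p - q) = cx p - cx q" for p q by (simp flip: psi_simps(3))
  show "cx (- p) = - cx p" using *[of 0 p] by simp
qed

lemma cx_const: "cx q = map_poly to_fract (const_coeffs q)"
  by (simp add: psi_def)

lemma cx_coeff: "poly.coeff (cx q) i = to_fract [:poly.coeff q i:]"
  by (simp add: cx_const coeff_map_poly)

lemma degree_cx [simp]: "Polynomial.degree (cx q) = Polynomial.degree q"
proof (rule antisym)
  show "Polynomial.degree (cx q) \<le> Polynomial.degree q"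
    by (rule degree_le) (auto simp: cx_coeff coeff_eq_0)
  show "Polynomial.degree q \<le> Polynomial.degree (cx q)"
  proof (rule degree_le, safe)
    fix i assume "Polynomial.degree (cx q) < i"
    then have "poly.coeff (cx q) i = 0" by (rule coeff_eq_0)
    then show "poly.coeff q i = 0" by (simp add: cx_coeff)
  qed
qed

lemma psi_curve: "psi [:C, B:] = curve_BC B C"
  by (rule poly_eqI)
    (simp add: psi_def curve_BC_def swap_vars_pCons coeff_map_poly const_QT_def T_QT_def to_fract_def
      one_fract_def Zero_fract_def algebra_simps)

text \<open>Gauss's lemma: q(x) is primitive over Q[T], so a quotient by it has no denominators in
  T.\<close>

lemma psi_dvd_iff:
  assumes "q \<noteq> 0" shows "cx q dvd psi A \<longleftrightarrow> [:q:] dvd A"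
proof
  assume "cx q dvd psi A"
  then have "const_coeffs q dvd swap_vars A"
    unfolding cx_const unfolding psi_def
    by (rule fract_poly_dvdD) (rule content_const_coeffs[OF assms])
  then show "[:q:] dvd A" by (metis swap_vars_const swap_vars_dvd_iff)
next
  assume "[:q:] dvd A"
  then obtain K where "A = [:q:] * K" by (rule dvdE)
  then have "psi A = cx q * psi K" by (simp only: psi_simps)
  then show "cx q dvd psi A" by simp
qed

lemma cx_dvd_iff: "q \<noteq> 0 \<Longrightarrow> cx q dvd cx p \<longleftrightarrow> q dvd p"
  by (simp add: psi_dvd_iff)

lemma psi_denominator:
  obtains c A where "c \<noteq> 0" "Polynomial.smult (to_fract c) a = psi A"
proof -
  obtain k a' where k: "a = Polynomial.smult k (map_poly to_fract a')" by (rule content_decompose_fract)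
  obtain m c where c: "k = Fract m c" "c \<noteq> 0" by (cases k)
  have "Polynomial.smult (to_fract c) a = map_poly to_fract (Polynomial.smult m a')"
    using c by (simp add: k Fract_conv_to_fract)
  also have "\<dots> = psi (swap_vars (Polynomial.smult m a'))" by (simp add: psi_def)
  finally show ?thesis using that c by blast
qed

lemma smult_to_fract_psi: "Polynomial.smult (to_fract c) (psi A) = psi (swap_vars [:c:] * A)"
  by (simp add: psi_def flip: swap_vars_const)

lemma psi_denominator2:
  obtains c A D where "c \<noteq> 0" "Polynomial.smult (to_fract c) a = psi A" "Polynomial.smult (to_fract c) b = psi D"
proof -
  obtain c A where A: "c \<noteq> 0" "Polynomial.smult (to_fract c) a = psi A" by (rule psi_denominator)
  obtain d D where D: "d \<noteq> 0" "Polynomial.smult (to_fract d) b = psi D" by (rule psi_denominator)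
  have "Polynomial.smult (to_fract (c * d)) a = Polynomial.smult (to_fract d) (psi A)"
    by (simp add: A(2)[symmetric] mult.commute)
  moreover have "Polynomial.smult (to_fract (c * d)) b = Polynomial.smult (to_fract c) (psi D)"
    by (simp add: D(2)[symmetric])
  ultimately show ?thesis
    using that[of "c * d" "swap_vars [:d:] * A" "swap_vars [:c:] * D"] A(1) D(1)
    unfolding smult_to_fract_psi by simp
qed

text \<open>
  The coefficients of \<open>A\<close> and \<open>D\<close>, of degree at most \<open>N\<close> in \<open>x\<close>, are \<open>(\<delta> + 1) (N + 1)\<close> unknown rationals,
  while clearing denominators leaves an equation between polynomials in \<open>T\<close> of degree
  \<open>\<delta> N + O(1)\<close>.
\<close>

lemma siegel:
  fixes n d \<alpha> \<beta> :: "rat poly"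
  defines "\<delta> \<equiv> max (Polynomial.degree n) (Polynomial.degree d)"
  assumes d: "d \<noteq> 0" "\<beta> \<noteq> 0" and \<delta>: "\<delta> \<ge> 1"
  obtains A D where "A \<noteq> 0 \<or> D \<noteq> 0" "2 * Polynomial.degree A \<le> \<delta>" "2 * Polynomial.degree D + 1 \<le> \<delta>"
    "poly (psi A) (to_fract n / to_fract d) + poly (psi D) (to_fract n / to_fract d) * (to_fract \<alpha> / to_fract \<beta>) = 0"
proof -
  \<comment> \<open>With degree bound N in x there are (\<delta> + 1) (N + 1) unknowns, and m
    equations below. This N is the least for which the unknowns outnumber the equations, in fact by
    one.\<close>
  define N where "N = Polynomial.degree \<alpha> + Polynomial.degree \<beta> + 1"
  define m where "m = \<delta> + \<delta> * N + Polynomial.degree \<alpha> + Polynomial.degree \<beta> + 1"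
  define S where "S = ({..\<delta> div 2} \<times> {..N}) <+> ({..<(\<delta> + 1) div 2} \<times> {..N})"
  \<comment> \<open>The contribution of each unknown coefficient of T^i x^j, for A
    (\<open>Inl\<close>) or D (\<open>Inr\<close>), once x = n / d and y = \<alpha> / \<beta> are
    substituted and the equation is multiplied by d^N \<beta>.\<close>
  define v where "v s = (case s of Inl (i, j) \<Rightarrow> Polynomial.monom 1 i * n ^ j * d ^ (N - j) * \<beta>
    | Inr (i, j) \<Rightarrow> Polynomial.monom 1 i * n ^ j * d ^ (N - j) * \<alpha>)" for s
  have fin: "finite S" by (simp add: S_def)
  have "card S = (\<delta> div 2 + 1) * (N + 1) + ((\<delta> + 1) div 2) * (N + 1)"
    by (simp add: S_def card_Plus card_cartesian_product)
  also have "\<dots> = (\<delta> div 2 + 1 + (\<delta> + 1) div 2) * (N + 1)" by (simp only: add_mult_distrib)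
  also have "\<delta> div 2 + 1 + (\<delta> + 1) div 2 = \<delta> + 1" by presburger
  finally have card: "m < card S" by (simp add: m_def N_def algebra_simps)
  have base: "Polynomial.degree (Polynomial.monom 1 i * n ^ j * d ^ (N - j) * \<gamma>) < m"
    if "i \<le> \<delta>" "j \<le> N" "Polynomial.degree \<gamma> \<le> Polynomial.degree \<alpha> + Polynomial.degree \<beta>" for i j and \<gamma> :: "rat poly"
  proof -
    have "Polynomial.degree (Polynomial.monom 1 i * n ^ j * d ^ (N - j) * \<gamma>)
      \<le> Polynomial.degree (Polynomial.monom (1::rat) i) + Polynomial.degree (n ^ j) + Polynomial.degree (d ^ (N - j)) + Polynomial.degree \<gamma>"
      by (meson add_le_mono degree_mult_le le_trans order_refl)
    also have "\<dots> \<le> \<delta> + \<delta> * j + \<delta> * (N - j) + (Polynomial.degree \<alpha> + Polynomial.degree \<beta>)"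
    proof (intro add_le_mono)
      show "Polynomial.degree (Polynomial.monom (1::rat) i) \<le> \<delta>" using that degree_monom_le[of "1::rat" i] by linarith
      show "Polynomial.degree (n ^ j) \<le> \<delta> * j"
        using degree_power_le[of n j] mult_le_mono1[of "Polynomial.degree n" \<delta> j] \<delta>_def by linarith
      show "Polynomial.degree (d ^ (N - j)) \<le> \<delta> * (N - j)"
        using degree_power_le[of d "N - j"] mult_le_mono1[of "Polynomial.degree d" \<delta> "N - j"] \<delta>_def by linarith
    qed (use that in simp)
    also have "\<delta> * j + \<delta> * (N - j) = \<delta> * N" using that by (simp add: add_mult_distrib2[symmetric])
    then have "\<delta> + \<delta> * j + \<delta> * (N - j) + (Polynomial.degree \<alpha> + Polynomial.degree \<beta>) < m"
      by (simp add: m_def)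
    finally show ?thesis .
  qed
  have dv: "Polynomial.degree (v s) < m" if "s \<in> S" for s
    using that \<delta> by (auto simp: S_def v_def intro!: base)
  obtain c s0 where c: "s0 \<in> S" "c s0 \<noteq> (0::rat)" "\<And>t. t < m \<Longrightarrow> (\<Sum>s\<in>S. c s * poly.coeff (v s) t) = 0"
    using idom_linear_dependence[of "{..<m}" S "\<lambda>s t. poly.coeff (v s) t"] fin card by auto
  have rel: "(\<Sum>s\<in>S. Polynomial.smult (c s) (v s)) = 0"
  proof (rule poly_eqI)
    fix t
    show "poly.coeff (\<Sum>s\<in>S. Polynomial.smult (c s) (v s)) t = poly.coeff 0 t"
    proof (cases "t < m")
      case True
      then show ?thesis using c(3) by (simp add: coeff_sum)
    next
      case False
      then have "poly.coeff (v s) t = 0" if "s \<in> S" for s using dv[OF that] by (intro coeff_eq_0) simp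
      then show ?thesis by (simp add: coeff_sum)
    qed
  qed
  define A where "A = (\<Sum>i\<le>\<delta> div 2. Polynomial.monom (\<Sum>j\<le>N. Polynomial.monom (c (Inl (i, j))) j) i)"
  define D where "D = (\<Sum>i<(\<delta> + 1) div 2. Polynomial.monom (\<Sum>j\<le>N. Polynomial.monom (c (Inr (i, j))) j) i)"
  have cA: "poly.coeff (poly.coeff A i) j = c (Inl (i, j))" if "i \<le> \<delta> div 2" "j \<le> N" for i j
    using that by (simp add: A_def coeff_sum coeff_monom)
  have cD: "poly.coeff (poly.coeff D i) j = c (Inr (i, j))" if "i < (\<delta> + 1) div 2" "j \<le> N" for i j
    using that by (simp add: D_def coeff_sum coeff_monom)
  have "A \<noteq> 0 \<or> D \<noteq> 0"
  proof (rule ccontr)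
    assume "\<not> (A \<noteq> 0 \<or> D \<noteq> 0)"
    then have "c s0 = 0" using c(1) cA cD by (auto simp: S_def)
    then show False using c(2) by simp
  qed
  moreover have "Polynomial.degree A \<le> \<delta> div 2"
    unfolding A_def by (intro degree_sum_le) (auto intro: order_trans[OF degree_monom_le])
  then have "2 * Polynomial.degree A \<le> \<delta>" by presburger
  moreover have "Polynomial.degree D \<le> (\<delta> - 1) div 2"
    unfolding D_def by (intro degree_sum_le) (auto intro: order_trans[OF degree_monom_le])
  then have "2 * Polynomial.degree D + 1 \<le> \<delta>" using \<delta> by presburger
  moreover have "poly (psi A) (to_fract n / to_fract d) + poly (psi D) (to_fract n / to_fract d) * (to_fract \<alpha> / to_fract \<beta>) = 0"
  proof -
    let ?x = "to_fract n / to_fract d" and ?y = "to_fract \<alpha> / to_fract \<beta>"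
    have psi_sum: "psi (sum g I) = (\<Sum>i\<in>I. psi (g i))" if "finite I" for g :: "nat \<Rightarrow> rat poly poly" and I
      using that by (induction I rule: finite_induct) auto
    have psi_monom: "psi (Polynomial.monom (Polynomial.monom r j) i) = Polynomial.monom (to_fract (Polynomial.monom r i)) j" for r i j
    proof -
      have "swap_vars (Polynomial.monom (Polynomial.monom r j) i) = Polynomial.monom (Polynomial.monom r i) j"
        by (intro poly_eqI) (auto simp: coeff_monom)
      then show ?thesis by (simp add: psi_def map_poly_monom)
    qed
    have psiA: "poly (psi A) ?x = (\<Sum>i\<le>\<delta> div 2. \<Sum>j\<le>N. to_fract (Polynomial.monom (c (Inl (i, j))) i) * ?x ^ j)"
      by (simp add: A_def psi_sum psi_monom monom_sum poly_sum poly_monom)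
    have psiD: "poly (psi D) ?x = (\<Sum>i<(\<delta> + 1) div 2. \<Sum>j\<le>N. to_fract (Polynomial.monom (c (Inr (i, j))) i) * ?x ^ j)"
      by (simp add: D_def psi_sum psi_monom monom_sum poly_sum poly_monom)
    have nd: "to_fract d \<noteq> 0" "to_fract \<beta> \<noteq> 0" using d by simp_all
    have pw: "to_fract d ^ N * ?x ^ j = to_fract (n ^ j * d ^ (N - j))" if "j \<le> N" for j
    proof -
      have "to_fract d ^ N = to_fract d ^ j * to_fract d ^ (N - j)" using that by (simp flip: power_add)
      moreover have tp: "to_fract (p ^ k) = to_fract p ^ k" for p :: "rat poly" and k
        by (induction k) simp_all
      ultimately show ?thesis using nd by (simp add: power_divide)
    qed
    have mon: "Polynomial.monom r i = Polynomial.smult r (Polynomial.monom 1 i)" for r :: rat and i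
      by (simp add: smult_monom)
    have "0 = to_fract (\<Sum>s\<in>S. Polynomial.smult (c s) (v s))" unfolding rel by simp
    also have "\<dots> = (\<Sum>s\<in>S. to_fract (Polynomial.smult (c s) (v s)))" by simp
    also have "\<dots> = (\<Sum>(i,j)\<in>{..\<delta> div 2} \<times> {..N}. to_fract (Polynomial.smult (c (Inl (i, j))) (v (Inl (i, j)))))
      + (\<Sum>(i,j)\<in>{..<(\<delta> + 1) div 2} \<times> {..N}. to_fract (Polynomial.smult (c (Inr (i, j))) (v (Inr (i, j)))))"
      unfolding S_def by (subst sum.Plus) (auto intro!: arg_cong2[of _ _ _ _ "(+)"] sum.cong)
    also have "(\<Sum>(i,j)\<in>{..\<delta> div 2} \<times> {..N}. to_fract (Polynomial.smult (c (Inl (i, j))) (v (Inl (i, j)))))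
      = to_fract d ^ N * to_fract \<beta> * poly (psi A) ?x"
      unfolding psiA sum_distrib_left sum.cartesian_product
    proof (intro sum.cong refl, goal_cases)
      case (1 s)
      then obtain i j where ij: "s = (i, j)" "j \<in> {..N}" by auto
      have "to_fract (Polynomial.smult (c (Inl (i, j))) (v (Inl (i, j)))) =
        to_fract (Polynomial.monom (c (Inl (i, j))) i * (n ^ j * d ^ (N - j)) * \<beta>)"
        by (subst mon) (simp add: v_def mult.assoc)
      also have "\<dots> = to_fract (Polynomial.monom (c (Inl (i, j))) i) * (to_fract d ^ N * ?x ^ j) * to_fract \<beta>"
        using pw[of j] ij by simp
      finally have "to_fract (Polynomial.smult (c (Inl (i, j))) (v (Inl (i, j)))) =
         to_fract d ^ N * to_fract \<beta> * (to_fract (Polynomial.monom (c (Inl (i, j))) i) * ?x ^ j)"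
        by (simp only: ac_simps)
      then show ?case unfolding ij(1) by simp
    qed
    also have "(\<Sum>(i,j)\<in>{..<(\<delta> + 1) div 2} \<times> {..N}. to_fract (Polynomial.smult (c (Inr (i, j))) (v (Inr (i, j)))))
      = to_fract d ^ N * to_fract \<alpha> * poly (psi D) ?x"
      unfolding psiD sum_distrib_left sum.cartesian_product
    proof (intro sum.cong refl, goal_cases)
      case (1 s)
      then obtain i j where ij: "s = (i, j)" "j \<in> {..N}" by auto
      have "to_fract (Polynomial.smult (c (Inr (i, j))) (v (Inr (i, j)))) =
        to_fract (Polynomial.monom (c (Inr (i, j))) i * (n ^ j * d ^ (N - j)) * \<alpha>)"
        by (subst mon) (simp add: v_def mult.assoc)
      also have "\<dots> = to_fract (Polynomial.monom (c (Inr (i, j))) i) * (to_fract d ^ N * ?x ^ j) * to_fract \<alpha>"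
        using pw[of j] ij by simp
      finally have "to_fract (Polynomial.smult (c (Inr (i, j))) (v (Inr (i, j)))) =
         to_fract d ^ N * to_fract \<alpha> * (to_fract (Polynomial.monom (c (Inr (i, j))) i) * ?x ^ j)"
        by (simp only: ac_simps)
      then show ?case unfolding ij(1) by simp
    qed
    finally have "to_fract d ^ N * to_fract \<beta> * poly (psi A) ?x + to_fract d ^ N * to_fract \<alpha> * poly (psi D) ?x = 0"
      by simp
    moreover have "to_fract d ^ N * to_fract \<beta> * (poly (psi A) ?x + poly (psi D) ?x * ?y) =
      to_fract d ^ N * to_fract \<beta> * poly (psi A) ?x + to_fract d ^ N * to_fract \<alpha> * poly (psi D) ?x"
      using nd by (simp add: distrib_left)
    ultimately have "to_fract d ^ N * to_fract \<beta> * (poly (psi A) ?x + poly (psi D) ?x * ?y) = 0" by simp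
    then show ?thesis using nd by simp
  qed
  ultimately show ?thesis by (rule that)
qed

locale qt_curve =
  fixes B C :: "rat poly"
  assumes B0: "B \<noteq> 0" and degB: "Polynomial.degree B \<le> 2"
    and degC: "Polynomial.degree C = 3" and monicC: "Polynomial.lead_coeff C = 1"
    and ell: "is_elliptic (curve_BC B C)"
begin

sublocale monic_cubic "curve_BC B C"
  using is_elliptic_monic_cubic[OF ell] .

abbreviation "f \<equiv> curve_BC B C"

abbreviation "F \<equiv> [:C, B:]"

section \<open>Behaviour of the primes of Q[x] in R\<close>

lemma psi_norm: "psi (A * A - D * D * F) = psi A * psi A - psi D * psi D * f"
  by (simp only: psi_simps psi_curve)

text \<open>Denominators lie in Q[T] and are units of Q(T)[x], so clearing them does not affect
  divisibility by q. One pair A, D serves all three equivalences, which makes them usable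
  together.\<close>

lemma dvd_norm_transfer:
  fixes a b
  assumes q: "q \<noteq> 0"
  obtains A D where "cx q dvd a * a - b * b * f \<longleftrightarrow> [:q:] dvd A * A - D * D * F"
    "\<And>s. cx q dvd a + b * cx s \<longleftrightarrow> [:q:] dvd A + D * [:s:]" "cx q dvd b \<longleftrightarrow> [:q:] dvd D"
proof -
  obtain c A D where c: "c \<noteq> 0" "Polynomial.smult (to_fract c) a = psi A" "Polynomial.smult (to_fract c) b = psi D"
    by (rule psi_denominator2)
  let ?c = "to_fract c"
  have c0: "?c \<noteq> 0" using c by simp
  have sm: "cx q dvd Polynomial.smult k w \<longleftrightarrow> cx q dvd w" if "k \<noteq> 0" for k w
    using that by (auto intro: dvd_smult dest: dvd_smult_cancel)
  have "Polynomial.smult (?c * ?c) (a * a - b * b * f) = psi (A * A - D * D * F)"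
    unfolding psi_norm c(2)[symmetric] c(3)[symmetric] by (simp add: smult_diff_right)
  then have 1: "cx q dvd a * a - b * b * f \<longleftrightarrow> [:q:] dvd A * A - D * D * F"
    using sm[of "?c * ?c"] c0 psi_dvd_iff[OF q] by (metis mult_eq_0_iff)
  have "Polynomial.smult ?c (a + b * cx s) = psi (A + D * [:s:])" for s
    by (simp only: psi_simps c(2,3)[symmetric] smult_add_right mult_smult_left)
  then have 2: "cx q dvd a + b * cx s \<longleftrightarrow> [:q:] dvd A + D * [:s:]" for s
    using sm[of ?c] c0 psi_dvd_iff[OF q] by metis
  have 3: "cx q dvd b \<longleftrightarrow> [:q:] dvd D" using sm[of ?c] c0 psi_dvd_iff[OF q] c(3) by metis
  show ?thesis using that 1 2 3 by blast
qed

text \<open>The assumption \<open>inert\<close> says that F is not a square over the residue field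
  Q[x]/q with T adjoined: either F is linear in T there, or it is the constant C, a
  nonsquare.\<close>

lemma inert_dvd:
  assumes q: "prime_elem q" and dvd: "cx q dvd a * a - b * b * f"
    and inert: "\<not> q dvd B \<or> (\<forall>s. \<not> q dvd C - s * s)"
  shows "cx q dvd a \<and> cx q dvd b"
proof -
  have q0: "q \<noteq> 0" using q by auto
  obtain A D where AD: "cx q dvd a * a - b * b * f \<longleftrightarrow> [:q:] dvd A * A - D * D * F"
    "\<And>s. cx q dvd a + b * cx s \<longleftrightarrow> [:q:] dvd A + D * [:s:]" "cx q dvd b \<longleftrightarrow> [:q:] dvd D"
    using dvd_norm_transfer[OF q0, of a b] by blast
  have N: "[:q:] dvd A * A - D * D * F" using dvd AD(1) by simp
  have "[:q:] dvd A \<and> [:q:] dvd D"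
  proof (cases "q dvd B")
    case False
    show ?thesis
    proof (rule dvd_norm_odd[OF q _ _ N])
      show "odd (Polynomial.degree F)" "\<not> q dvd Polynomial.lead_coeff F" using B0 False by simp_all
    qed
  next
    case True
    then have "[:q:] dvd D * D * (F - [:C:])" by (intro dvd_mult) (simp add: const_poly_dvd_iff coeff_pCons split: nat.splits)
    from dvd_add[OF N this] have "[:q:] dvd A * A - D * D * [:C:]" by (simp only: algebra_simps) simp
    then show ?thesis using dvd_norm_const[OF q] inert True by blast
  qed
  then show ?thesis using AD(2)[of 0] AD(3) by simp
qed

lemma ramified_dvd:
  assumes q: "prime_elem q" and dvd: "cx q dvd a * a - b * b * f" and ram: "q dvd B" "q dvd C"
  shows "cx q dvd a"
proof -
  have "[:q:] dvd F" using ram by (simp add: const_poly_dvd_iff coeff_pCons split: nat.splits)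
  then have "cx q dvd f" using q psi_dvd_iff[of q F] psi_curve by auto
  then have "cx q dvd a * a" using dvd_add[OF dvd dvd_mult[of "cx q" f "b * b"]] by simp
  \<comment> \<open>Applied to the pair a, 0. About the resulting D only divisibility by q is known,
    which is why the term D^2 F is added back before primality is used.\<close>
  moreover obtain A D where AD: "cx q dvd a * a - 0 * 0 * f \<longleftrightarrow> [:q:] dvd A * A - D * D * F"
    "\<And>s. cx q dvd a + 0 * cx s \<longleftrightarrow> [:q:] dvd A + D * [:s:]" "cx q dvd (0 :: rat poly fract poly) \<longleftrightarrow> [:q:] dvd D"
    by (rule dvd_norm_transfer[of q a 0]) (use q in auto)
  ultimately have "[:q:] dvd A * A - D * D * F" "[:q:] dvd D" by simp_all
  then have "[:q:] dvd A * A - D * D * F + D * (D * F)" by (intro dvd_add) simp_all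
  then have "[:q:] dvd A * A" by (simp only: mult.assoc diff_add_cancel)
  then have "[:q:] dvd A" using prime_elem_const_poly[OF q] by (simp add: prime_elem_dvd_square)
  then show ?thesis using AD(2)[of 0] by simp
qed

text \<open>Modulo q the norm factors as (a + b s)(a - b s), and q remains prime in Q[x][T].\<close>

lemma split_dvd:
  assumes q: "prime_elem q" and dvd: "cx q dvd a * a - b * b * f" and sp: "q dvd B" "q dvd C - s * s"
  shows "cx q dvd a + b * cx s \<or> cx q dvd a + b * - cx s"
proof -
  have q0: "q \<noteq> 0" using q by auto
  obtain A D where AD: "cx q dvd a * a - b * b * f \<longleftrightarrow> [:q:] dvd A * A - D * D * F"
    "\<And>s. cx q dvd a + b * cx s \<longleftrightarrow> [:q:] dvd A + D * [:s:]" "cx q dvd b \<longleftrightarrow> [:q:] dvd D"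
    using dvd_norm_transfer[OF q0, of a b] by blast
  have "[:q:] dvd F - [:s:] * [:s:]" using sp by (simp add: const_poly_dvd_iff coeff_pCons split: nat.splits)
  then have "[:q:] dvd (A * A - D * D * F) + D * D * (F - [:s:] * [:s:])" using dvd AD(1) by (intro dvd_add dvd_mult) auto
  also have "(A * A - D * D * F) + D * D * (F - [:s:] * [:s:]) = (A + D * [:s:]) * (A + D * [:- s:])"
  proof -
    have "[:- s:] = - [:s:]" by simp
    then show ?thesis by (simp only:) (simp only: algebra_simps)
  qed
  finally have "[:q:] dvd A + D * [:s:] \<or> [:q:] dvd A + D * [:- s:]"
    using prime_elem_const_poly[OF q] by (auto dest: prime_elem_dvd_multD)
  then show ?thesis using AD(2)[of s] AD(2)[of "- s"] by (simp add: cx_simps)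
qed

section \<open>Ideals with norm in Q[x]\<close>

lemma conj_emb: "conj_el (emb a) = emb a"
  using conj_el[of a 0] by (simp add: emb_el)

text \<open>The norm is required to come from Q[x] rather than Q(T)[x]; g is determined up to a
  constant. Since g is nonzero, the condition also makes I invertible, with inverse conj(I) /
  g.\<close>

definition normed :: "rat poly fract poly fract alg_closure set \<Rightarrow> rat poly \<Rightarrow> bool" where
  "normed I g \<longleftrightarrow> is_submodule R I \<and> I \<subseteq> R \<and> g \<noteq> 0 \<and> I \<bullet> conj_el ` I = scale (emb (cx g)) R"

lemma normedD:
  assumes "normed I g"
  shows "is_submodule R I" "I \<subseteq> R" "g \<noteq> 0" "I \<bullet> conj_el ` I = scale (emb (cx g)) R"
  using assms by (auto simp: normed_def)

lemma normed_prod: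
  assumes "normed I g" "normed J h" shows "normed (I \<bullet> J) (g * h)"
proof -
  note I = normedD[OF assms(1)] and J = normedD[OF assms(2)]
  have "(I \<bullet> J) \<bullet> conj_el ` (I \<bullet> J) = (I \<bullet> conj_el ` I) \<bullet> (J \<bullet> conj_el ` J)"
    unfolding conj_prod[OF I(2) J(2)] by (simp only: set_prod_ac)
  also have "\<dots> = scale (emb (cx (g * h))) R"
    unfolding I(4) J(4) cx_simps emb_simps set_prod_scale set_prod_scale_right scale_scale
    using set_prod_R[OF R_submodule] by (simp add: mult.commute[of "emb (cx h)"])
  finally show ?thesis using I J unfolding normed_def
    by (auto intro: set_prod_submodule simp: set_prod_subset_R)
qed

lemma normed_conj:
  assumes "normed I g" shows "normed (conj_el ` I) g"
  using normedD[OF assms] unfolding normed_def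
  by (simp add: conj_submodule conj_subset_R conj_conj set_prod_comm)

lemma normed_R: "normed R 1"
proof -
  have "cx 1 = 1" by (metis one_pCons psi_one)
  then show ?thesis
    unfolding normed_def by (simp del: one_pCons add: R_submodule conj_R set_prod_R[OF R_submodule])
qed

lemma normed_mem:
  assumes "normed I g" "el a b \<in> I" "q dvd g"
  shows "cx q dvd a * a - b * b * f"
proof -
  note I = normedD[OF assms(1)]
  have "el a (- b) \<in> conj_el ` I" using imageI[OF assms(2), of conj_el] by simp
  then have "el a b * el a (- b) \<in> I \<bullet> conj_el ` I" by (rule set_prodI[OF assms(2)])
  then have "el (a * a - b * b * f) 0 \<in> scale (emb (cx g)) R"
    unfolding I(4) by (simp add: el_norm emb_el[symmetric])
  then have "cx g dvd a * a - b * b * f" by (simp only: scale_emb_R_mem)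
  moreover have "cx q dvd cx g" using assms(3) by (auto simp: cx_simps elim!: dvdE)
  ultimately show ?thesis by (rule dvd_trans[rotated])
qed

lemma normed_M:
  assumes "q \<noteq> 0" "cx q dvd f - v * v" shows "normed (M (cx q) v) q"
proof -
  obtain w where "f - v * v = cx q * w" using assms(2) by (auto elim: dvdE)
  from M_prod_conj[OF this] show ?thesis
    unfolding normed_def using assms by (simp add: M_submodule M_subset_R conj_M)
qed

lemma M_similar_conj:
  assumes "q \<noteq> 0" "cx q dvd f - v * v" shows "M (cx q) v \<bullet> M (cx q) (- v) \<approx> R"
  using normedD[OF normed_M[OF assms]] similar_emb_R[of "cx q"] assms by (simp add: conj_M)

text \<open>To contain is to divide: the quotient is I conj(J) / r, which lies in R because I
  conj(J) is contained in J conj(J) = (r).\<close>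

lemma normed_quotient:
  assumes I: "normed I g" and J: "normed J r" and sub: "I \<subseteq> J"
  obtains I' k where "normed I' k" "g = r * k" "I = I' \<bullet> J"
proof -
  note I' = normedD[OF I] and J' = normedD[OF J]
  let ?r = "emb (cx r)"
  have r0: "?r \<noteq> 0" using J'(3) by simp
  define K where "K = I \<bullet> conj_el ` J"
  define I1 where "I1 = scale (inverse ?r) K"
  have K: "K = scale ?r I1" unfolding I1_def scale_scale using r0 by simp
  have nK: "normed K (g * r)" unfolding K_def by (rule normed_prod[OF I normed_conj[OF J]])
  have "K \<subseteq> scale ?r R"
    using set_prod_mono[OF sub subset_refl, of "conj_el ` J"] unfolding K_def J'(4) .
  then have I1R: "I1 \<subseteq> R" unfolding K using r0 by auto
  have I1s: "is_submodule R I1" unfolding I1_def by (rule is_submodule_scale[OF normedD(1)[OF nK]])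
  have "scale (?r * ?r) (I1 \<bullet> conj_el ` I1) = K \<bullet> conj_el ` K"
    unfolding K conj_scale[OF emb_in_R I1R] conj_emb
    by (simp only: set_prod_scale set_prod_scale_right scale_scale)
  also have "\<dots> = scale (?r * emb (cx g)) R" using normedD(4)[OF nK] by (simp add: cx_simps mult.commute)
  finally have "scale ?r (scale ?r (I1 \<bullet> conj_el ` I1)) = scale ?r (scale (emb (cx g)) R)"
    by (simp only: scale_scale)
  then have e: "scale ?r (I1 \<bullet> conj_el ` I1) = scale (emb (cx g)) R" using r0 by (rule scale_cancel)
  have "scale ?r (I1 \<bullet> conj_el ` I1) \<subseteq> scale ?r R"
    by (intro image_mono set_prod_subset_R I1R conj_subset_R)
  then have "cx r dvd cx g" unfolding e by (rule scale_emb_R_dvd)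
  then have "r dvd g" using J'(3) by (simp add: cx_dvd_iff)
  then obtain k where k: "g = r * k" by (auto elim: dvdE)
  have "scale ?r (I1 \<bullet> conj_el ` I1) = scale ?r (scale (emb (cx k)) R)"
    unfolding e k cx_simps emb_simps scale_scale ..
  then have "I1 \<bullet> conj_el ` I1 = scale (emb (cx k)) R" using r0 by (rule scale_cancel)
  then have "normed I1 k" unfolding normed_def using I1s I1R k I'(3) by auto
  moreover have "I1 \<bullet> J = I"
  proof -
    have "I1 \<bullet> J = scale (inverse ?r) (I \<bullet> (J \<bullet> conj_el ` J))"
      unfolding I1_def K_def set_prod_scale by (simp only: set_prod_ac)
    also have "\<dots> = I" unfolding J'(4) set_prod_scale_right scale_scale set_prod_R(2)[OF I'(1)] using r0 by simp
    finally show ?thesis .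
  qed
  ultimately show ?thesis using that k by metis
qed

text \<open>No additive group is the union of two proper subgroups. The alternative in
  \<open>split_dvd\<close> is taken element by element; this makes it uniform on an ideal.\<close>

lemma submodule_subset_union:
  assumes I: "is_submodule R I" and J: "is_submodule R J" "is_submodule R K" and sub: "I \<subseteq> J \<union> K"
  shows "I \<subseteq> J \<or> I \<subseteq> K"
proof (rule ccontr)
  assume "\<not> (I \<subseteq> J \<or> I \<subseteq> K)"
  then obtain x y where xy: "x \<in> I" "x \<notin> J" "y \<in> I" "y \<notin> K" by blast
  have minus: "a - b \<in> L" if "is_submodule R L" "a \<in> L" "b \<in> L" for a b L
  proof -
    have "a + emb (- 1) * b \<in> L" using that emb_in_R[of "- 1"] unfolding is_submodule_def by metis
    then show ?thesis by simp
  qed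
  have "x \<in> K" "y \<in> J" using xy sub by auto
  have "x + y \<in> I" using xy I by (auto simp: is_submodule_def)
  then have "x + y \<in> J \<or> x + y \<in> K" using sub by auto
  then show False
    using minus[OF J(1), of "x + y" y] minus[OF J(2), of "x + y" x] xy \<open>x \<in> K\<close> \<open>y \<in> J\<close> by auto
qed

text \<open>Monic, so that each prime of Q[x] is counted once; the condition on C keeps out the
  ramified primes.\<close>

definition is_split :: "rat poly \<Rightarrow> bool" where
  "is_split q \<longleftrightarrow> Factorial_Ring.irreducible q \<and> Polynomial.lead_coeff q = 1 \<and> q dvd B \<and> \<not> q dvd C \<and> (\<exists>s. q dvd C - s * s)"

lemma split_dvd_curve: "q \<noteq> 0 \<Longrightarrow> q dvd B \<Longrightarrow> q dvd C - s * s \<Longrightarrow> cx q dvd f - cx s * cx s"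
proof -
  assume q: "q \<noteq> 0" "q dvd B" "q dvd C - s * s"
  then have "[:q:] dvd F - [:s:] * [:s:]" by (simp add: const_poly_dvd_iff coeff_pCons split: nat.splits)
  then show ?thesis using psi_dvd_iff[OF q(1)] by (metis psi_curve psi_simps(3,4))
qed

abbreviation "E \<equiv> ec_points f"

text \<open>
  An ideal whose norm lies in \<open>\<rat>[x]\<close> is, up to squaring, a product of the ideals above the split
  factors of \<open>B\<close>: every other irreducible factor of the norm is inert or ramified.
\<close>

lemma normed_square_class:
  assumes H: "Infinity \<in> H" "H \<subseteq> E" "\<And>P Q. P \<in> H \<Longrightarrow> Q \<in> H \<Longrightarrow> ec_add f P Q \<in> H"
    and gen: "\<And>q. is_split q \<Longrightarrow> \<exists>s P P'. q dvd C - s * s \<and> P \<in> H \<and> P' \<in> H \<and>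
      M (cx q) (cx s) \<approx> point_ideal P \<and> M (cx q) (- cx s) \<approx> point_ideal P'"
    and I: "normed I g"
  shows "\<exists>P\<in>H. I \<bullet> I \<approx> point_ideal P"
  using I
proof (induction "Polynomial.degree g" arbitrary: I g rule: less_induct)
  case less
  note I = normedD[OF less.prems]
  show ?case
  proof (cases "Polynomial.degree g = 0")
    case True
    then obtain k where k: "g = [:k:]" "k \<noteq> 0" using I(3) by (metis degree_eq_zeroE pCons_0_0)
    have "cx g * cx [:inverse k:] = 1" using k by (simp add: cx_simps[symmetric] flip: one_pCons)
    then have "1 = emb (cx g) * emb (cx [:inverse k:])" by (metis emb_simps(2,4))
    then have "1 \<in> I \<bullet> conj_el ` I" unfolding I(4) by (intro image_eqI) auto
    then have "1 \<in> I \<bullet> R" using set_prod_mono[OF subset_refl conj_subset_R[OF I(2)]] by blast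
    then have "I = R" using submodule_R_eq[OF I(1,2)] set_prod_R(2)[OF I(1)] by simp
    then show ?thesis using H(1) by (intro bexI[of _ Infinity]) (simp_all add: set_prod_R[OF R_submodule])
  next
    case False
    \<comment> \<open>Dividing out J lowers the degree of the norm, and J^2 has the class of a point
      of H. It remains to find such a J containing I: (q) if q is inert, (q, y) if it is ramified,
      and one of (q, y - s), (q, y + s) if it splits.\<close>
    have step: ?thesis if J: "normed J r" "I \<subseteq> J" "Polynomial.degree r > 0" "P \<in> H" "J \<bullet> J \<approx> point_ideal P" for J r P
    proof -
      obtain I' k where k: "normed I' k" "g = r * k" "I = I' \<bullet> J"
        by (rule normed_quotient[OF less.prems J(1,2)])
      have "Polynomial.degree k < Polynomial.degree g"
        using J(3) k(2) I(3) by (auto simp: degree_mult_eq)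
      from less.hyps[OF this k(1)] obtain Q where Q: "Q \<in> H" "I' \<bullet> I' \<approx> point_ideal Q" by blast
      have "I \<bullet> I = (I' \<bullet> I') \<bullet> (J \<bullet> J)" unfolding k(3) by (simp only: set_prod_ac)
      also have "\<dots> \<approx> point_ideal Q \<bullet> point_ideal P" by (rule similar_prod[OF Q(2) J(5)])
      also have "\<dots> \<approx> point_ideal (ec_add f Q P)" using ec_add_ideal Q(1) J(4) H(2) by blast
      finally show ?thesis using H(3)[OF Q(1) J(4)] by blast
    qed
    have "\<not> is_unit g" using False I(3) by (simp add: is_unit_iff_degree)
    then obtain q' where q': "prime_elem q'" "q' dvd g" using prime_divisor_exists[OF I(3)] by auto
    obtain q c where qc: "c \<noteq> 0" "q = Polynomial.smult c q'" and lq: "Polynomial.lead_coeff q = 1" and q: "prime_elem q"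
      by (rule monic_prime_elem[OF q'(1)])
    then have q0: "q \<noteq> 0" by auto
    have qg: "q dvd g" unfolding qc(2) by (rule smult_dvd[OF q'(2) qc(1)])
    have qdeg: "Polynomial.degree q > 0" using q q0 is_unit_iff_degree[OF q0] by (auto simp: prime_elem_def)
    have mem: "cx q dvd a * a - b * b * f" if "el a b \<in> I" for a b
      by (rule normed_mem[OF less.prems that qg])
    consider (inert) "\<not> q dvd B \<or> (\<forall>s. \<not> q dvd C - s * s)" | (ram) "q dvd B" "q dvd C"
      | (split) "is_split q"
      using q lq by (auto simp: is_split_def intro: prime_elem_imp_irreducible)
    then show ?thesis
    proof cases
      case inert
      have "normed (scale (emb (cx q)) R) (q * q)"
        unfolding normed_def
      proof (intro conjI)
        show "is_submodule R (scale (emb (cx q)) R)" by (rule is_submodule_scale[OF R_submodule])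
        show "scale (emb (cx q)) R \<subseteq> R" using R_closed(2) by auto
        show "scale (emb (cx q)) R \<bullet> conj_el ` scale (emb (cx q)) R = scale (emb (cx (q * q))) R"
          unfolding conj_scale[OF emb_in_R subset_refl] conj_emb conj_R
          by (simp only: set_prod_scale set_prod_scale_right scale_scale set_prod_R[OF R_submodule] cx_simps emb_simps)
      qed (use q0 in simp)
      moreover have "I \<subseteq> scale (emb (cx q)) R"
      proof
        fix z assume z: "z \<in> I"
        then obtain a b where "z = el a b" using I(2) RE by blast
        then show "z \<in> scale (emb (cx q)) R"
          using inert_dvd[OF q mem inert] z by (simp add: scale_emb_R_mem)
      qed
      moreover have "Polynomial.degree (q * q) > 0" using qdeg q0 by (simp add: degree_mult_eq)
      moreover have "scale (emb (cx q)) R \<bullet> scale (emb (cx q)) R \<approx> point_ideal Infinity"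
        using q0 similar_emb_R[of "cx q * cx q"]
        by (simp add: set_prod_scale set_prod_scale_right scale_scale set_prod_R[OF R_submodule])
      ultimately show ?thesis using step H(1) by blast
    next
      case ram
      have "cx q dvd f" using split_dvd_curve[of q 0] ram q0 by simp
      then have v: "cx q dvd f - 0 * 0" by simp
      have "I \<subseteq> M (cx q) 0"
      proof
        fix z assume z: "z \<in> I"
        then obtain a b where "z = el a b" using I(2) RE by blast
        then show "z \<in> M (cx q) 0" using ramified_dvd[OF q mem ram] z by simp
      qed
      moreover have "M (cx q) 0 \<bullet> M (cx q) 0 \<approx> point_ideal Infinity"
        using M_similar_conj[OF q0 v] by simp
      ultimately show ?thesis using step[OF normed_M[OF q0 v]] qdeg H(1) by blast
    next
      case split
      then obtain s P P' where s: "q dvd C - s * s" "P \<in> H" "P' \<in> H"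
        "M (cx q) (cx s) \<approx> point_ideal P" "M (cx q) (- cx s) \<approx> point_ideal P'" using gen by blast
      have qB: "q dvd B" using split by (simp add: is_split_def)
      have v: "cx q dvd f - cx s * cx s" "cx q dvd f - (- cx s) * (- cx s)"
        using split_dvd_curve[OF q0 qB s(1)] by simp_all
      have "I \<subseteq> M (cx q) (cx s) \<union> M (cx q) (- cx s)"
      proof
        fix z assume z: "z \<in> I"
        then obtain a b where "z = el a b" using I(2) RE by blast
        then show "z \<in> M (cx q) (cx s) \<union> M (cx q) (- cx s)"
          using split_dvd[OF q mem qB s(1)] z by auto
      qed
      then have "I \<subseteq> M (cx q) (cx s) \<or> I \<subseteq> M (cx q) (- cx s)"
        by (intro submodule_subset_union I(1) M_submodule v)
      moreover have "M (cx q) (cx s) \<bullet> M (cx q) (cx s) \<approx> point_ideal (ec_add f P P)"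
        using similar_trans[OF similar_prod[OF s(4,4)]] ec_add_ideal s(2) H(2) by blast
      moreover have "M (cx q) (- cx s) \<bullet> M (cx q) (- cx s) \<approx> point_ideal (ec_add f P' P')"
        using similar_trans[OF similar_prod[OF s(5,5)]] ec_add_ideal s(3) H(2) by blast
      ultimately show ?thesis
        using step[OF normed_M[OF q0 v(1)] _ qdeg] step[OF normed_M[OF q0 v(2)] _ qdeg] H(3) s(2,3) by blast
    qed
  qed
qed

end

section \<open>Generators up to squares\<close>

context qt_curve
begin

lemma cx_linear: "cx [:e, 1:] = [:to_fract [:e:], 1:]"
  by (rule poly_eqI) (simp add: cx_coeff coeff_pCons one_pCons[symmetric] split: nat.splits)

text \<open>
  With \<open>x\<^sub>0 = n / d\<close>, the element \<open>h = A + D y\<close> found by counting lies in the ideal of \<open>(x\<^sub>0, - y\<^sub>0)\<close>, so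
  its norm is divisible by \<open>d x - n\<close>. Both have degree at most \<open>\<delta>\<close> in \<open>T\<close>, and the latter has degree
  exactly \<open>\<delta>\<close>, hence the quotient is in \<open>\<rat>[x]\<close>.
\<close>

lemma point_normed:
  assumes "P \<in> E"
  shows "\<exists>I g. normed I g \<and> I \<approx> point_ideal P"
proof (cases P)
  case Infinity
  then show ?thesis using normed_R similar_refl by fastforce
next
  case (Affine x0 y0)
  then have P: "y0 ^ 2 = poly f x0" using assms by simp
  obtain n d where nd: "x0 = to_fract n / to_fract d" "d \<noteq> 0" "coprime n d"
  proof
    show "x0 = to_fract (fst (quot_of_fract x0)) / to_fract (snd (quot_of_fract x0))"
      by (metis Fract_conv_to_fract Fract_quot_of_fract)
  qed (simp_all add: coprime_quot_of_fract)
  obtain \<alpha> \<beta> where \<alpha>: "y0 = to_fract \<alpha> / to_fract \<beta>" "\<beta> \<noteq> 0"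
    by (metis Fract_cases Fract_conv_to_fract)
  define \<delta> where "\<delta> = max (Polynomial.degree n) (Polynomial.degree d)"
  let ?u = "[:- x0, 1:]"
  let ?J = "point_ideal (Affine x0 y0)" and ?J' = "point_ideal (Affine x0 (- y0))"
  show ?thesis
  proof (cases "\<delta> = 0")
    \<comment> \<open>Here x0 is a rational number and the ideal of the point itself has norm x - x0
      in Q[x]; the count in \<open>siegel\<close> is only for \<delta> at least 1.\<close>
    case True
    then have "Polynomial.degree n = 0" "Polynomial.degree d = 0" by (auto simp: \<delta>_def max_def split: if_splits)
    then obtain a b where ab: "n = [:a:]" "d = [:b:]" by (metis degree_eq_zeroE)
    then have b0: "b \<noteq> 0" using nd by auto
    have "to_fract [:a:] = to_fract [:a / b:] * to_fract [:b:]"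
      using b0 by (simp flip: to_fract_mult)
    moreover have "to_fract [:b:] \<noteq> 0" using b0 by simp
    ultimately have "x0 = to_fract [:a / b:]" unfolding nd(1) ab by simp
    then have x0: "- x0 = to_fract [:- (a / b):]" by (metis minus_pCons minus_zero to_fract_uminus)
    have "normed (M (cx [:- (a / b), 1:]) [:y0:]) [:- (a / b), 1:]"
      by (rule normed_M) (use point_dvd[OF P] in \<open>simp_all only: cx_linear x0\<close>, simp)
    then show ?thesis using Affine similar_refl unfolding cx_linear x0[symmetric]
      by (intro exI[of _ "?J"] exI[of _ "[:- (a / b), 1:]"]) simp
  next
    case False
    then have "1 \<le> max (Polynomial.degree n) (Polynomial.degree d)" unfolding \<delta>_def by linarith
    from siegel[OF nd(2) \<alpha>(2) this, of "- \<alpha>"] obtain A D where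
      AD: "A \<noteq> 0 \<or> D \<noteq> 0" "2 * Polynomial.degree A \<le> \<delta>" "2 * Polynomial.degree D + 1 \<le> \<delta>"
      "poly (psi A) x0 + poly (psi D) x0 * - y0 = 0"
      unfolding \<delta>_def nd(1) \<alpha>(1) by (auto simp: to_fract_uminus)
    define W where "W = A * A - D * D * F"
    define h where "h = el (psi A) (psi D)"
    have psiW: "psi W = psi A * psi A - psi D * psi D * f" unfolding W_def by (rule psi_norm)
    have W0: "W \<noteq> 0" using AD(1) norm_eq_0_iff[of "psi A" "psi D"] psiW by auto
    have hJ: "h \<in> ?J'" unfolding h_def using AD(4) by (simp flip: poly_eq_0_iff_dvd)
    have degF: "Polynomial.degree F = 1" using B0 by simp
    have "Polynomial.degree (A * A) \<le> \<delta>" using degree_mult_le[of A A] AD(2) by linarith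
    moreover have "Polynomial.degree (D * D * F) \<le> \<delta>"
      using degree_mult_le[of "D * D" F] degree_mult_le[of D D] AD(3) degF by linarith
    ultimately have degW: "Polynomial.degree W \<le> \<delta>" unfolding W_def by (rule degree_diff_le)
    define \<pi> where "\<pi> = [:- n, d:]"
    have \<pi>: "map_poly to_fract \<pi> = Polynomial.smult (to_fract d) ?u"
      using nd(1,2) by (simp add: \<pi>_def map_poly_pCons to_fract_uminus)
    have "content \<pi> dvd n" "content \<pi> dvd d"
      using content_dvd_coeff[of \<pi> 0] content_dvd_coeff[of \<pi> 1] by (simp_all add: \<pi>_def)
    then have "is_unit (content \<pi>)" using nd(3) coprime_common_divisor by blast
    then have c1: "content \<pi> = 1" by (metis is_unit_normalize normalize_content)
    have "y0 * y0 = poly f x0" using P by (simp add: power2_eq_square)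
    moreover have "poly (psi A) x0 = poly (psi D) x0 * y0" using AD(4) by simp
    ultimately have "poly (psi W) x0 = 0" unfolding psiW by (simp add: algebra_simps)
    then have "?u dvd psi W" by (simp add: poly_eq_0_iff_dvd)
    then have "map_poly to_fract \<pi> dvd psi W" unfolding \<pi> by (rule smult_dvd) (use nd(2) in simp)
    then have "\<pi> dvd swap_vars W" unfolding psi_def by (rule fract_poly_dvdD[OF _ c1])
    then have "swap_vars \<pi> dvd W" by (metis swap_vars_dvd_iff swap_vars_swap_vars)
    then obtain K where K: "W = swap_vars \<pi> * K" by (auto elim: dvdE)
    have "poly.coeff (swap_vars \<pi>) \<delta> \<noteq> 0"
    proof
      assume "poly.coeff (swap_vars \<pi>) \<delta> = 0"
      then have z: "poly.coeff (poly.coeff \<pi> i) \<delta> = 0" for i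
        using coeff_swap_vars[where p = \<pi> and j = \<delta> and i = i] by simp
      have "poly.coeff n \<delta> = 0" "poly.coeff d \<delta> = 0" using z[of 0] z[of 1] by (simp_all add: \<pi>_def)
      then show False using False unfolding \<delta>_def
        by (metis leading_coeff_0_iff degree_0 max.absorb1 max.absorb2 nat_le_linear)
    qed
    then have "\<delta> \<le> Polynomial.degree (swap_vars \<pi>)" by (rule le_degree)
    moreover have "Polynomial.degree W = Polynomial.degree (swap_vars \<pi>) + Polynomial.degree K"
      using W0 unfolding K by (intro degree_mult_eq) auto
    ultimately have "Polynomial.degree K = 0" using degW by simp
    then obtain g where g: "K = [:g:]" by (rule degree_eq_zeroE)
    have g0: "g \<noteq> 0" using W0 K g by auto
    have "psi W = map_poly to_fract \<pi> * cx g" unfolding K g psi_simps by (simp add: psi_def)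
    then have N: "psi W = [:to_fract d:] * (?u * cx g)" unfolding \<pi> by (simp add: smult_diff_right)
    \<comment> \<open>As h lies in \<open>?J'\<close>, the set h J is contained in J' J = (x - x0),
      so the division stays inside R. The norm becomes that of h divided by x - x0, which is g up to
      the factor d in Q[T].\<close>
    define I where "I = scale (inverse (emb ?u)) (scale h ?J)"
    have u0: "emb ?u \<noteq> 0" by simp
    have "emb ?u * (inverse (emb ?u) * h) = h" 
      unfolding mult.assoc[symmetric] right_inverse[OF u0] by (rule mult_1_left)
    then have K': "scale h ?J = scale (emb ?u) I" unfolding I_def scale_scale by (simp only:)
    have subJ: "is_submodule R ?J" by (rule point_ideal_submodule) (simp add: P)
    have hR: "h \<in> R" by (simp add: h_def)
    have "scale h ?J \<subseteq> ?J' \<bullet> ?J" using hJ by (auto intro: set_prodI)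
    then have sub: "scale (emb ?u) I \<subseteq> scale (emb ?u) R"
      using point_ideal_opposite[OF P] unfolding K' by (simp only: set_prod_comm)
    have IR: "I \<subseteq> R"
    proof
      fix z assume "z \<in> I"
      then have "emb ?u * z \<in> scale (emb ?u) R" using sub by blast
      then show "z \<in> R" using u0 by (auto simp del: emb_eq_0_iff)
    qed
    have Is: "is_submodule R I" unfolding I_def by (intro is_submodule_scale subJ)
    have conjJ: "conj_el ` ?J = ?J'" by (simp add: conj_M)
    have "scale (emb ?u) (scale (emb ?u) (I \<bullet> conj_el ` I)) = scale (emb ?u) I \<bullet> conj_el ` scale (emb ?u) I"
      unfolding conj_scale[OF emb_in_R IR] conj_emb by (simp only: set_prod_scale set_prod_scale_right)
    also have "\<dots> = scale h ?J \<bullet> scale (conj_el h) ?J'"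
      unfolding K'[symmetric] conj_scale[OF hR point_ideal_subset_R] conjJ ..
    also have "\<dots> = scale (h * conj_el h) (?J \<bullet> ?J')"
      by (simp only: set_prod_scale set_prod_scale_right scale_scale mult.commute)
    also have "h * conj_el h = emb (psi W)" by (simp only: h_def conj_el el_norm psiW)
    also have "scale (emb (psi W)) (?J \<bullet> ?J') = scale (emb ?u) (scale (emb ?u) (scale (emb (cx g)) (scale (emb [:to_fract d:]) R)))"
      unfolding point_ideal_opposite[OF P] N scale_scale by (simp only: emb_simps ac_simps)
    also have "scale (emb [:to_fract d:]) R = R" by (rule scale_const_R) (simp add: nd)
    finally have "I \<bullet> conj_el ` I = scale (emb (cx g)) R" using u0 by (metis scale_cancel)
    then have "normed I g" unfolding normed_def using Is IR g0 by simp
    moreover have h0: "h \<noteq> 0" unfolding h_def using AD(1) by simp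
    then have "?J \<approx> I" unfolding I_def scale_scale using u0 by (intro similar_scale) simp
    ultimately show ?thesis using Affine similar_sym by blast
  qed
qed

lemma prime_elem_monic_irreducible:
  "is_split q \<Longrightarrow> prime_elem q" "is_split q \<Longrightarrow> q \<noteq> 0"
  unfolding is_split_def by (auto simp: irreducible_imp_prime_elem)

text \<open>As q divides B, its degree is 1 or 2. In degree 1 the ideal is a point ideal. In degree
  2 the line y = t(x) meets the curve above the roots of q and in one further point, which is
  rational over Q(T); the ideal has the class of its negative.\<close>

lemma split_point:
  assumes q: "is_split q" and s: "q dvd C - s * s"
  shows "\<exists>P\<in>E. M (cx q) (cx s) \<approx> point_ideal P"
proof -
  have q0: "q \<noteq> 0" and lq: "Polynomial.lead_coeff q = 1" and qB: "q dvd B" and irr: "Factorial_Ring.irreducible q"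
    using q prime_elem_monic_irreducible by (auto simp: is_split_def)
  have dq: "Polynomial.degree q \<le> 2" using dvd_imp_degree_le[OF qB B0] degB by simp
  have dq1: "Polynomial.degree q > 0" using irr q0 is_unit_iff_degree[OF q0] by (auto simp: Factorial_Ring.irreducible_def)
  \<comment> \<open>Reduction modulo q makes t at most linear, so that f - t^2 is still a monic
    cubic.\<close>
  define t where "t = s mod q"
  have st: "q dvd s - t" by (simp add: t_def minus_mod_eq_mult_div)
  have dt: "t = 0 \<or> Polynomial.degree t < Polynomial.degree q" using degree_mod_less[OF q0] by (auto simp: t_def)
  have "q dvd (C - s * s) + (s - t) * (s + t)" using s st by (intro dvd_add dvd_mult2)
  then have qt: "q dvd C - t * t" by (simp add: algebra_simps)
  have "cx q dvd cx s - cx t" using st cx_dvd_iff[OF q0] by (simp add: cx_simps[symmetric] del: psi_simps)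
  then have Mst: "M (cx q) (cx s) = M (cx q) (cx t)" by (rule M_cong)
  have dvd: "cx q dvd f - cx t * cx t" by (rule split_dvd_curve[OF q0 qB qt])
  have on_curve: "(poly v x) ^ 2 = poly f x" if "[:- x, 1:] dvd f - v * v" for v x
    using that by (simp add: power2_eq_square flip: poly_eq_0_iff_dvd)
  consider "Polynomial.degree q = 1" | "Polynomial.degree q = 2" using dq dq1 by linarith
  then show ?thesis
  proof cases
    case 1
    then obtain e where "q = [:e, 1:]" using lq by (metis degree1_coeffs coeff_pCons_0 coeff_pCons_Suc One_nat_def)
    then have cq: "cx q = [:- (- to_fract [:e:]), 1:]" by (simp add: cx_linear)
    let ?x = "- to_fract [:e:]"
    have "M (cx q) (cx s) = point_ideal (Affine ?x (poly (cx t) ?x))"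
      unfolding Mst unfolding cq by (subst M_eval) simp
    moreover have "Affine ?x (poly (cx t) ?x) \<in> E" using on_curve dvd[unfolded cq] by simp
    ultimately show ?thesis using similar_refl by metis
  next
    case 2
    obtain w where w: "f - cx t * cx t = cx q * w" using dvd by (auto elim: dvdE)
    have "Polynomial.degree t \<le> 1" using dt 2 by auto
    then have dtt: "Polynomial.degree (cx t * cx t) < 3" using degree_mult_le[of "cx t" "cx t"] by simp
    have "Polynomial.degree (f - cx t * cx t) = 3"
      using degree_add_eq_left[of "- (cx t * cx t)" f] dtt deg_f by simp
    moreover have "poly.coeff (f - cx t * cx t) 3 = 1" using monic_f deg_f dtt by (simp add: coeff_eq_0)
    ultimately have m: "Polynomial.degree (cx q * w) = 3" "Polynomial.lead_coeff (cx q * w) = 1"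
      unfolding w by simp_all
    then have w0: "w \<noteq> 0" by auto
    have lcq: "Polynomial.lead_coeff (cx q) = 1" using lq by (simp add: cx_coeff one_pCons[symmetric])
    have "Polynomial.degree (cx q * w) = 2 + Polynomial.degree w" using q0 w0 2 by (simp add: degree_mult_eq)
    then have "Polynomial.degree w = 1" using m(1) by simp
    moreover have lw: "Polynomial.lead_coeff w = 1" using m(2) lcq by (simp add: lead_coeff_mult)
    ultimately obtain e where e: "w = [:- (- e), 1:]"
      by (metis degree1_coeffs coeff_pCons_0 coeff_pCons_Suc One_nat_def minus_minus)
    let ?x = "- e" let ?y = "poly (cx t) ?x"
    have wd: "[:- ?x, 1:] dvd f - cx t * cx t" unfolding w e by (rule dvd_triv_right)
    have on: "?y ^ 2 = poly f ?x" using on_curve[OF wd] .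
    have Mw: "M w (cx t) = point_ideal (Affine ?x ?y)" unfolding e by (subst M_eval) simp
    let ?P = "point_ideal (Affine ?x ?y)" and ?P' = "point_ideal (Affine ?x (- ?y))"
    have sub: "is_submodule R (M (cx q) (cx t))" "is_submodule R ?P'"
      using dvd on by (auto intro!: M_submodule point_ideal_submodule simp del: point_ideal.simps)
    have "M (cx q) (cx t) \<bullet> ?P = scale (el (- cx t) 1) R"
      unfolding Mw[symmetric] by (subst M_prod) (simp_all only: w[symmetric] M_full dvd_refl)
    then have prin: "M (cx q) (cx t) \<bullet> ?P \<approx> R" using similar_sym[OF similar_scale[of "el (- cx t) 1" R]] by simp
    have "M (cx q) (cx t) = M (cx q) (cx t) \<bullet> R" using set_prod_R(2)[OF sub(1)] by simp
    also have "\<dots> \<approx> M (cx q) (cx t) \<bullet> (?P \<bullet> ?P')"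
      unfolding point_ideal_opposite[OF on] by (intro similar_prod similar_refl similar_scale) simp
    also have "\<dots> = (M (cx q) (cx t) \<bullet> ?P) \<bullet> ?P'" by (simp only: set_prod_assoc)
    also have "\<dots> \<approx> R \<bullet> ?P'" by (rule similar_prod[OF prin similar_refl])
    also have "\<dots> = ?P'" by (rule set_prod_R(1)[OF sub(2)])
    finally have "M (cx q) (cx s) \<approx> ?P'" unfolding Mst .
    moreover have "Affine ?x (- ?y) \<in> E" using on by simp
    ultimately show ?thesis by blast
  qed
qed

text \<open>The choice of sign selects one of the two primes above q; the other one gives the
  inverse point, by \<open>spt_inv\<close>.\<close>

definition sroot :: "rat poly \<Rightarrow> rat poly" where
  "sroot q = (SOME s. q dvd C - s * s)"

definition spt :: "rat poly \<Rightarrow> rat poly fract ec_point" where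
  "spt q = (SOME P. P \<in> E \<and> M (cx q) (cx (sroot q)) \<approx> point_ideal P)"

lemma sroot: "is_split q \<Longrightarrow> q dvd C - sroot q * sroot q"
  unfolding sroot_def is_split_def by (metis (mono_tags, lifting) someI_ex)

lemma spt: "is_split q \<Longrightarrow> spt q \<in> E" "is_split q \<Longrightarrow> M (cx q) (cx (sroot q)) \<approx> point_ideal (spt q)"
proof -
  assume "is_split q"
  then have "\<exists>P. P \<in> E \<and> M (cx q) (cx (sroot q)) \<approx> point_ideal P" using split_point sroot by blast
  then show "spt q \<in> E" "M (cx q) (cx (sroot q)) \<approx> point_ideal (spt q)"
    unfolding spt_def by (metis (mono_tags, lifting) someI_ex)+
qed

sublocale G: comm_group "ec_group f"
  by (rule comm_group_ec)

lemma ec_group_simps [simp]: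
  "carrier (ec_group f) = E" "P \<otimes>\<^bsub>ec_group f\<^esub> Q = ec_add f P Q" "\<one>\<^bsub>ec_group f\<^esub> = Infinity"
  by (simp_all add: ec_group_def)

text \<open>The two primes above q multiply to the principal ideal (q), so their classes are inverse
  to each other.\<close>

lemma spt_inv:
  assumes "is_split q"
  shows "M (cx q) (- cx (sroot q)) \<approx> point_ideal (inv\<^bsub>ec_group f\<^esub> (spt q))"
proof -
  have "q dvd C - (- sroot q) * (- sroot q)" using sroot[OF assms] by simp
  from split_point[OF assms this] obtain P where P: "P \<in> E" "M (cx q) (- cx (sroot q)) \<approx> point_ideal P"
    unfolding cx_simps by blast
  note i = ec_add_ideal[OF P(1) spt(1)[OF assms]]
  have q: "q \<noteq> 0" "q dvd B" using assms prime_elem_monic_irreducible by (auto simp: is_split_def)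
  have "point_ideal (ec_add f P (spt q)) \<approx> point_ideal P \<bullet> point_ideal (spt q)"
    using i similar_sym by blast
  also have "\<dots> \<approx> M (cx q) (- cx (sroot q)) \<bullet> M (cx q) (cx (sroot q))"
    by (rule similar_prod[OF similar_sym[OF P(2)] similar_sym[OF spt(2)[OF assms]]])
  also have "\<dots> = M (cx q) (cx (sroot q)) \<bullet> M (cx q) (- cx (sroot q))" by (rule set_prod_comm)
  also have "\<dots> \<approx> point_ideal Infinity"
    using M_similar_conj[OF q(1) split_dvd_curve[OF q(1,2) sroot[OF assms]]]
    by (simp only: point_ideal.simps)
  finally have "ec_add f P (spt q) = Infinity"
    by (rule point_ideal_inj[OF conjunct1[OF i] Infinity_in_points])
  then have "P = inv\<^bsub>ec_group f\<^esub> (spt q)"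
    using G.inv_equality[of P "spt q"] P(1) spt(1)[OF assms] by (simp only: ec_group_simps)
  then show ?thesis using P by simp
qed

lemma finite_split: "finite {q. is_split q}"
proof (rule finite_subset)
  show "{q. is_split q} \<subseteq> prime_factors B"
  proof
    fix q assume "q \<in> {q. is_split q}"
    then have q: "is_split q" by simp
    then have "normalize q = q" unfolding is_split_def by (simp add: normalize_poly_eq_map_poly map_poly_idI)
    then have "Factorial_Ring.prime q" using prime_elem_monic_irreducible[OF q] by (simp add: Factorial_Ring.prime_def)
    then show "q \<in> prime_factors B" using q B0 by (auto simp: is_split_def in_prime_factors_iff)
  qed
qed simp

lemma double_in_span:
  assumes "P \<in> E"
  shows "ec_add f P P \<in> G.int_span (spt ` {q. is_split q})"
proof -
  let ?S = "spt ` {q. is_split q}"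
  have S: "?S \<subseteq> carrier (ec_group f)" "finite ?S" using spt(1) finite_split by auto
  note cl = G.int_span_closed[OF S(1), unfolded ec_group_simps]
  obtain I g where I: "normed I g" "I \<approx> point_ideal P" using point_normed[OF assms] by blast
  have "\<exists>Q\<in>G.int_span ?S. I \<bullet> I \<approx> point_ideal Q"
  proof (rule normed_square_class[OF _ _ _ _ I(1)])
    fix q assume q: "is_split q"
    have "spt q \<in> G.int_span ?S" by (rule cl(5)[OF S(2)]) (use q in auto)
    moreover have "inv\<^bsub>ec_group f\<^esub> (spt q) \<in> G.int_span ?S" by (rule cl(3)) fact
    ultimately show "\<exists>s P P'. q dvd C - s * s \<and> P \<in> G.int_span ?S \<and> P' \<in> G.int_span ?S \<and>
      M (cx q) (cx s) \<approx> point_ideal P \<and> M (cx q) (- cx s) \<approx> point_ideal P'"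
      using sroot[OF q] spt(2)[OF q] spt_inv[OF q] by blast
  next
    show "G.int_span ?S \<subseteq> E" using cl(1) by blast
  qed (fact cl(4) cl(2))+
  then obtain Q where Q: "Q \<in> G.int_span ?S" "I \<bullet> I \<approx> point_ideal Q" by blast
  have "point_ideal (ec_add f P P) \<approx> point_ideal P \<bullet> point_ideal P"
    using ec_add_ideal[OF assms assms] similar_sym by blast
  also have "\<dots> \<approx> I \<bullet> I" by (intro similar_prod similar_sym[OF I(2)])
  also have "\<dots> \<approx> point_ideal Q" by (rule Q(2))
  finally have "ec_add f P P = Q"
    by (rule point_ideal_inj[OF conjunct1[OF ec_add_ideal[OF assms assms]] cl(1)[OF Q(1)]])
  then show ?thesis using Q(1) by simp
qed

end

section \<open>Independence and the rank\<close>

context qt_curve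
begin

text \<open>The same cubic over Q[T] with x as outer variable. It is monic of odd degree, as
  \<open>dvd_norm_odd\<close> requires for primes p(T).\<close>

abbreviation "F0 \<equiv> swap_vars F"

lemma map_F0: "map_poly to_fract F0 = f"
  using psi_curve[of C B] by (simp add: psi_def)

lemma degree_F0: "Polynomial.degree F0 = 3" and lead_F0: "Polynomial.lead_coeff F0 = 1"
proof -
  show d: "Polynomial.degree F0 = 3"
    using deg_f degree_map_poly[of to_fract F0] unfolding map_F0[symmetric] by simp
  have "to_fract (Polynomial.lead_coeff F0) = Polynomial.lead_coeff f"
    unfolding d deg_f by (simp add: map_F0[symmetric] coeff_map_poly)
  then show "Polynomial.lead_coeff F0 = 1" using monic_f by (simp flip: to_fract_1)
qed

text \<open>
  A prime \<open>p(T)\<close> dividing \<open>k\<close> divides \<open>A\<close> and \<open>D\<close>, as \<open>f\<close> has odd degree in \<open>x\<close>. Once \<open>k\<close> is constant, the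
  left-hand side would have positive degree in \<open>T\<close> if \<open>D\<close> were nonzero, as \<open>f\<close> has odd degree in \<open>T\<close>.
\<close>

lemma norm_descent:
  assumes "k \<noteq> 0" "g \<noteq> 0" "A * A - D * D * F0 = Polynomial.smult k (const_coeffs g)"
  shows "D = 0"
  using assms(1,3)
proof (induction "Polynomial.degree k" arbitrary: k A D rule: less_induct)
  case less
  show ?case
  proof (cases "Polynomial.degree k = 0")
    case True
    then obtain c where c: "k = [:c:]" by (rule degree_eq_zeroE)
    have "swap_vars (A * A - D * D * F0) = swap_vars (Polynomial.smult k (const_coeffs g))"
      by (simp only: less.prems(2))
    then have e: "swap_vars A * swap_vars A - swap_vars D * swap_vars D * F = [:[:c:] * g:]"
      unfolding c by (simp only: swap_vars_mult swap_vars_diff swap_vars_swap_vars swap_vars_smult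
          swap_vars_const_coeffs const_coeffs_simps) (simp add: mult.commute)
    have odd: "odd (Polynomial.degree F)" using B0 by simp
    show ?thesis
    proof (rule ccontr)
      assume "D \<noteq> 0"
      then have "swap_vars D \<noteq> 0" by simp
      from degree_norm_odd[OF odd this, of "swap_vars A"] show False using odd unfolding e by simp
    qed
  next
    case False
    have "\<not> is_unit k" using False less.prems(1) by (simp add: is_unit_iff_degree)
    then obtain p where p: "prime_elem p" "p dvd k" using prime_divisor_exists[OF less.prems(1)] by auto
    have p0: "p \<noteq> 0" using p by auto
    have N: "[:p:] dvd A * A - D * D * F0" unfolding less.prems(2)
      using p(2) by (auto simp: const_poly_dvd_iff intro: dvd_smult)
    have "odd (Polynomial.degree F0)" unfolding degree_F0 by simp
    moreover have "\<not> p dvd Polynomial.lead_coeff F0"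
      unfolding lead_F0 using p(1) by (simp add: prime_elem_def)
    ultimately have "[:p:] dvd A \<and> [:p:] dvd D" by (rule dvd_norm_odd[OF p(1) _ _ N])
    then obtain A1 D1 where AD: "A = [:p:] * A1" "D = [:p:] * D1" by (auto elim!: dvdE simp del: mult_pCons_left)
    have e: "[:p * p:] * (A1 * A1 - D1 * D1 * F0) = Polynomial.smult k (const_coeffs g)"
      unfolding less.prems(2)[symmetric] AD by (simp add: algebra_simps smult_diff_right)
    obtain i where i: "poly.coeff g i \<noteq> 0" using assms(2) by (auto simp: poly_eq_iff)
    \<comment> \<open>Some coefficient of g is a nonzero rational, so p^2 divides k itself.\<close>
    have "p * p dvd k * [:poly.coeff g i:]"
      using arg_cong[OF e, of "\<lambda>w. poly.coeff w i"] by (simp add: dvd_def) metis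
    then have "p * p dvd k" using dvd_smult_cancel[of "p * p" _ k] i by simp
    then obtain k1 where k1: "k = p * p * k1" by (auto elim: dvdE)
    have "[:p * p:] * (A1 * A1 - D1 * D1 * F0) = [:p * p:] * Polynomial.smult k1 (const_coeffs g)"
      unfolding e k1 by (simp add: mult.commute)
    then have e1: "A1 * A1 - D1 * D1 * F0 = Polynomial.smult k1 (const_coeffs g)"
      using p0 by (metis mult_left_cancel pCons_eq_0_iff mult_eq_0_iff)
    have k10: "k1 \<noteq> 0" using less.prems(1) k1 by auto
    have "Polynomial.degree p > 0" using p(1) p0 is_unit_iff_degree[OF p0] by (auto simp: prime_elem_def)
    then have "Polynomial.degree k1 < Polynomial.degree k" using k1 k10 p0 by (simp add: degree_mult_eq)
    from less.hyps[OF this k10 e1] show ?thesis by (simp add: AD)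
  qed
qed

lemma norm_pure:
  assumes "\<kappa> \<noteq> 0" "g \<noteq> 0" "a * a - b * b * f = Polynomial.smult \<kappa> (cx g)"
  shows "b = 0"
proof -
  obtain c A D where c: "c \<noteq> 0" "Polynomial.smult (to_fract c) a = psi A" "Polynomial.smult (to_fract c) b = psi D"
    by (rule psi_denominator2)
  define W where "W = swap_vars A * swap_vars A - swap_vars D * swap_vars D * F0"
  define \<kappa>' where "\<kappa>' = to_fract c * to_fract c * \<kappa>"
  have "map_poly to_fract W = psi A * psi A - psi D * psi D * f"
    by (simp add: W_def psi_def map_F0)
  also have "\<dots> = Polynomial.smult (to_fract c * to_fract c) (a * a - b * b * f)"
    unfolding c(2)[symmetric] c(3)[symmetric] by (simp add: smult_diff_right)
  finally have W: "map_poly to_fract W = Polynomial.smult \<kappa>' (cx g)" by (simp add: assms(3) \<kappa>'_def)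
  obtain i where i: "poly.coeff g i \<noteq> 0" using assms(2) by (auto simp: poly_eq_iff)
  \<comment> \<open>A nonzero coefficient of g is invertible in Q[T]; comparing coefficients at that
    place shows that the factor \<kappa>' is in fact a polynomial in T.\<close>
  define k where "k = poly.coeff W i * [:inverse (poly.coeff g i):]"
  have "to_fract (poly.coeff W i) = \<kappa>' * to_fract [:poly.coeff g i:]"
    using arg_cong[OF W, of "\<lambda>w. poly.coeff w i"] by (simp add: coeff_map_poly cx_coeff)
  then have "to_fract k = \<kappa>' * (to_fract [:poly.coeff g i:] * to_fract [:inverse (poly.coeff g i):])"
    unfolding k_def to_fract_mult by simp
  also have "to_fract [:poly.coeff g i:] * to_fract [:inverse (poly.coeff g i):] = 1"
    using i by (simp flip: to_fract_mult one_pCons)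
  finally have k: "to_fract k = \<kappa>'" by simp
  have "map_poly to_fract W = map_poly to_fract (Polynomial.smult k (const_coeffs g))"
    unfolding W k[symmetric] cx_const by simp
  then have "W = Polynomial.smult k (const_coeffs g)" by (simp only: fract_poly_eq_iff)
  moreover have "k \<noteq> 0" using k assms(1) c(1) by (auto simp: \<kappa>'_def)
  ultimately have "swap_vars D = 0" using norm_descent assms(2) unfolding W_def by blast
  then have "psi D = 0" by simp
  then show ?thesis using c by simp
qed

text \<open>A prime q of Q[x] remains prime in Q[x][T], and clearing denominators carries this over
  to Q(T)[x].\<close>

lemma prime_cx:
  assumes q: "prime_elem q" and dvd: "cx q dvd x * y"
  shows "cx q dvd x \<or> cx q dvd y"
proof -
  have q0: "q \<noteq> 0" using q by auto
  obtain c A D where c: "c \<noteq> 0" "Polynomial.smult (to_fract c) x = psi A" "Polynomial.smult (to_fract c) y = psi D"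
    by (rule psi_denominator2)
  have "psi (A * D) = Polynomial.smult (to_fract c * to_fract c) (x * y)"
    unfolding psi_simps c(2,3)[symmetric] by simp
  then have "cx q dvd psi (A * D)" using dvd by (simp only: dvd_smult)
  then have "[:q:] dvd A \<or> [:q:] dvd D"
    using psi_dvd_iff[OF q0] prime_elem_const_poly[OF q] prime_elem_dvd_multD by blast
  then have "cx q dvd Polynomial.smult (to_fract c) x \<or> cx q dvd Polynomial.smult (to_fract c) y"
    unfolding c using psi_dvd_iff[OF q0] by simp
  then show ?thesis using dvd_smult_cancel[of "cx q" "to_fract c"] c(1) by auto
qed

text \<open>
  A substitute for the valuation at the prime ideal \<open>(q, y + \<sigma>)\<close>: the property is multiplicative in \<open>P\<close>
  and \<open>g\<close>, and fails for \<^const>\<open>Infinity\<close> if \<open>q\<close> divides \<open>g\<close>.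
\<close>

definition avoids :: "rat poly \<Rightarrow> rat poly \<Rightarrow> rat poly fract ec_point \<Rightarrow> rat poly \<Rightarrow> bool" where
  "avoids q \<sigma> P g \<longleftrightarrow> (\<exists>I. normed I g \<and> point_ideal P \<approx> I \<and> \<not> I \<subseteq> M (cx q) (- cx \<sigma>))"

text \<open>The ideal (q, y + \<sigma>) is prime: it is the kernel of y -> - \<sigma> modulo q. So a
  product of two elements outside it is again outside.\<close>

lemma avoids_mult:
  assumes q: "prime_elem q" "cx q dvd f - cx \<sigma> * cx \<sigma>"
    and P: "P \<in> E" "avoids q \<sigma> P g" and Q: "Q \<in> E" "avoids q \<sigma> Q h"
  shows "avoids q \<sigma> (ec_add f P Q) (g * h)"
proof -
  obtain I x where I: "normed I g" "point_ideal P \<approx> I" "x \<in> I" "x \<notin> M (cx q) (- cx \<sigma>)"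
    using P(2) by (auto simp: avoids_def)
  obtain J y where J: "normed J h" "point_ideal Q \<approx> J" "y \<in> J" "y \<notin> M (cx q) (- cx \<sigma>)"
    using Q(2) by (auto simp: avoids_def)
  obtain a b where ab: "x = el a b" using normedD(2)[OF I(1)] I(3) RE by blast
  obtain c d where cd: "y = el c d" using normedD(2)[OF J(1)] J(3) RE by blast
  have "\<not> cx q dvd (a + b * - cx \<sigma>) * (c + d * - cx \<sigma>)"
    using prime_cx[OF q(1)] I(4) J(4) unfolding ab cd M_mem by blast
  moreover have "(a * c + b * d * f) + (a * d + b * c) * - cx \<sigma> =
    (a + b * - cx \<sigma>) * (c + d * - cx \<sigma>) + b * d * (f - cx \<sigma> * cx \<sigma>)"
    by (simp add: algebra_simps)
  ultimately have "x * y \<notin> M (cx q) (- cx \<sigma>)" unfolding ab cd el_mult M_mem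
    using dvd_add_left_iff[OF dvd_mult[OF q(2), of "b * d"]] by metis
  moreover have "x * y \<in> I \<bullet> J" using I(3) J(3) by (rule set_prodI)
  moreover have "point_ideal (ec_add f P Q) \<approx> point_ideal P \<bullet> point_ideal Q"
    using ec_add_ideal[OF P(1) Q(1)] similar_sym by blast
  then have "point_ideal (ec_add f P Q) \<approx> I \<bullet> J"
    using similar_prod[OF I(2) J(2)] by (rule similar_trans)
  ultimately show ?thesis unfolding avoids_def using normed_prod[OF I(1) J(1)] by blast
qed

lemma avoids_Infinity:
  assumes "prime_elem q" shows "avoids q \<sigma> Infinity 1"
proof -
  have q0: "q \<noteq> 0" using assms by auto
  have "\<not> [:q:] dvd 1" using prime_elem_const_poly[OF assms] by (simp add: prime_elem_def)
  then have "\<not> cx q dvd psi 1" using psi_dvd_iff[OF q0] by blast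
  then have "el 1 0 \<notin> M (cx q) (- cx \<sigma>)" by (simp del: el_1)
  then have "\<not> R \<subseteq> M (cx q) (- cx \<sigma>)" using el_in_R by blast
  then show ?thesis unfolding avoids_def using normed_R by (intro exI[of _ R]) simp
qed

lemma avoids_pow:
  assumes q: "prime_elem q" "cx q dvd f - cx \<sigma> * cx \<sigma>" and P: "P \<in> E" "avoids q \<sigma> P g"
  shows "avoids q \<sigma> (P [^]\<^bsub>ec_group f\<^esub> (n::nat)) (g ^ n)"
proof (induction n)
  case 0
  then show ?case using avoids_Infinity[OF q(1)] by simp
next
  case (Suc n)
  have "P [^]\<^bsub>ec_group f\<^esub> n \<in> E" using G.nat_pow_closed[of P n] P(1) by simp
  from avoids_mult[OF q this Suc P] show ?case by (simp add: mult.commute)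
qed

lemma avoids_int_pow:
  assumes q: "prime_elem q" "cx q dvd f - cx \<sigma> * cx \<sigma>" and P: "P \<in> E"
    and a: "n \<ge> 0 \<Longrightarrow> avoids q \<sigma> P g" "n < 0 \<Longrightarrow> avoids q \<sigma> (inv\<^bsub>ec_group f\<^esub> P) g"
  shows "avoids q \<sigma> (P [^]\<^bsub>ec_group f\<^esub> (n::int)) (g ^ nat \<bar>n\<bar>)"
proof (cases "n \<ge> 0")
  case True
  then obtain m where m: "n = int m" by (rule nonneg_int_cases)
  show ?thesis using avoids_pow[OF q P a(1)[OF True], of m] unfolding m int_pow_int by simp
next
  case False
  have inv: "inv\<^bsub>ec_group f\<^esub> P \<in> E" using G.inv_closed P by simp
  obtain m where m: "n = - int m" using False by (metis int_cases2 linorder_not_le of_nat_0_le_iff)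
  have Pc: "P \<in> carrier (ec_group f)" using P by simp
  have "P [^]\<^bsub>ec_group f\<^esub> n = (inv\<^bsub>ec_group f\<^esub> P) [^]\<^bsub>ec_group f\<^esub> m"
    unfolding m G.int_pow_neg_int[OF Pc] G.nat_pow_inv[OF Pc] ..
  moreover have "n < 0" using False by simp
  ultimately show ?thesis using avoids_pow[OF q inv a(2), of m] by (simp add: m)
qed

lemma split_dvd_split:
  assumes "is_split q" "is_split p" "q dvd p" shows "p = q"
proof -
  obtain r where r: "p = q * r" using assms(3) by (auto elim: dvdE)
  have "\<not> is_unit q" using prime_elem_monic_irreducible[OF assms(1)] by (simp add: prime_elem_def)
  then have "is_unit r" using assms(2) r by (metis irreducibleD is_split_def)
  then obtain c where c: "r = [:c:]" by (metis is_unit_polyE)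
  moreover have "Polynomial.lead_coeff r = 1" using assms(1,2) r by (simp add: is_split_def lead_coeff_mult)
  ultimately show ?thesis using r by simp
qed

text \<open>If n q is nonzero, the sign of \<sigma> is chosen so that the power of
  \<open>spt q\<close> is represented by a power of (q, y - \<sigma>), which avoids (q, y +
  \<sigma>); the factors from other p avoid it because q does not divide p. Their product is
  principal with norm divisible by q, and \<open>norm_pure\<close> puts its generator in Q(T)[x], so
  q divides the generator and the ideal lies in (q, y + \<sigma>) after all.\<close>

lemma split_finprod_eq_one:
  assumes one: "finprod (ec_group f) (\<lambda>q. spt q [^]\<^bsub>ec_group f\<^esub> n q) {q. is_split q} = \<one>\<^bsub>ec_group f\<^esub>"
    and q: "is_split q"
  shows "n q = (0::int)"
proof (rule ccontr)
  assume n0: "n q \<noteq> 0"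
  let ?Spl = "{q. is_split q}"
  let ?P = "\<lambda>q. spt q [^]\<^bsub>ec_group f\<^esub> n q"
  have pq: "prime_elem q" and q0: "q \<noteq> 0" and qB: "q dvd B"
    and nqC: "\<not> q dvd C"
    using q prime_elem_monic_irreducible by (auto simp: is_split_def)
  define \<sigma> where "\<sigma> = (if n q > 0 then sroot q else - sroot q)"
  have q\<sigma>: "q dvd C - \<sigma> * \<sigma>" using sroot[OF q] by (simp add: \<sigma>_def)
  have c\<sigma>: "cx q dvd f - cx \<sigma> * cx \<sigma>" by (rule split_dvd_curve[OF q0 qB q\<sigma>])
  have E: "spt p \<in> E" "inv\<^bsub>ec_group f\<^esub> (spt p) \<in> E" if "is_split p" for p
    using spt(1)[OF that] G.inv_closed[of "spt p"] by simp_all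
  have norm: "normed (M (cx p) (cx (sroot p))) p" "normed (M (cx p) (- cx (sroot p))) p" if p: "is_split p" for p
  proof -
    have "p \<noteq> 0" "p dvd B" using p prime_elem_monic_irreducible by (auto simp: is_split_def)
    from split_dvd_curve[OF this sroot[OF p]] \<open>p \<noteq> 0\<close>
    show "normed (M (cx p) (cx (sroot p))) p" "normed (M (cx p) (- cx (sroot p))) p" by (auto intro!: normed_M)
  qed
  have other: "avoids q \<sigma> (?P p) (p ^ nat \<bar>n p\<bar>)" if p: "is_split p" "p \<noteq> q" for p
  proof (rule avoids_int_pow[OF pq c\<sigma> E(1)[OF p(1)]])
    have "p \<noteq> 0" using prime_elem_monic_irreducible[OF p(1)] by simp
    have "\<not> q dvd p" using split_dvd_split[OF q p(1)] p(2) by blast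
    then have "el (cx p) 0 \<notin> M (cx q) (- cx \<sigma>)" using cx_dvd_iff[OF q0] by simp
    moreover have "el (cx p) 0 \<in> M (cx p) v" for v by simp
    ultimately have ns: "\<not> M (cx p) v \<subseteq> M (cx q) (- cx \<sigma>)" for v by blast
    show "avoids q \<sigma> (spt p) p"
      unfolding avoids_def using norm(1)[OF p(1)] similar_sym[OF spt(2)[OF p(1)]] ns by blast
    show "avoids q \<sigma> (inv\<^bsub>ec_group f\<^esub> (spt p)) p"
      unfolding avoids_def using norm(2)[OF p(1)] similar_sym[OF spt_inv[OF p(1)]] ns by blast
  qed
  have self: "avoids q \<sigma> (?P q) (q ^ nat \<bar>n q\<bar>)"
  proof (rule avoids_int_pow[OF pq c\<sigma> E(1)[OF q]])
    \<comment> \<open>The two primes above q are distinct: otherwise q divides \<sigma> and hence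
      C.\<close>
    have "\<not> q dvd \<sigma> + \<sigma>"
    proof
      assume "q dvd \<sigma> + \<sigma>"
      then have "q dvd Polynomial.smult 2 \<sigma>" by (simp add: smult_2)
      then have "q dvd \<sigma>" by (rule dvd_smult_cancel) simp
      then have "q dvd (C - \<sigma> * \<sigma>) + \<sigma> * \<sigma>" using q\<sigma> by (intro dvd_add) auto
      then show False using nqC by simp
    qed
    then have "\<not> cx q dvd - (cx \<sigma> + cx \<sigma>)" using cx_dvd_iff[OF q0, of "\<sigma> + \<sigma>"] by (simp only: cx_simps dvd_minus_iff) simp
    moreover have "- cx \<sigma> + 1 * - cx \<sigma> = - (cx \<sigma> + cx \<sigma>)" by simp
    ultimately have "el (- cx \<sigma>) 1 \<notin> M (cx q) (- cx \<sigma>)" unfolding M_mem by metis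
    moreover have "el (- cx \<sigma>) 1 \<in> M (cx q) (cx \<sigma>)" by simp
    ultimately have ns: "\<not> M (cx q) (cx \<sigma>) \<subseteq> M (cx q) (- cx \<sigma>)" by blast
    show "avoids q \<sigma> (spt q) q" if "n q \<ge> 0"
    proof -
      have "\<sigma> = sroot q" using that n0 by (simp add: \<sigma>_def)
      then show ?thesis
        unfolding avoids_def using norm(1)[OF q] similar_sym[OF spt(2)[OF q]] ns by blast
    qed
    show "avoids q \<sigma> (inv\<^bsub>ec_group f\<^esub> (spt q)) q" if "n q < 0"
    proof -
      have "cx \<sigma> = - cx (sroot q)" using that by (simp add: \<sigma>_def cx_simps)
      then show ?thesis
        unfolding avoids_def using norm(2)[OF q] similar_sym[OF spt_inv[OF q]] ns by metis
    qed
  qed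
  have PE: "?P p \<in> E" if "is_split p" for p
    using G.int_pow_closed[of "spt p" "n p"] E(1)[OF that] by simp
  \<comment> \<open>The norm of the remaining product may be anything; its divisibility by q will
    come from the factor at q alone.\<close>
  have "\<exists>g. avoids q \<sigma> (finprod (ec_group f) ?P A) g" if "finite A" "A \<subseteq> ?Spl - {q}" for A
    using that
  proof (induction A rule: finite_induct)
    case empty
    then show ?case using avoids_Infinity[OF pq] by auto
  next
    case (insert p A)
    have pi: "?P \<in> A \<rightarrow> carrier (ec_group f)" "?P p \<in> carrier (ec_group f)" using PE insert by auto
    obtain g where g: "avoids q \<sigma> (finprod (ec_group f) ?P A) g" using insert by auto
    have "finprod (ec_group f) ?P A \<in> E" using G.finprod_closed[OF pi(1)] by simp
    moreover have "?P p \<in> E" "avoids q \<sigma> (?P p) (p ^ nat \<bar>n p\<bar>)" using other[of p] PE insert by auto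
    ultimately have "avoids q \<sigma> (ec_add f (?P p) (finprod (ec_group f) ?P A)) (p ^ nat \<bar>n p\<bar> * g)"
      using g by (intro avoids_mult[OF pq c\<sigma>])
    moreover have "finprod (ec_group f) ?P (insert p A) = ec_add f (?P p) (finprod (ec_group f) ?P A)"
      using G.finprod_insert[OF insert.hyps pi] by simp
    ultimately show ?case by metis
  qed
  from this[of "?Spl - {q}"] obtain g0 where g0: "avoids q \<sigma> (finprod (ec_group f) ?P (?Spl - {q})) g0"
    using finite_split by auto
  have pi: "?P \<in> ?Spl - {q} \<rightarrow> carrier (ec_group f)" "?P q \<in> carrier (ec_group f)" using PE q by auto
  have fE: "finprod (ec_group f) ?P (?Spl - {q}) \<in> E" using G.finprod_closed[OF pi(1)] by simp
  have "finprod (ec_group f) ?P (insert q (?Spl - {q})) = ec_add f (?P q) (finprod (ec_group f) ?P (?Spl - {q}))"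
    using G.finprod_insert[OF _ _ pi] finite_split by simp
  moreover have "insert q (?Spl - {q}) = ?Spl" using q by auto
  ultimately have "ec_add f (?P q) (finprod (ec_group f) ?P (?Spl - {q})) = Infinity" using one by simp
  then have "avoids q \<sigma> Infinity (q ^ nat \<bar>n q\<bar> * g0)"
    using avoids_mult[OF pq c\<sigma> PE[OF q] self fE g0] by simp
  then obtain I where I: "normed I (q ^ nat \<bar>n q\<bar> * g0)" "R \<approx> I" "\<not> I \<subseteq> M (cx q) (- cx \<sigma>)"
    by (auto simp: avoids_def)
  define g where "g = q ^ nat \<bar>n q\<bar> * g0"
  have qg: "q dvd g" using n0 unfolding g_def by (intro dvd_mult2 dvd_power) auto
  note nI = normedD[OF I(1), folded g_def]
  obtain c where c: "I = scale c R" using I(2) unfolding similar_def by blast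
  have "c * 1 \<in> scale c R" by (intro imageI) simp
  then have "c \<in> R" using c nI(2) by auto
  then obtain a b where ab: "c = el a b" by (rule RE)
  have nd: "cx g dvd a * a - b * b * f" "a * a - b * b * f dvd cx g"
    using norm_R_dvd[OF _ nI(4), of a b] c ab by simp_all
  then obtain u where u: "a * a - b * b * f = cx g * u" by (auto elim: dvdE)
  have "cx g * u dvd cx g * 1" using nd(2) unfolding u by simp
  then have "is_unit u" using nI(3) by (simp only: dvd_mult_cancel_left) simp
  then obtain \<kappa> where \<kappa>: "u = [:\<kappa>:]" "\<kappa> \<noteq> 0" 
    using is_unit_polyE[of u] by (metis dvd_0_left_iff zero_neq_one)
  have "b = 0" by (rule norm_pure[OF \<kappa>(2) nI(3), of a]) (simp add: u \<kappa>)
  then have "cx g dvd a * a" using nd(1) by simp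
  then have "cx q dvd a * a" using qg cx_dvd_iff[OF q0] dvd_trans by blast
  then have "cx q dvd a" using prime_cx[OF pq] by blast
  moreover have "I \<subseteq> M (cx q) (- cx \<sigma>)"
  proof
    fix z assume "z \<in> I"
    then obtain w where w: "w \<in> R" "z = el a 0 * w" unfolding c ab \<open>b = 0\<close> by blast
    from w(1) obtain x y where "w = el x y" by (rule RE)
    then have "z = el a 0 * el x y" using w(2) by simp
    then have z: "z = el (a * x) (a * y)" by (simp add: el_mult)
    have "cx q dvd a * x + a * y * - cx \<sigma>" using \<open>cx q dvd a\<close> by (intro dvd_add dvd_mult2)
    then show "z \<in> M (cx q) (- cx \<sigma>)" unfolding z M_mem .
  qed
  ultimately show False using I(3) by simp
qed

text \<open>Two equal points would give a relation with exponents 1 and -1.\<close>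

lemma spt_inj: "inj_on spt {q. is_split q}"
proof (rule inj_onI, rule ccontr)
  fix p q assume pq: "p \<in> {q. is_split q}" "q \<in> {q. is_split q}" "spt p = spt q" "p \<noteq> q"
  define n :: "rat poly \<Rightarrow> int" where "n r = (if r = p then 1 else if r = q then - 1 else 0)" for r
  let ?P = "\<lambda>r. spt r [^]\<^bsub>ec_group f\<^esub> n r"
  have E: "spt r \<in> carrier (ec_group f)" if "r \<in> {q. is_split q}" for r using spt(1) that by simp
  have "finprod (ec_group f) ?P {q. is_split q} = finprod (ec_group f) ?P {p, q}"
    by (rule G.finprod_mono_neutral_cong_right) (use pq E finite_split in \<open>auto simp: n_def simp del: ec_group_simps\<close>)
  also have "\<dots> = ?P p \<otimes>\<^bsub>ec_group f\<^esub> ?P q"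
    using pq E by (subst G.finprod_insert) (auto simp del: ec_group_simps)
  also have "\<dots> = \<one>\<^bsub>ec_group f\<^esub>"
    using pq E[of q] by (simp add: n_def G.int_pow_neg del: ec_group_simps)
  finally have "n p = 0" using split_finprod_eq_one pq(1) by blast
  then show False by (simp add: n_def)
qed

theorem group_rank_curve: "group_rank (ec_group f) = enat (card {q. is_split q})"
proof -
  let ?S = "{q. is_split q}"
  have S: "spt ` ?S \<subseteq> carrier (ec_group f)" using spt(1) by auto
  have "Z_independent (ec_group f) (spt ` ?S)"
    unfolding Z_independent_def
  proof (intro conjI allI impI ballI)
    fix n :: "rat poly fract ec_point \<Rightarrow> int" and P
    assume one: "finprod (ec_group f) (\<lambda>P. P [^]\<^bsub>ec_group f\<^esub> n P) (spt ` ?S) = \<one>\<^bsub>ec_group f\<^esub>" and P: "P \<in> spt ` ?S"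
    have "finprod (ec_group f) (\<lambda>q. spt q [^]\<^bsub>ec_group f\<^esub> n (spt q)) ?S = \<one>\<^bsub>ec_group f\<^esub>"
      unfolding one[symmetric] using S
      by (intro G.finprod_reindex[symmetric] spt_inj) (auto simp del: ec_group_simps)
    from split_finprod_eq_one[OF this] P show "n P = 0" by auto
  qed (use S finite_split in auto)
  then have "group_rank (ec_group f) = enat (card (spt ` ?S))"
    using double_in_span by (intro G.group_rank_eqI) auto
  then show ?thesis using card_image[OF spt_inj] by simp
qed

text \<open>Distinct split polynomials are coprime, so they can be divided out of k one after the
  other, each lowering the degree by at least 1.\<close>

lemma card_split_le_degree:
  assumes "finite A" "A \<subseteq> {q. is_split q}" "k \<noteq> 0" "\<And>q. q \<in> A \<Longrightarrow> q dvd k"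
  shows "card A \<le> Polynomial.degree k"
  using assms
proof (induction A arbitrary: k rule: finite_induct)
  case (insert q A)
  have q: "is_split q" using insert by simp
  obtain k' where k': "k = q * k'" using insert.prems(3)[of q] by (auto elim: dvdE)
  have "p dvd k'" if "p \<in> A" for p
  proof -
    have p: "is_split p" "p \<noteq> q" using that insert by auto
    then have "\<not> p dvd q" using split_dvd_split[OF p(1) q] by blast
    moreover have "p dvd q * k'" using insert.prems(3)[of p] that k' by simp
    ultimately show ?thesis using prime_elem_monic_irreducible(1)[OF p(1)] by (meson prime_elem_dvd_multD)
  qed
  then have "card A \<le> Polynomial.degree k'" using insert k' by auto
  moreover have "Polynomial.degree q > 0"
    using prime_elem_monic_irreducible[OF q] is_unit_iff_degree[of q] by (auto simp: prime_elem_def)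
  moreover have "Polynomial.degree k = Polynomial.degree q + Polynomial.degree k'"
    using insert.prems(2) unfolding k' by (intro degree_mult_eq) auto
  ultimately show ?case using insert by simp
qed simp

lemma card_split_le: "card {q. is_split q} \<le> 2"
  using card_split_le_degree[OF finite_split subset_refl B0] degB by (force simp: is_split_def)

end

section \<open>Galois orbits\<close>

lemma eval_ac_simps [simp]:
  "eval_ac 0 \<theta> = 0" "eval_ac 1 \<theta> = 1" "eval_ac (pCons c p) \<theta> = to_ac c + \<theta> * eval_ac p \<theta>"
  by (simp_all add: eval_ac_def map_poly_pCons)

lemma eval_ac_add [simp]: "eval_ac (p + q) \<theta> = eval_ac p \<theta> + eval_ac q \<theta>"
  by (induction p q rule: poly_induct2) (simp_all add: algebra_simps)

lemma eval_ac_smult [simp]: "eval_ac (Polynomial.smult c p) \<theta> = to_ac c * eval_ac p \<theta>"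
  by (induction p) (simp_all add: algebra_simps)

lemma eval_ac_mult [simp]: "eval_ac (p * q) \<theta> = eval_ac p \<theta> * eval_ac q \<theta>"
  by (induction p) (simp_all add: algebra_simps)

lemma eval_ac_diff [simp]: "eval_ac (p - q) \<theta> = eval_ac p \<theta> - eval_ac q \<theta>"
  using eval_ac_add[of "p - q" q \<theta>] by (simp add: eq_diff_eq del: eval_ac_add)

text \<open>If q did not divide p, a Bezout relation u p + v q = 1 evaluated at \<theta> would
  exclude a common root.\<close>

lemma root_dvd_iff:
  assumes "prime_elem q" "eval_ac q \<theta> = 0"
  shows "eval_ac p \<theta> = 0 \<longleftrightarrow> q dvd p"
proof
  assume p: "eval_ac p \<theta> = 0"
  show "q dvd p"
  proof (rule ccontr)
    assume "\<not> q dvd p"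
    then obtain u v where "u * p + v * q = 1" using prime_elem_bezout[OF assms(1)] by blast
    then have "eval_ac (u * p + v * q) \<theta> = 1" by simp
    then show False using p assms(2) by simp
  qed
qed (use assms(2) in \<open>auto elim: dvdE\<close>)

lemma minimal_polynomial:
  obtains q where "prime_elem q" "Polynomial.lead_coeff q = 1" "eval_ac q \<theta> = 0"
proof -
  obtain p :: "rat poly" where p: "p \<noteq> 0" "eval_ac p \<theta> = 0"
    using alg_closure_algebraic[of \<theta>] unfolding eval_ac_def by blast
  have "\<exists>q'. prime_elem q' \<and> eval_ac q' \<theta> = 0"
    using p
  proof (induction "Polynomial.degree p" arbitrary: p rule: less_induct)
    case less
    have nu: "\<not> is_unit p"
    proof
      assume "is_unit p"
      then obtain k where "1 = p * k" by (auto elim: dvdE)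
      then have "eval_ac (p * k) \<theta> = 1" by (metis eval_ac_simps(2))
      then show False using less.prems by simp
    qed
    then obtain q where q: "prime_elem q" "q dvd p" using prime_divisor_exists[OF less.prems(1)] by auto
    then obtain k where k: "p = q * k" by (auto elim: dvdE)
    show ?case
    proof (cases "eval_ac q \<theta> = 0")
      case False
      have "q \<noteq> 0" using q by auto
      then have "Polynomial.degree q > 0" using q is_unit_iff_degree[of q] by (auto simp: prime_elem_def)
      then have "Polynomial.degree k < Polynomial.degree p"
        using less.prems(1) k by (auto simp: degree_mult_eq)
      then show ?thesis using less.hyps[of k] less.prems False k by auto
    qed (use q in blast)
  qed
  then obtain q' where q': "prime_elem q'" "eval_ac q' \<theta> = 0" by blast
  then show ?thesis using that monic_prime_elem[OF q'(1)] by (metis eval_ac_smult mult_zero_right)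
qed

text \<open>
  Graphs of ring homomorphisms over \<open>\<rat>\<close> between subrings of the algebraic closure. As all elements
  are algebraic, such homomorphisms are injective, so the notion is symmetric.
\<close>

definition hom_graph :: "(rat alg_closure \<times> rat alg_closure) set \<Rightarrow> bool" where
  "hom_graph \<Gamma> \<longleftrightarrow> (\<forall>c. (to_ac c, to_ac c) \<in> \<Gamma>) \<and>
    (\<forall>a b c d. (a, b) \<in> \<Gamma> \<longrightarrow> (c, d) \<in> \<Gamma> \<longrightarrow> (a + c, b + d) \<in> \<Gamma> \<and> (a * c, b * d) \<in> \<Gamma>) \<and>
    (\<forall>b. (0, b) \<in> \<Gamma> \<longrightarrow> b = 0)"

lemma hom_graphD:
  assumes "hom_graph \<Gamma>"
  shows "(to_ac c, to_ac c) \<in> \<Gamma>" "(a, b) \<in> \<Gamma> \<Longrightarrow> (c', d) \<in> \<Gamma> \<Longrightarrow> (a + c', b + d) \<in> \<Gamma>"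
    "(a, b) \<in> \<Gamma> \<Longrightarrow> (c', d) \<in> \<Gamma> \<Longrightarrow> (a * c', b * d) \<in> \<Gamma>" "(0, b) \<in> \<Gamma> \<Longrightarrow> b = 0"
    "(0, 0) \<in> \<Gamma>" "(1, 1) \<in> \<Gamma>"
  using assms unfolding hom_graph_def by (blast, blast, blast, blast, metis to_ac_0, metis to_ac_1)

lemma hom_graph_diff:
  assumes "hom_graph \<Gamma>" "(a, b) \<in> \<Gamma>" "(c, d) \<in> \<Gamma>" shows "(a - c, b - d) \<in> \<Gamma>"
proof -
  have "(to_ac (- 1) * c, to_ac (- 1) * d) \<in> \<Gamma>" using hom_graphD(1,3)[OF assms(1)] assms(3) by blast
  from hom_graphD(2)[OF assms(1,2) this] show ?thesis by simp
qed

lemma hom_graph_eval: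
  assumes "hom_graph \<Gamma>" "(a, b) \<in> \<Gamma>" shows "(eval_ac p a, eval_ac p b) \<in> \<Gamma>"
  by (induction p) (auto intro: hom_graphD[OF assms(1)] assms(2))

text \<open>Applying the minimal polynomial q of a nonzero a to the pair (a, 0) gives (0, q(0)), so
  q(0) = 0. Then q / X still vanishes at a, against minimality.\<close>

lemma hom_graph_inj:
  assumes "hom_graph \<Gamma>" "(a, 0) \<in> \<Gamma>" shows "a = 0"
proof (rule ccontr)
  assume a: "a \<noteq> 0"
  obtain q where q: "prime_elem q" "eval_ac q a = 0" by (rule minimal_polynomial)
  obtain c r where cr: "q = pCons c r" by (rule pCons_cases)
  have "(0, eval_ac q 0) \<in> \<Gamma>" using hom_graph_eval[OF assms, of q] q by simp
  from hom_graphD(4)[OF assms(1) this] have "c = 0" by (simp add: cr)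
  then have "eval_ac r a = 0" using q(2) a by (simp add: cr)
  then have "q dvd r" using root_dvd_iff[OF q] by blast
  moreover have "r \<noteq> 0" using q(1) cr \<open>c = 0\<close> by auto
  ultimately have "Polynomial.degree q \<le> Polynomial.degree r" by (rule dvd_imp_degree_le)
  then show False using cr \<open>r \<noteq> 0\<close> by simp
qed

lemma hom_graph_converse: "hom_graph \<Gamma> \<Longrightarrow> hom_graph (\<Gamma>\<inverse>)"
  using hom_graph_inj unfolding hom_graph_def[of "\<Gamma>\<inverse>"] by (auto dest: hom_graphD)

lemma hom_graph_unique: "hom_graph \<Gamma> \<Longrightarrow> (a, b) \<in> \<Gamma> \<Longrightarrow> (a, c) \<in> \<Gamma> \<Longrightarrow> b = c"
  using hom_graph_diff[of \<Gamma> a b a c] hom_graphD(4)[of \<Gamma> "b - c"] by simp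

lemma hom_graph_sum:
  "hom_graph \<Gamma> \<Longrightarrow> (\<And>i. i \<in> A \<Longrightarrow> (g i, h i) \<in> \<Gamma>) \<Longrightarrow> (sum g A, sum h A) \<in> \<Gamma>"
  by (induction A rule: infinite_finite_induct) (auto intro: hom_graphD)

text \<open>The usual extension of an embedding to one more algebraic element: take a polynomial m
  of least degree over the domain with root a, transport its coefficients to m', and send a to a
  root b of m'. As the domain is only a ring, pseudo-division replaces division by m.\<close>

lemma hom_graph_extend:
  assumes \<Gamma>: "hom_graph \<Gamma>"
  obtains b \<Gamma>' where "hom_graph \<Gamma>'" "\<Gamma> \<subseteq> \<Gamma>'" "(a, b) \<in> \<Gamma>'"
proof -
  \<comment> \<open>p' is the image of p under the homomorphism, coefficient by coefficient.\<close>
  define Pol where "Pol p p' \<longleftrightarrow> (\<forall>i. (poly.coeff p i, poly.coeff p' i) \<in> \<Gamma>)" for p p'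
  have Pol_const: "Pol [:c:] [:d:]" if "(c, d) \<in> \<Gamma>" for c d
    using that hom_graphD(5)[OF \<Gamma>] by (auto simp: Pol_def coeff_pCons split: nat.splits)
  have Pol_add: "Pol (p + q) (p' + q')" if "Pol p p'" "Pol q q'" for p q p' q'
    using that hom_graphD(2)[OF \<Gamma>] by (auto simp: Pol_def)
  have Pol_diff: "Pol (p - q) (p' - q')" if "Pol p p'" "Pol q q'" for p q p' q'
    using that hom_graph_diff[OF \<Gamma>] by (auto simp: Pol_def)
  have Pol_mult: "Pol (p * q) (p' * q')" if "Pol p p'" "Pol q q'" for p q p' q'
    using that hom_graphD(3)[OF \<Gamma>] unfolding Pol_def coeff_mult by (auto intro!: hom_graph_sum[OF \<Gamma>])
  have Pol_monom: "Pol (Polynomial.monom 1 k) (Polynomial.monom 1 k)" for k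
    using hom_graphD(5,6)[OF \<Gamma>] by (auto simp: Pol_def coeff_monom)
  have Pol_0: "p' = 0" if "Pol 0 p'" for p'
    using that hom_graphD(4)[OF \<Gamma>] by (auto simp: Pol_def poly_eq_iff)
  obtain r :: "rat poly" where r: "r \<noteq> 0" "poly (map_poly to_ac r) a = 0" by (rule alg_closure_algebraic)
  let ?good = "\<lambda>(m, m'). Pol m m' \<and> m \<noteq> 0 \<and> poly m a = 0"
  have "map_poly to_ac r \<noteq> 0" using r(1) by (auto simp: poly_eq_iff coeff_map_poly)
  then have ex: "?good (map_poly to_ac r, map_poly to_ac r)"
    using r(2) hom_graphD(1)[OF \<Gamma>] by (auto simp: Pol_def coeff_map_poly)
  define mm where "mm = arg_min (\<lambda>(m, m'). Polynomial.degree m) ?good"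
  obtain m m' where mm': "mm = (m, m')" by (cases mm)
  have m: "Pol m m'" "m \<noteq> 0" "poly m a = 0"
    using arg_min_nat_lemma[of ?good, OF ex, of "\<lambda>(m, m'). Polynomial.degree m"] mm' unfolding mm_def by auto
  have min: "Polynomial.degree m \<le> Polynomial.degree p" if "Pol p p'" "p \<noteq> 0" "poly p a = 0" for p p'
  proof -
    have "(case mm of (m, m') \<Rightarrow> Polynomial.degree m) \<le> (case (p, p') of (m, m') \<Rightarrow> Polynomial.degree m)"
      unfolding mm_def by (rule arg_min_nat_le) (use that in simp)
    then show ?thesis by (simp add: mm')
  qed
  have lm': "poly.coeff m' (Polynomial.degree m) \<noteq> 0"
    using hom_graph_inj[OF \<Gamma>, of "Polynomial.lead_coeff m"] m(1,2) unfolding Pol_def by (metis leading_coeff_0_iff)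
  have dm: "Polynomial.degree m > 0"
  proof (rule ccontr)
    assume "\<not> 0 < Polynomial.degree m"
    then obtain c where "m = [:c:]" using degree_eq_zeroE by blast
    then show False using m by simp
  qed
  have "Polynomial.degree m' > 0" using le_degree[OF lm'] dm by linarith
  then obtain b where b: "poly m' b = 0" using alg_closed_imp_poly_has_root by blast
  have key: "poly p' b = 0" if "Pol p p'" "poly p a = 0" for p p'
    using that
  proof (induction "Polynomial.degree p" arbitrary: p p' rule: less_induct)
    case less
    show ?case
    proof (cases "p = 0")
      case True
      then show ?thesis using Pol_0[of p'] less.prems(1) by simp
    next
      case False
      define k where "k = Polynomial.degree p - Polynomial.degree m"
      have dp: "Polynomial.degree p = k + Polynomial.degree m" using min less.prems False by (simp add: k_def)
      define lp where "lp = Polynomial.lead_coeff p"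
      define lp' where "lp' = poly.coeff p' (Polynomial.degree p)"
      define lm where "lm = Polynomial.lead_coeff m"
      define lm' where "lm' = poly.coeff m' (Polynomial.degree m)"
      have "(lp, lp') \<in> \<Gamma>" "(lm, lm') \<in> \<Gamma>"
        using less.prems(1) m(1) by (auto simp: Pol_def lp_def lp'_def lm_def lm'_def)
      \<comment> \<open>One step of pseudo-division cancels the top coefficient of p, and the same
        step is performed on p'. The factor lm' is nonzero by injectivity, so p'(b) = 0 can be
        recovered.\<close>
      define s where "s = [:lm:] * p - [:lp:] * (Polynomial.monom 1 k * m)"
      define s' where "s' = [:lm':] * p' - [:lp':] * (Polynomial.monom 1 k * m')"
      have Ps: "Pol s s'" unfolding s_def s'_def
        by (intro Pol_diff Pol_mult Pol_const Pol_monom less.prems m) fact+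
      have "Polynomial.degree s \<le> Polynomial.degree p"
        unfolding s_def
      proof (rule degree_diff_le)
        show "Polynomial.degree ([:lm:] * p) \<le> Polynomial.degree p" by (simp add: degree_smult_le)
        have "Polynomial.degree ([:lp:] * (Polynomial.monom 1 k * m)) \<le> Polynomial.degree (Polynomial.monom 1 k * m)"
          by (simp add: degree_smult_le)
        also have "\<dots> \<le> k + Polynomial.degree m"
          by (rule order_trans[OF degree_mult_le]) (simp add: degree_monom_le)
        finally show "Polynomial.degree ([:lp:] * (Polynomial.monom 1 k * m)) \<le> Polynomial.degree p" by (simp add: dp)
      qed
      moreover have "poly.coeff s (Polynomial.degree p) = 0"
        by (simp add: s_def lp_def lm_def dp coeff_monom_mult)
      ultimately have "s = 0 \<or> Polynomial.degree s < Polynomial.degree p" by (rule eq_zero_or_degree_less)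
      then have ds: "Polynomial.degree s < Polynomial.degree p" using dp dm by auto
      have "poly s a = 0" using less.prems(2) m(3) by (simp add: s_def)
      from less.hyps[OF ds Ps this] have "lm' * poly p' b = 0" using b by (simp add: s'_def)
      then show ?thesis using lm' by (simp add: lm'_def)
    qed
  qed
  define \<Gamma>' where "\<Gamma>' = {(poly p a, poly p' b) | p p'. Pol p p'}"
  have sub: "\<Gamma> \<subseteq> \<Gamma>'"
  proof safe
    fix c d assume "(c, d) \<in> \<Gamma>"
    then show "(c, d) \<in> \<Gamma>'" using Pol_const[of c d] unfolding \<Gamma>'_def by force
  qed
  have "hom_graph \<Gamma>'"
    unfolding hom_graph_def
  proof (intro conjI allI impI)
    show "(to_ac c, to_ac c) \<in> \<Gamma>'" for c using sub hom_graphD(1)[OF \<Gamma>] by blast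
    show "(c + c', d + d') \<in> \<Gamma>'" if cd: "(c, d) \<in> \<Gamma>'" "(c', d') \<in> \<Gamma>'" for c d c' d'
    proof -
      obtain p p' q q' where "Pol p p'" "Pol q q'" "c = poly p a" "d = poly p' b" "c' = poly q a" "d' = poly q' b"
        using cd unfolding \<Gamma>'_def by blast
      then show ?thesis using Pol_add[of p p' q q'] unfolding \<Gamma>'_def by (auto simp flip: poly_add)
    qed
    show "(c * c', d * d') \<in> \<Gamma>'" if cd: "(c, d) \<in> \<Gamma>'" "(c', d') \<in> \<Gamma>'" for c d c' d'
    proof -
      obtain p p' q q' where "Pol p p'" "Pol q q'" "c = poly p a" "d = poly p' b" "c' = poly q a" "d' = poly q' b"
        using cd unfolding \<Gamma>'_def by blast
      then show ?thesis using Pol_mult[of p p' q q'] unfolding \<Gamma>'_def by (auto simp flip: poly_mult)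
    qed
    show "d = 0" if "(0, d) \<in> \<Gamma>'" for d
    proof -
      obtain p p' where "Pol p p'" "poly p a = 0" "d = poly p' b" using \<open>(0, d) \<in> \<Gamma>'\<close> unfolding \<Gamma>'_def by auto
      then show ?thesis using key by simp
    qed
  qed
  moreover have "(a, b) \<in> \<Gamma>'"
    using Pol_monom[of 1] unfolding \<Gamma>'_def by (force simp: poly_monom)
  ultimately show ?thesis using that sub by blast
qed

section \<open>Galois orbits as root sets of irreducible polynomials\<close>

lemma Gal_Q_iff:
  "\<sigma> \<in> Gal_Q \<longleftrightarrow> (\<forall>x y. \<sigma> (x + y) = \<sigma> x + \<sigma> y) \<and> (\<forall>x y. \<sigma> (x * y) = \<sigma> x * \<sigma> y) \<and> bij \<sigma> \<and>
    (\<forall>q. \<sigma> (to_ac q) = to_ac q)"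
  unfolding Gal_Q_def ring_iso_def ring_hom_def ring_of_type_algebra_def
  by (auto dest: spec[of _ "1 :: rat"])

text \<open>Automorphisms commute with evaluation, which gives one inclusion. Conversely \<theta> ->
  t defines a homomorphism graph on Q[\<theta>]; a maximal graph above it, from Zorn's lemma, is
  total by \<open>hom_graph_extend\<close>.\<close>

lemma Gal_orbit_eq:
  assumes q: "prime_elem q" "eval_ac q \<theta> = 0"
  shows "Gal_orbit \<theta> = {t. eval_ac q t = 0}"
proof
  show "Gal_orbit \<theta> \<subseteq> {t. eval_ac q t = 0}"
  proof (clarsimp simp: Gal_orbit_def)
    fix \<sigma> assume \<sigma>: "\<sigma> \<in> Gal_Q"
    then have "\<sigma> 0 = 0" unfolding Gal_Q_iff by (metis to_ac_0)
    moreover have "\<sigma> (eval_ac p \<theta>) = eval_ac p (\<sigma> \<theta>)" for p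
      using \<sigma> \<open>\<sigma> 0 = 0\<close> by (induction p) (simp_all add: Gal_Q_iff)
    ultimately show "eval_ac q (\<sigma> \<theta>) = 0" using q(2) by metis
  qed
  show "{t. eval_ac q t = 0} \<subseteq> Gal_orbit \<theta>"
  proof safe
    fix t assume t: "eval_ac q t = 0"
    define \<Gamma>0 where "\<Gamma>0 = range (\<lambda>p. (eval_ac p \<theta>, eval_ac p t))"
    have g0: "hom_graph \<Gamma>0"
      unfolding hom_graph_def
    proof (intro conjI allI impI)
      show "(to_ac c, to_ac c) \<in> \<Gamma>0" for c
        unfolding \<Gamma>0_def by (rule image_eqI[of _ _ "[:c:]"]) auto
      show "(a + c, b + d) \<in> \<Gamma>0" if "(a, b) \<in> \<Gamma>0" "(c, d) \<in> \<Gamma>0" for a b c d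
        using that unfolding \<Gamma>0_def by (auto simp flip: eval_ac_add)
      show "(a * c, b * d) \<in> \<Gamma>0" if "(a, b) \<in> \<Gamma>0" "(c, d) \<in> \<Gamma>0" for a b c d
        using that unfolding \<Gamma>0_def by (auto simp flip: eval_ac_mult)
      show "b = 0" if "(0, b) \<in> \<Gamma>0" for b
        using that root_dvd_iff[OF q] root_dvd_iff[OF q(1) t] unfolding \<Gamma>0_def by (auto dest: sym)
    qed
    let ?A = "{\<Gamma>. hom_graph \<Gamma> \<and> \<Gamma>0 \<subseteq> \<Gamma>}"
    have "\<exists>M\<in>?A. \<forall>N\<in>?A. M \<subseteq> N \<longrightarrow> N = M"
    proof (rule subset_Zorn_nonempty)
      show "?A \<noteq> {}" using g0 by blast
    next
      fix \<C> assume ne: "\<C> \<noteq> {}" and ch: "subset.chain ?A \<C>"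
      have gr: "hom_graph \<Gamma>" "\<Gamma>0 \<subseteq> \<Gamma>" if "\<Gamma> \<in> \<C>" for \<Gamma> using ch that by (auto simp: subset.chain_def)
      have two: "\<exists>\<Gamma>\<in>\<C>. x \<in> \<Gamma> \<and> y \<in> \<Gamma>" if "x \<in> \<Union>\<C>" "y \<in> \<Union>\<C>" for x y
        using that ch unfolding subset_chain_def by blast
      have "hom_graph (\<Union>\<C>)"
        unfolding hom_graph_def
      proof (intro conjI allI impI)
        show "(to_ac c, to_ac c) \<in> \<Union>\<C>" for c using ne gr(1) hom_graphD(1) by blast
        show "(a + c, b + d) \<in> \<Union>\<C>" "(a * c, b * d) \<in> \<Union>\<C>" if "(a, b) \<in> \<Union>\<C>" "(c, d) \<in> \<Union>\<C>" for a b c d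
          using two[OF that] gr(1) hom_graphD(2,3) by blast+
        show "b = 0" if "(0, b) \<in> \<Union>\<C>" for b using that gr(1) hom_graphD(4) by blast
      qed
      then show "\<Union>\<C> \<in> ?A" using ne gr(2) by blast
    qed
    then obtain M where M: "hom_graph M" "\<Gamma>0 \<subseteq> M" "\<And>N. hom_graph N \<Longrightarrow> M \<subseteq> N \<Longrightarrow> N = M"
      by (smt (verit) mem_Collect_eq subset_trans)
    have dom: "\<exists>b. (a, b) \<in> M" for a
      by (rule hom_graph_extend[OF M(1), of a]) (use M(3) in blast)
    \<comment> \<open>Surjectivity is totality of the converse graph, whose maximality follows from
      that of M.\<close>
    have ran: "\<exists>a. (a, b) \<in> M" for b
    proof (rule hom_graph_extend[OF hom_graph_converse[OF M(1)], of b])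
      fix a N assume N: "hom_graph N" "M\<inverse> \<subseteq> N" "(b, a) \<in> N"
      then have "N\<inverse> = M" by (intro M(3) hom_graph_converse) auto
      then show ?thesis using N(3) by blast
    qed
    define \<sigma> where "\<sigma> a = (SOME b. (a, b) \<in> M)" for a
    have \<sigma>: "(a, \<sigma> a) \<in> M" for a unfolding \<sigma>_def using dom by (rule someI_ex)
    have \<sigma>_eq: "\<sigma> a = b" if "(a, b) \<in> M" for a b using hom_graph_unique[OF M(1) \<sigma> that] .
    have "\<sigma> \<in> Gal_Q"
      unfolding Gal_Q_iff
    proof (intro conjI allI bijI surjI injI)
      show "\<sigma> (x + y) = \<sigma> x + \<sigma> y" for x y by (intro \<sigma>_eq hom_graphD(2)[OF M(1)] \<sigma>)
      show "\<sigma> (x * y) = \<sigma> x * \<sigma> y" for x y by (intro \<sigma>_eq hom_graphD(3)[OF M(1)] \<sigma>)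
      show "\<sigma> (to_ac r) = to_ac r" for r by (intro \<sigma>_eq hom_graphD(1)[OF M(1)])
      show "x = y" if "\<sigma> x = \<sigma> y" for x y
        using hom_graph_unique[OF hom_graph_converse[OF M(1)], of "\<sigma> x" x y] \<sigma>[of x] \<sigma>[of y] that by simp
      show "\<sigma> (SOME a. (a, b) \<in> M) = b" for b using someI_ex[OF ran[of b]] by (rule \<sigma>_eq)
    qed
    moreover have "\<sigma> \<theta> = t"
    proof (rule \<sigma>_eq)
      have "(eval_ac [:0, 1:] \<theta>, eval_ac [:0, 1:] t) \<in> M" using M(2) unfolding \<Gamma>0_def by blast
      then show "(\<theta>, t) \<in> M" by simp
    qed
    ultimately show "t \<in> Gal_orbit \<theta>" unfolding Gal_orbit_def by blast
  qed
qed

text \<open>As \<theta> is algebraic, Q[\<theta>] is already a field: Bezout with the minimal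
  polynomial provides inverses.\<close>

lemma Q_adjoin_eq: "Q_adjoin \<theta> = range (\<lambda>p. eval_ac p \<theta>)"
proof -
  let ?R = "ring_of_type_algebra :: rat alg_closure ring"
  interpret R: field ?R by (rule field_from_type_algebra)
  have simps [simp]: "\<one>\<^bsub>?R\<^esub> = 1" "\<zero>\<^bsub>?R\<^esub> = 0" "x \<oplus>\<^bsub>?R\<^esub> y = x + y" "x \<otimes>\<^bsub>?R\<^esub> y = x * y" "carrier ?R = UNIV" for x y
    by (simp_all add: ring_of_type_algebra_def)
  have minus: "\<ominus>\<^bsub>?R\<^esub> x = - x" for x
    by (rule R.minus_equality) simp_all
  have inv: "inv\<^bsub>?R\<^esub> x = inverse x" if "x \<noteq> 0" for x
    by (rule R.comm_inv_char) (use that in simp_all)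
  obtain q where q: "prime_elem q" "eval_ac q \<theta> = 0" by (rule minimal_polynomial)
  show ?thesis
  proof
    show "Q_adjoin \<theta> \<subseteq> range (\<lambda>p. eval_ac p \<theta>)"
    proof
      fix x assume "x \<in> Q_adjoin \<theta>"
      then show "x \<in> range (\<lambda>p. eval_ac p \<theta>)"
        unfolding Q_adjoin_def
      proof induction
        case one
        show ?case by (rule image_eqI[of _ _ 1]) auto
      next
        case (incl h)
        then consider "h = \<theta>" | c where "h = to_ac c" by blast
        then show ?case
          by cases (auto intro: image_eqI[of _ _ "[:0, 1:]"] image_eqI[of _ _ "[:_:]"])
      next
        case (a_inv h)
        then obtain p where "h = eval_ac p \<theta>" by blast
        then show ?case unfolding minus by (intro image_eqI[of _ _ "0 - p"]) (simp_all del: diff_0)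
      next
        case (m_inv h)
        then obtain p where p: "h = eval_ac p \<theta>" by blast
        have h: "h \<noteq> 0" using m_inv by simp
        then have "\<not> q dvd p" using root_dvd_iff[OF q] p by blast
        then obtain u v where "u * p + v * q = 1" using prime_elem_bezout[OF q(1)] by blast
        then have "eval_ac (u * p + v * q) \<theta> = 1" by simp
        then have "eval_ac u \<theta> * h = 1" using q(2) p by simp
        then have "inverse h = eval_ac u \<theta>" using h by (metis inverse_unique mult.commute)
        then show ?case using inv[OF h] by simp
      next
        case (eng_add h k)
        then show ?case by (auto simp flip: eval_ac_add)
      next
        case (eng_mult h k)
        then show ?case by (auto simp flip: eval_ac_mult)
      qed
    qed
    have "eval_ac p \<theta> \<in> Q_adjoin \<theta>" for p
    proof (induction p)
      case 0
      have "to_ac 0 \<in> Q_adjoin \<theta>" unfolding Q_adjoin_def by (rule generate_field.incl) blast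
      then show ?case by simp
    next
      case (pCons c p)
      have "to_ac c \<in> Q_adjoin \<theta>" "\<theta> \<in> Q_adjoin \<theta>" unfolding Q_adjoin_def by (rule generate_field.incl, blast)+
      then show ?case
        using pCons generate_field.eng_add[of _ ?R] generate_field.eng_mult[of _ ?R] unfolding Q_adjoin_def
        by (metis simps(3,4) eval_ac_simps(3))
    qed
    then show "range (\<lambda>p. eval_ac p \<theta>) \<subseteq> Q_adjoin \<theta>" by blast
  qed
qed

section \<open>Split factors and orbits of roots of B\<close>

context qt_curve
begin

lemma split_root:
  assumes "is_split q" obtains \<theta> where "eval_ac q \<theta> = 0"
proof -
  have "Polynomial.degree q > 0"
    using prime_elem_monic_irreducible[OF assms] is_unit_iff_degree[of q] by (auto simp: prime_elem_def)
  then have "Polynomial.degree (map_poly to_ac q) > 0" by (simp add: degree_map_poly)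
  then show ?thesis using that alg_closed_imp_poly_has_root unfolding eval_ac_def by blast
qed

text \<open>An orbit corresponds to its minimal polynomial q. Conditions at \<theta> become
  divisibility by q, and a square root of C(\<theta>) in Q(\<theta>) = Q[\<theta>] is the value of a
  polynomial s with q dividing C - s^2.\<close>

lemma square_value_orbits_eq:
  "square_value_orbits B C = (\<lambda>q. {t. eval_ac q t = 0}) ` {q. is_split q}" (is "_ = ?Z ` _")
proof
  show "square_value_orbits B C \<subseteq> ?Z ` {q. is_split q}"
  proof
    fix O' assume "O' \<in> square_value_orbits B C"
    then obtain \<theta> p where \<theta>: "O' = Gal_orbit \<theta>" "eval_ac B \<theta> = 0" "eval_ac C \<theta> \<noteq> 0" "eval_ac C \<theta> = (eval_ac p \<theta>)^2"
      unfolding square_value_orbits_def Q_adjoin_eq by auto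
    obtain q where q: "prime_elem q" "Polynomial.lead_coeff q = 1" "eval_ac q \<theta> = 0" by (rule minimal_polynomial)
    note r = root_dvd_iff[OF q(1,3)]
    have "q dvd B" "\<not> q dvd C" "q dvd C - p * p"
      using \<theta> by (simp_all add: r[symmetric] power2_eq_square)
    then have "is_split q" using q unfolding is_split_def by (auto intro: prime_elem_imp_irreducible)
    then show "O' \<in> ?Z ` {q. is_split q}" using Gal_orbit_eq[OF q(1,3)] \<theta>(1) by blast
  qed
  show "?Z ` {q. is_split q} \<subseteq> square_value_orbits B C"
  proof safe
    fix q assume q: "is_split q"
    note pq = prime_elem_monic_irreducible[OF q]
    obtain \<theta> where \<theta>: "eval_ac q \<theta> = 0" using split_root[OF q] by blast
    note r = root_dvd_iff[OF pq(1) \<theta>]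
    obtain s where s: "q dvd C - s * s" using q unfolding is_split_def by blast
    have "eval_ac B \<theta> = 0" "eval_ac C \<theta> \<noteq> 0" "eval_ac C \<theta> = (eval_ac s \<theta>)^2"
      using q s r[of "C - s * s"] r[of B] r[of C] by (auto simp: is_split_def power2_eq_square)
    then show "?Z q \<in> square_value_orbits B C"
      unfolding square_value_orbits_def Q_adjoin_eq using Gal_orbit_eq[OF pq(1) \<theta>] by blast
  qed
qed

lemma card_square_value_orbits: "card (square_value_orbits B C) = card {q. is_split q}"
  unfolding square_value_orbits_eq
proof (intro card_image inj_onI)
  fix p q assume pq: "p \<in> {q. is_split q}" "q \<in> {q. is_split q}" "{t. eval_ac p t = 0} = {t. eval_ac q t = 0}"
  obtain \<theta> where \<theta>: "eval_ac q \<theta> = 0" using split_root pq(2) by blast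
  then have "eval_ac p \<theta> = 0" using pq(3) by blast
  then have "q dvd p" using root_dvd_iff[OF _ \<theta>] prime_elem_monic_irreducible pq(2) by blast
  then show "p = q" using split_dvd_split pq by blast
qed

end

section \<open>Examples\<close>

lemma coeff_curve_BC: "poly.coeff (curve_BC B C) i = to_fract [:poly.coeff C i, poly.coeff B i:]"
  by (simp add: psi_curve[symmetric] psi_def coeff_map_poly swap_vars_pCons)
    (simp flip: to_fract_add to_fract_mult)

text \<open>The discriminant is a polynomial in T, so it is nonzero as soon as one specialisation T
  = t has nonzero discriminant.\<close>

lemma qt_curveI:
  fixes B C :: "rat poly" and t :: rat
  defines "a i \<equiv> poly.coeff C i + t * poly.coeff B i"
  assumes "B \<noteq> 0" "Polynomial.degree B \<le> 2" "Polynomial.degree C = 3" "Polynomial.lead_coeff C = 1"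
    and disc: "16 * ((a 2)^2 * (a 1)^2 - 4 * (a 1)^3 - 4 * (a 2)^3 * a 0 - 27 * (a 0)^2 + 18 * a 2 * a 1 * a 0) \<noteq> 0"
  shows "qt_curve B C"
proof
  let ?f = "curve_BC B C"
  let ?c = "\<lambda>i. [:poly.coeff C i, poly.coeff B i:]"
  have "poly.coeff ?f i = 0" if "i > 3" for i
    using that assms(3,4) by (simp add: coeff_curve_BC coeff_eq_0)
  then have "Polynomial.degree ?f \<le> 3" by (intro degree_le) auto
  moreover have c3: "poly.coeff ?f 3 = 1"
    using assms(3,4,5) by (simp add: coeff_curve_BC coeff_eq_0 one_pCons[symmetric])
  then have "Polynomial.degree ?f \<ge> 3" by (intro le_degree) simp
  ultimately have d: "Polynomial.degree ?f = 3" by simp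
  define P where "P = 16 * ((?c 2)^2 * (?c 1)^2 - 4 * (?c 1)^3 - 4 * (?c 2)^3 * ?c 0 - 27 * (?c 0)^2 + 18 * ?c 2 * ?c 1 * ?c 0)"
  have tn: "to_fract (numeral n) = numeral n" for n :: num
    by (metis of_nat_fract of_nat_numeral to_fract_def)
  have tp: "to_fract (p ^ n) = to_fract p ^ n" for p :: "rat poly" and n
    by (induction n) simp_all
  have "weierstrass_disc ?f = to_fract P"
    unfolding P_def weierstrass_disc_def Let_def coeff_curve_BC
    by (simp only: to_fract_mult to_fract_diff to_fract_add tp tn)
  moreover have "poly P t \<noteq> 0" using disc
    by (simp only: P_def a_def poly_mult poly_add poly_diff poly_power poly_numeral poly_pCons poly_0
        mult_zero_right add_0_right not_False_eq_True)
  then have "P \<noteq> 0" by auto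
  ultimately show "is_elliptic ?f" using d c3 unfolding is_elliptic_def by simp
qed (use assms in auto)

context qt_curve
begin

lemma is_split_linear:
  assumes "poly B e = 0" "poly C e = 1" shows "is_split [:- e, 1:]"
proof -
  have "Factorial_Ring.irreducible [:- e, 1:]" by (rule irreducible_linear_field_poly) simp
  moreover have "[:- e, 1:] dvd C - 1 * 1" using assms by (simp flip: poly_eq_0_iff_dvd)
  then have "\<exists>s. [:- e, 1:] dvd C - s * s" by blast
  ultimately show ?thesis using assms unfolding is_split_def by (simp flip: poly_eq_0_iff_dvd)
qed

lemma split_dvd_linear:
  assumes q: "is_split q" "q dvd [:- e, 1:]" shows "q = [:- e, 1:]"
proof -
  have "q \<noteq> 0" "Polynomial.degree q \<noteq> 0"
    using prime_elem_monic_irreducible[OF q(1)] is_unit_iff_degree[of q] by (auto simp: prime_elem_def)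
  moreover have "Polynomial.degree q \<le> 1" using dvd_imp_degree_le[OF q(2)] by simp
  ultimately have d: "Polynomial.degree q = 1" by simp
  then obtain a b where ab: "q = [:a, b:]" by (metis degree1_coeffs)
  then have b: "b = 1" using q(1) d by (simp add: is_split_def)
  obtain k where "[:- e, 1:] = q * k" using q(2) by (rule dvdE)
  then have "poly [:- e, 1:] (- a) = poly q (- a) * poly k (- a)" by (simp only: poly_mult)
  then have "poly [:- e, 1:] (- a) = 0" by (simp add: ab b)
  then show ?thesis using ab b by (simp add: add_eq_0_iff)
qed

end

theorem theorem3p2:
  shows
    "(\<forall>B C :: rat poly.
        B \<noteq> 0 \<and> Polynomial.degree B \<le> 2 \<and>
        Polynomial.degree C = 3 \<and> Polynomial.lead_coeff C = 1 \<and>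
        is_elliptic (curve_BC B C) \<longrightarrow>
          group_rank (ec_group (curve_BC B C)) = enat (card (square_value_orbits B C)) \<and>
          group_rank (ec_group (curve_BC B C)) \<le> 2) \<and>
     (\<forall>r \<in> {0, 1, 2 :: enat}. \<exists>B C :: rat poly.
        B \<noteq> 0 \<and> Polynomial.degree B \<le> 2 \<and>
        Polynomial.degree C = 3 \<and> Polynomial.lead_coeff C = 1 \<and>
        is_elliptic (curve_BC B C) \<and>
        group_rank (ec_group (curve_BC B C)) = r)"
proof (intro conjI allI impI ballI)
  fix B C :: "rat poly"
  assume "B \<noteq> 0 \<and> Polynomial.degree B \<le> 2 \<and>
        Polynomial.degree C = 3 \<and> Polynomial.lead_coeff C = 1 \<and> is_elliptic (curve_BC B C)"
  then interpret qt_curve B C by unfold_locales auto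
  show "group_rank (ec_group (curve_BC B C)) = enat (card (square_value_orbits B C))"
    by (simp add: group_rank_curve card_square_value_orbits)
  show "group_rank (ec_group (curve_BC B C)) \<le> 2"
    using card_split_le by (simp add: group_rank_curve numeral_eq_enat)
next
  fix r :: enat assume r: "r \<in> {0, 1, 2}"
  show "\<exists>B C :: rat poly. B \<noteq> 0 \<and> Polynomial.degree B \<le> 2 \<and>
        Polynomial.degree C = 3 \<and> Polynomial.lead_coeff C = 1 \<and>
        is_elliptic (curve_BC B C) \<and> group_rank (ec_group (curve_BC B C)) = r"
  proof -
    consider "r = 0" | "r = 1" | "r = 2" using r by blast
    then show ?thesis
    proof cases
      case 1
      \<comment> \<open>The curve y^2 = x^3 + T: a constant B has no roots.\<close>
      have "qt_curve [:1:] [:0, 0, 0, 1:]" by (rule qt_curveI[where t = 1]) (simp_all add: numeral_2_eq_2 power3_eq_cube)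
      then interpret qt_curve "[:1:]" "[:0, 0, 0, 1:]" .
      have "{q. is_split q} = {}"
        unfolding is_split_def by (auto simp: one_pCons[symmetric])
      then show ?thesis
        using B0 degB degC monicC ell group_rank_curve 1 by (metis card.empty zero_enat_def)
    next
      case 2
      \<comment> \<open>The curve y^2 = x^3 + T x + 1: the only root of B is 0, and C(0) =
        1.\<close>
      have "qt_curve [:0, 1:] [:1, 0, 0, 1:]" by (rule qt_curveI[where t = 1]) (simp_all add: numeral_2_eq_2 power3_eq_cube)
      then interpret qt_curve "[:0, 1:]" "[:1, 0, 0, 1:]" .
      have "{q. is_split q} = {[:- 0, 1:]}"
      proof safe
        fix q assume q: "is_split q"
        then have "q dvd [:- 0, 1:]" by (simp add: is_split_def)
        then show "q = [:- 0, 1:]" by (rule split_dvd_linear[OF q])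
      qed (rule is_split_linear, simp_all)
      then have "card {q. is_split q} = 1" by simp
      then show ?thesis using B0 degB degC monicC ell group_rank_curve 2 by (metis one_enat_def)
    next
      case 3
      \<comment> \<open>B = x^2 - x has the roots 0 and 1, and C = x^3 - x + 1 takes the value 1 at
        both.\<close>
      have "qt_curve [:0, -1, 1:] [:1, -1, 0, 1:]" by (rule qt_curveI[where t = 0]) (simp_all add: numeral_2_eq_2 power3_eq_cube)
      then interpret qt_curve "[:0, -1, 1:]" "[:1, -1, 0, 1:]" .
      have "q = [:- 0, 1:] \<or> q = [:- 1, 1:]" if q: "is_split q" for q
      proof -
        have "q dvd [:0, -1, 1:]" using q by (simp only: is_split_def)
        also have "[:0, -1, 1:] = [:- 0, 1:] * [:- 1, 1 :: rat:]" by simp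
        finally have "q dvd [:- 0, 1:] \<or> q dvd [:- 1, 1:]"
          by (rule prime_elem_dvd_multD[OF prime_elem_monic_irreducible(1)[OF q]])
        then show ?thesis using split_dvd_linear[OF q] by blast
      qed
      moreover have "is_split [:- 0, 1:]" "is_split [:- 1, 1:]" by (rule is_split_linear; simp)+
      ultimately have "{q. is_split q} = {[:- 0, 1:], [:- 1, 1:]}" by blast
      then have "card {q. is_split q} = 2" by simp
      then show ?thesis using B0 degB degC monicC ell group_rank_curve 3 by (metis numeral_eq_enat of_nat_numeral)
    qed
  qed
qed

end
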